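(* Let $r\geq 1$ be an integer. If two graphs of order at most $2^{r+3}-1$ (on the same vertex set) are LU-equivalent, then they are LC$_r$-equivalent.
   Context: All graphs are finite, simple and undirected, on a totally ordered vertex set $V$; the order of a graph is $n=|V|$. The graph state of $G$ is the $n$-qubit state $|G\rangle=\frac{1}{\sqrt{2^n}}\sum_{x\in\{0,1\}^n}(-1)^{|G[x]|}|x\rangle$, where qubits are indexed by $V$, $x$ is identified with the subset of vertices of which it is the indicator, and $|G[x]|$ is the number of edges of the subgraph of $G$ induced by $x$. Two graphs on the same vertex set are LU-equivalent if there is a local unitary $U=\bigotimes_{u\in V}U_u$, each $U_u$ a single-qubit unitary, with $|G_2\rangle=U|G_1\rangle$. They are LC$_r$-equivalent if there is such a local unitary in which each $U_u$ is generated by $H$ and $Z(\pi/2^r)$, where $Z(\alpha)=\mathrm{diag}(1,e^{i\alpha})$; equivalently (known theorem), if $G_2$ is obtained from $G_1$ by a sequence of $r$-local complementations, defined as follows. $\Lambda_G^D$ is the set of vertices adjacent in $G$ to all vertices of $D$. A multiset $S$ of vertices is identified with its multiplicity function $V\to\mathbb{N}$, $\mathrm{supp}(S)=\{u: S(u)>0\}$, $S\bullet\Lambda_G^D=\sum_{u\in\Lambda_G^D}S(u)$, and $S$ is independent if no two vertices of $\mathrm{supp}(S)$ are adjacent. $S$ is $r$-incident in $G$ if for every integer $k$ with $0\leq k<r$ and every $K\subseteq V\setminus\mathrm{supp}(S)$ with $|K|=k+2$, $S\bullet\Lambda_G^K$ is a multiple of $2^{r-k-\delta(k)}$, where $\delta(0)=1$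 and $\delta(k)=0$ for $k\neq0$. For an $r$-incident independent multiset $S$, the $r$-local complementation $G\star^rS$ is the graph on $V$ in which, for $u\neq v$, $u\sim_{G\star^rS}v\Leftrightarrow(u\sim_Gv\ \oplus\ S\bullet\Lambda_G^{\{u,v\}}=2^{r-1}\bmod 2^r)$. *)

theory Defs
  imports
    "HOL-Analysis.Analysis"
    "Graph_Theory.Pair_Digraph"
    "Graph_Theory.Digraph_Component"
begin

text \<open>
  A finite simple undirected graph is a \<open>pair_graph\<close>: finite, loop-free, without parallel arcs,
  and with a symmetric arc relation, so that an undirected edge \<open>{u, v}\<close> is a pair of opposite arcs.
\<close>

definition undirected_edges :: "('a, 'b) pre_digraph \<Rightarrow> 'a set set" where
  "undirected_edges H = {{u, v} | u v. (u, v) \<in> arcs_ends H}"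


text \<open>
  A vector of the \<open>n\<close>-qubit space with qubits indexed by a finite set \<open>V\<close> is given by its amplitudes
  in the computational basis. A basis label in \<open>{0, 1}\<^sup>V\<close> is identified with the subset of \<open>V\<close> of
  which it is the indicator; amplitudes are \<open>0\<close> at sets that are not subsets of \<open>V\<close>, which makes
  equality of functions the same as equality of state vectors.
\<close>

type_synonym 'a state = "'a set \<Rightarrow> complex"

definition graph_state :: "'a pair_pre_digraph \<Rightarrow> 'a state" where
  "graph_state G = (\<lambda>x. if x \<subseteq> pverts G
     then complex_of_real (1 / sqrt (2 ^ card (pverts G)))
            * (- 1) ^ card (undirected_edges (with_proj G \<restriction> x))
     else 0)"


text \<open>
  Single-qubit operators are \<open>2 \<times> 2\<close> matrices with rows and columns indexed by \<open>bool\<close>, where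
  \<open>False\<close> stands for the basis vector \<open>|0>\<close> and \<open>True\<close> for \<open>|1>\<close>.
\<close>

type_synonym gate = "complex ^ bool ^ bool"

definition adjoint_gate :: "gate \<Rightarrow> gate" where
  "adjoint_gate A = (\<chi> i j. cnj (A $ j $ i))"

definition unitary_gate :: "gate \<Rightarrow> bool" where
  "unitary_gate A \<longleftrightarrow> adjoint_gate A ** A = mat 1 \<and> A ** adjoint_gate A = mat 1"

definition hadamard_gate :: gate where
  "hadamard_gate = (\<chi> i j. (if i \<and> j then - 1 else 1) / complex_of_real (sqrt 2))"

definition Z_gate :: "real \<Rightarrow> gate" where
  "Z_gate \<alpha> = (\<chi> i j. if i = j then (if i then cis \<alpha> else 1) else 0)"

text \<open>
  The group generated by \<open>H\<close> and \<open>Z(\<pi>/2\<^sup>r)\<close>. Both generators have finite order, so closure under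
  products already gives closure under inverses, see \<open>adjoint_in_generated_gates\<close> below.
\<close>

inductive_set generated_gates :: "nat \<Rightarrow> gate set" for r :: nat where
  one: "mat 1 \<in> generated_gates r"
| H: "hadamard_gate \<in> generated_gates r"
| Z: "Z_gate (pi / 2 ^ r) \<in> generated_gates r"
| mult: "A \<in> generated_gates r \<Longrightarrow> B \<in> generated_gates r \<Longrightarrow> A ** B \<in> generated_gates r"


text \<open>
  The operator \<open>\<Otimes>\<^bsub>u\<in>V\<^esub> U u\<close>: its matrix entry in row \<open>x\<close> and column \<open>y\<close> is the product over
  \<open>u \<in> V\<close> of the entries of \<open>U u\<close> at the bits of \<open>x\<close> and \<open>y\<close> for the qubit \<open>u\<close>.
\<close>

definition local_operator :: "'a set \<Rightarrow> ('a \<Rightarrow> gate) \<Rightarrow> 'a state \<Rightarrow> 'a state" where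
  "local_operator V U \<psi> = (\<lambda>x. if x \<subseteq> V
     then \<Sum>y\<in>Pow V. (\<Prod>u\<in>V. U u $ (u \<in> x) $ (u \<in> y)) * \<psi> y
     else 0)"

definition LU_equivalent :: "'a pair_pre_digraph \<Rightarrow> 'a pair_pre_digraph \<Rightarrow> bool" where
  "LU_equivalent G\<^sub>1 G\<^sub>2 \<longleftrightarrow> pverts G\<^sub>1 = pverts G\<^sub>2 \<and>
     (\<exists>U. (\<forall>u \<in> pverts G\<^sub>1. unitary_gate (U u)) \<and>
          graph_state G\<^sub>2 = local_operator (pverts G\<^sub>1) U (graph_state G\<^sub>1))"

definition LC_equivalent :: "nat \<Rightarrow> 'a pair_pre_digraph \<Rightarrow> 'a pair_pre_digraph \<Rightarrow> bool" where
  "LC_equivalent r G\<^sub>1 G\<^sub>2 \<longleftrightarrow> pverts G\<^sub>1 = pverts G\<^sub>2 \<and>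
     (\<exists>U. (\<forall>u \<in> pverts G\<^sub>1. U u \<in> generated_gates r) \<and>
          graph_state G\<^sub>2 = local_operator (pverts G\<^sub>1) U (graph_state G\<^sub>1))"


lemma adjoint_gate_mult: "adjoint_gate (A ** B) = adjoint_gate B ** adjoint_gate A"
  by (simp add: adjoint_gate_def matrix_matrix_mult_def vec_eq_iff mult.commute)

lemma adjoint_gate_mat_1: "adjoint_gate (mat 1) = mat 1"
  by (auto simp: adjoint_gate_def mat_def vec_eq_iff)

lemma unitary_gate_mult:
  assumes "unitary_gate A" "unitary_gate B"
  shows "unitary_gate (A ** B)"
  using assms unfolding unitary_gate_def adjoint_gate_mult
  by (metis matrix_mul_assoc matrix_mul_lid)

lemma unitary_hadamard_gate: "unitary_gate hadamard_gate"
proof -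
  have "complex_of_real (sqrt 2) * complex_of_real (sqrt 2) = 2"
    by (simp flip: of_real_mult)
  then show ?thesis
    by (auto simp: unitary_gate_def adjoint_gate_def hadamard_gate_def matrix_matrix_mult_def
        mat_def vec_eq_iff UNIV_bool)
qed

lemma unitary_Z_gate: "unitary_gate (Z_gate \<alpha>)"
  by (auto simp: unitary_gate_def adjoint_gate_def Z_gate_def matrix_matrix_mult_def
      mat_def vec_eq_iff UNIV_bool cis_cnj cis_mult)

lemma generated_gates_unitary: "A \<in> generated_gates r \<Longrightarrow> unitary_gate A"
proof (induction rule: generated_gates.induct)
  case one
  show ?case by (simp add: unitary_gate_def adjoint_gate_mat_1)
qed (auto intro: unitary_hadamard_gate unitary_Z_gate unitary_gate_mult)

lemma Z_gate_mult: "Z_gate \<alpha> ** Z_gate \<beta> = Z_gate (\<alpha> + \<beta>)"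
  by (auto simp: Z_gate_def matrix_matrix_mult_def vec_eq_iff UNIV_bool cis_mult)

lemma Z_gate_multiple_in_generated_gates: "Z_gate (real k * (pi / 2 ^ r)) \<in> generated_gates r"
proof (induction k)
  case 0
  have "Z_gate 0 = mat 1" by (auto simp: Z_gate_def mat_def vec_eq_iff)
  then show ?case by (simp add: generated_gates.one)
next
  case (Suc k)
  have "Z_gate (real (Suc k) * (pi / 2 ^ r)) = Z_gate (pi / 2 ^ r) ** Z_gate (real k * (pi / 2 ^ r))"
    unfolding Z_gate_mult by (rule arg_cong [of _ _ Z_gate]) (simp add: field_simps)
  with Suc show ?case by (simp add: generated_gates.mult generated_gates.Z)
qed

lemma adjoint_in_generated_gates: "A \<in> generated_gates r \<Longrightarrow> adjoint_gate A \<in> generated_gates r"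
proof (induction rule: generated_gates.induct)
  case one
  show ?case by (simp add: adjoint_gate_mat_1 generated_gates.one)
next
  case H
  have "adjoint_gate hadamard_gate = hadamard_gate"
    by (auto simp: adjoint_gate_def hadamard_gate_def vec_eq_iff)
  then show ?case by (simp add: generated_gates.H)
next
  case Z
  have "real (2 * 2 ^ r - 1) * (pi / 2 ^ r) = 2 * pi - pi / 2 ^ r"
    by (simp add: of_nat_diff field_simps)
  moreover have "cis (2 * pi - \<alpha>) = cis (- \<alpha>)" for \<alpha>
    by (simp add: cis.ctr)
  then have "adjoint_gate (Z_gate \<alpha>) = Z_gate (2 * pi - \<alpha>)" for \<alpha>
    by (auto simp: adjoint_gate_def Z_gate_def vec_eq_iff cis_cnj)
  ultimately show ?case
    using Z_gate_multiple_in_generated_gates [of "2 * 2 ^ r - 1" r] by simp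
next
  case (mult A B)
  then show ?case by (simp add: adjoint_gate_mult generated_gates.mult)
qed

end

theory Submission
  imports Defs
begin

text \<open>
  A local unitary \<open>U\<close> with \<open>|G\<^sub>2> = U |G\<^sub>1>\<close> acts on Pauli expectation values by local orthogonal maps.
  Counting the stabilizers of both states that live on a vertex set \<open>B\<close> and carry a given Pauli at
  \<open>u \<in> B\<close> shows that \<open>U\<^sub>u\<close> maps some Pauli to a multiple of a Pauli, unless for every \<open>B\<close> the three
  counts agree. In that case a minimal \<open>B\<close> with nonzero counts carries exactly three stabilizers, all
  of full support; \<open>|B| \<ge> 3\<close> again forces \<open>U\<^sub>u\<close> to preserve a Pauli axis, and \<open>|B| = 2\<close> is an isolated
  edge, across which \<open>U\<^sub>u\<close> can be moved to the other end. So every \<open>U\<^sub>u\<close> may be taken of the form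
  \<open>\<alpha> P Z(\<theta>\<^sub>u) Q\<close> with \<open>P, Q\<close> Clifford.

  Then two stabilizer states differ by the phases \<open>\<Sum>u\<in>x. \<theta>\<^sub>u\<close> on an affine space of sets \<open>x\<close>. As both
  are quadratic, the third derivatives of these phases vanish. If \<open>\<theta>\<close> is chosen with minimal support,
  its values are dyadic multiples \<open>S\<^sub>u \<pi> / 2\<^sup>R\<close>; when \<open>R > r\<close>, the set \<open>T\<close> of odd \<open>S\<^sub>u\<close> is a word of a punctured
  Reed-Muller code, so it is empty or has at least \<open>2\<^bsup>R+2\<^esup> - 1\<close> elements. As the order is at most
  \<open>2\<^bsup>r+3\<^esup> - 1\<close>, a nonempty \<open>T\<close> has minimum weight, and adding \<open>\<pi> / 2\<^sup>R\<close> on \<open>T\<close> changes no phase. So all \<open>S\<^sub>u\<close>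
  can be made even and \<open>R\<close> decreases to \<open>r\<close>.
\<close>

section \<open>Symmetric differences\<close>

text \<open>The counts of the two states can be compared because they are diagonal entries of Gram
  matrices. Opening all qubits of \<open>B - {u}\<close> leaves a matrix indexed by the Paulis at
  \<open>u\<close>, and \<open>U\<close> acts on it only through the rotation induced at
  \<open>u\<close>. For graph states this matrix is diagonal on the nontrivial Paulis, so a nonzero
  entry of the rotation forces two counts to be equal. Minimal support of the angles makes the
  vertices distinct nonzero linear forms on the directions of the affine space, which is what turns
  sets of vertices into code words. The bound on the order comes from the last halving, from
  \<open>R = r + 1\<close> to \<open>r\<close>: the minimum weight is then 2^(r+3) - 1, and a word
  of that weight meets each direction in 0 or 2^(r+2) vertices, where angles pi / 2^(r+1) add up to
  a full turn. Equality of states is exact, so the remaining scalar must also come from the gates.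
  Up to powers of sqrt 2, amplitudes of Clifford images of graph states are Gaussian integers whose
  squared norm is a power of 2. Hence their phases are multiples of pi / 4, which the gates produce
  already for \<open>r = 1\<close>.\<close>

definition symdiff :: "'a set \<Rightarrow> 'a set \<Rightarrow> 'a set"  (infixl \<open>\<triangle>\<close> 65) where
  "A \<triangle> B = (A - B) \<union> (B - A)"

lemma in_symdiff [simp]: "x \<in> A \<triangle> B \<longleftrightarrow> (x \<in> A) \<noteq> (x \<in> B)"
  by (auto simp: symdiff_def)

lemma finite_symdiff [simp]: "finite A \<Longrightarrow> finite B \<Longrightarrow> finite (A \<triangle> B)"
  by (simp add: symdiff_def)

lemma symdiff_subset: "A \<subseteq> C \<Longrightarrow> B \<subseteq> C \<Longrightarrow> A \<triangle> B \<subseteq> C"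
  by auto

lemma symdiff_empty [simp]: "A \<triangle> {} = A" "{} \<triangle> A = A"
  by auto

lemma symdiff_self [simp]: "A \<triangle> A = {}"
  by auto

lemma symdiff_commute: "A \<triangle> B = B \<triangle> A"
  by auto

lemma symdiff_assoc: "A \<triangle> B \<triangle> C = A \<triangle> (B \<triangle> C)"
  by auto

lemma symdiff_cancel [simp]: "A \<triangle> B \<triangle> B = A" "A \<triangle> (A \<triangle> B) = B"
  by auto

lemma symdiff_Int_distrib: "(A \<triangle> B) \<inter> C = (A \<inter> C) \<triangle> (B \<inter> C)"
  by auto

lemma sum_symdiff:
  fixes f :: "'a \<Rightarrow> 'b::comm_ring_1"
  assumes "finite A" "finite B"
  shows "sum f (A \<triangle> B) = sum f A + sum f B - 2 * sum f (A \<inter> B)"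
proof -
  have "sum f (A \<triangle> B) = sum f (A - B) + sum f (B - A)"
    unfolding symdiff_def using assms by (intro sum.union_disjoint) auto
  moreover have "sum f A = sum f (A - B) + sum f (A \<inter> B)" "sum f B = sum f (B - A) + sum f (A \<inter> B)"
    using assms by (auto simp: sum.Int_Diff[of A f B] sum.Int_Diff[of B f A] Int_commute)
  ultimately show ?thesis by simp
qed

lemma sum_symdiff_Int:
  fixes f :: "'a \<Rightarrow> 'b::comm_ring_1"
  assumes "finite A" "finite B"
  shows "sum f ((A \<triangle> B) \<inter> C) = sum f (A \<inter> C) + sum f (B \<inter> C) - 2 * sum f (A \<inter> B \<inter> C)"
proof -
  have "(A \<inter> C) \<inter> (B \<inter> C) = A \<inter> B \<inter> C" by auto
  then show ?thesis
    using sum_symdiff[of "A \<inter> C" "B \<inter> C" f] assms by (simp add: symdiff_Int_distrib)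
qed

section \<open>Denominators of dyadic phases\<close>

text \<open>The right side is the third difference of \<open>sum a\<close> under symmetric
  difference. It involves sums over members of a closed family only, so integrality of the left side
  depends only on these sums modulo 1.\<close>

lemma four_sum_Int3:
  fixes a :: "'a \<Rightarrow> real"
  assumes "finite A" "finite B" "finite C"
  shows "4 * sum a (A \<inter> B \<inter> C) = sum a A + sum a B + sum a C - sum a (A \<triangle> B)
    - sum a (A \<triangle> C) - sum a (B \<triangle> C) + sum a (A \<triangle> B \<triangle> C)"
  using assms sum_symdiff_Int[of A B a C] sum_symdiff[of A B a] sum_symdiff[of A C a] sum_symdiff[of B C a]
      sum_symdiff[of "A \<triangle> B" C a] by simp

text \<open>Each further factor costs one power of 2: twice the sum over
  \<open>w \<inter> w' \<inter> Y\<close> is a combination of sums over \<open>w \<inter> Y\<close>,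
  \<open>w' \<inter> Y\<close> and \<open>(w \<triangle> w') \<inter> Y\<close>, which have one
  factor less.\<close>

lemma sum_Inter_in_Ints:
  fixes a :: "'a \<Rightarrow> real"
  assumes closed: "\<And>w w'. w \<in> L \<Longrightarrow> w' \<in> L \<Longrightarrow> w \<triangle> w' \<in> L"
    and fin: "\<And>w. w \<in> L \<Longrightarrow> finite w"
    and base: "\<And>w1 w2 w3. w1 \<in> L \<Longrightarrow> w2 \<in> L \<Longrightarrow> w3 \<in> L \<Longrightarrow> 4 * sum a (w1 \<inter> w2 \<inter> w3) \<in> \<int>"
  shows "length ws = k + 3 \<Longrightarrow> set ws \<subseteq> L \<Longrightarrow> 2 ^ (k + 2) * sum a (\<Inter> (set ws)) \<in> \<int>"
proof (induction k arbitrary: ws)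
  case 0
  then obtain w1 w2 w3 where "ws = [w1, w2, w3]"
    by (auto simp: length_Suc_conv numeral_3_eq_3)
  with 0 base[of w1 w2 w3] show ?case by (simp add: Int_ac)
next
  case (Suc k)
  then obtain w w' vs where ws: "ws = w # w' # vs"
    by (cases ws; cases "tl ws") auto
  with Suc.prems have vs: "length vs = k + 2" "set vs \<subseteq> L" "w \<in> L" "w' \<in> L" by auto
  define Y where "Y = \<Inter> (set vs)"
  have *: "2 ^ (k + 2) * sum a (x \<inter> Y) \<in> \<int>" if "x \<in> L" for x
    using Suc.IH[of "x # vs"] vs that by (simp add: Y_def)
  have "2 * sum a (w \<inter> w' \<inter> Y) = sum a (w \<inter> Y) + sum a (w' \<inter> Y) - sum a ((w \<triangle> w') \<inter> Y)"
    using sum_symdiff_Int[of w w' a Y] vs fin by simp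
  moreover have "2 ^ (Suc k + 2) * x = 2 ^ (k + 2) * (2 * x)" for x :: real by simp
  ultimately have "2 ^ (Suc k + 2) * sum a (w \<inter> w' \<inter> Y) = 2 ^ (k + 2) * sum a (w \<inter> Y)
    + 2 ^ (k + 2) * sum a (w' \<inter> Y) - 2 ^ (k + 2) * sum a ((w \<triangle> w') \<inter> Y)"
    by (simp only: ring_distribs)
  also have "\<dots> \<in> \<int>"
    using vs closed by (intro Ints_add Ints_diff *) auto
  finally show ?case by (simp add: ws Y_def Int_assoc)
qed

text \<open>This is the minimum weight of a Reed-Muller code. The sets in \<open>L\<close> are
  coordinate functions that separate the points of \<open>T\<close>, intersections are monomials,
  and evenness says that \<open>T\<close> is orthogonal to all monomials of degree below
  \<open>m\<close>. A coordinate that separates two points splits \<open>T\<close> into two nonempty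
  parts, each of which satisfies the condition for \<open>m - 1\<close>.\<close>

lemma card_ge_power_if_even_Inter:
  assumes "finite T" "T \<noteq> {}"
    and "\<And>x y. x \<in> T \<Longrightarrow> y \<in> T \<Longrightarrow> x \<noteq> y \<Longrightarrow> \<exists>w\<in>L. (x \<in> w) \<noteq> (y \<in> w)"
    and "\<And>ws. set ws \<subseteq> L \<Longrightarrow> length ws < m \<Longrightarrow> even (card (T \<inter> \<Inter> (set ws)))"
  shows "2 ^ m \<le> card T"
  using assms
proof (induction m arbitrary: T)
  case 0
  then show ?case by (simp add: Suc_le_eq card_gt_0_iff)
next
  case (Suc m)
  have "even (card T)" using Suc.prems(4)[of "[]"] by simp
  obtain x where x: "x \<in> T" using Suc.prems by auto
  have "T \<noteq> {x}" using \<open>even (card T)\<close> by auto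
  then obtain y where y: "y \<in> T" "x \<noteq> y" using x by auto
  from Suc.prems(3)[OF x y] obtain w where w: "w \<in> L" "(x \<in> w) \<noteq> (y \<in> w)" by auto
  have "2 ^ m \<le> card (T \<inter> w)"
  proof (rule Suc.IH)
    fix ws assume "set ws \<subseteq> L" "length ws < m"
    then show "even (card (T \<inter> w \<inter> \<Inter> (set ws)))"
      using Suc.prems(4)[of "w # ws"] w by (simp add: Int_assoc)
  qed (use Suc.prems x y w in auto)
  moreover have "2 ^ m \<le> card (T - w)"
  proof (rule Suc.IH)
    fix ws assume ws: "set ws \<subseteq> L" "length ws < m"
    let ?X = "T \<inter> \<Inter> (set ws)"
    have "card ?X = card (?X \<inter> w) + card (?X - w)"
      using Suc.prems(1) by (metis card_Int_Diff finite_Int)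
    moreover have "?X \<inter> w = T \<inter> \<Inter> (set (w # ws))" "?X - w = (T - w) \<inter> \<Inter> (set ws)" by auto
    moreover have "even (card ?X)" "even (card (T \<inter> \<Inter> (set (w # ws))))"
      using Suc.prems(4)[of ws] Suc.prems(4)[of "w # ws"] w ws by auto
    ultimately show "even (card ((T - w) \<inter> \<Inter> (set ws)))" by simp
  qed (use Suc.prems x y w in auto)
  ultimately show ?case
    using card_Int_Diff[of T w] Suc.prems(1) by simp
qed

text \<open>The punctured code: the missing point is the origin, where all coordinates vanish.
  Coverage keeps \<open>T\<close> away from it, and the constant monomial, which would count it, is
  excluded from the evenness condition. The second claim says that a word of minimum weight meets a
  coordinate in nothing or in half of the completed word.\<close>

lemma card_ge_power_if_odd:
  assumes "finite T" "odd (card T)"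
    and "\<And>x y. x \<in> T \<Longrightarrow> y \<in> T \<Longrightarrow> x \<noteq> y \<Longrightarrow> \<exists>w\<in>L. (x \<in> w) \<noteq> (y \<in> w)"
    and "\<And>x. x \<in> T \<Longrightarrow> \<exists>w\<in>L. x \<in> w"
    and "\<And>ws. set ws \<subseteq> L \<Longrightarrow> ws \<noteq> [] \<Longrightarrow> length ws < m \<Longrightarrow> even (card (T \<inter> \<Inter> (set ws)))"
  shows "2 ^ m \<le> card T + 1"
    and "w \<in> L \<Longrightarrow> m \<noteq> 0 \<Longrightarrow> card T + 1 = 2 ^ m \<Longrightarrow> card (T \<inter> w) \<in> {0, 2 ^ (m - 1)}"
proof -
  \<comment> \<open>Within \<open>w\<close> the constant monomial coincides with \<open>w\<close>,
    so the unpunctured bound applies to \<open>T \<inter> w\<close> with one factor less.\<close>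
  have inter: "2 ^ m \<le> card (T \<inter> w)"
    if "finite T" "w \<in> L" "T \<inter> w \<noteq> {}"
      "\<And>x y. x \<in> T \<Longrightarrow> y \<in> T \<Longrightarrow> x \<noteq> y \<Longrightarrow> \<exists>w\<in>L. (x \<in> w) \<noteq> (y \<in> w)"
      "\<And>ws. set ws \<subseteq> L \<Longrightarrow> ws \<noteq> [] \<Longrightarrow> length ws < Suc m \<Longrightarrow> even (card (T \<inter> \<Inter> (set ws)))"
    for T :: "'a set" and w m
  proof (rule card_ge_power_if_even_Inter)
    fix ws assume "set ws \<subseteq> L" "length ws < m"
    then show "even (card (T \<inter> w \<inter> \<Inter> (set ws)))"
      using that(5)[of "w # ws"] that(2) by (simp add: Int_assoc)
  qed (use that in auto)
  \<comment> \<open>The part outside \<open>w\<close> contains the punctured side and is again an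
    odd word of the same kind.\<close>
  have diff: "odd (card (T - w))"
      "\<And>ws. set ws \<subseteq> L \<Longrightarrow> ws \<noteq> [] \<Longrightarrow> length ws < m \<Longrightarrow> even (card ((T - w) \<inter> \<Inter> (set ws)))"
    if "finite T" "odd (card T)" "w \<in> L" "m \<noteq> 0"
      "\<And>ws. set ws \<subseteq> L \<Longrightarrow> ws \<noteq> [] \<Longrightarrow> length ws < Suc m \<Longrightarrow> even (card (T \<inter> \<Inter> (set ws)))"
    for T :: "'a set" and w m
  proof -
    show "odd (card (T - w))"
      using that(5)[of "[w]"] that card_Int_Diff[of T w] by simp
    fix ws assume ws: "set ws \<subseteq> L" "ws \<noteq> []" "length ws < m"
    let ?X = "T \<inter> \<Inter> (set ws)"
    have "card ?X = card (?X \<inter> w) + card (?X - w)"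
      using that(1) by (metis card_Int_Diff finite_Int)
    moreover have "?X \<inter> w = T \<inter> \<Inter> (set (w # ws))" "?X - w = (T - w) \<inter> \<Inter> (set ws)" by auto
    moreover have "even (card ?X)" "even (card (T \<inter> \<Inter> (set (w # ws))))"
      using that(5)[of ws] that(5)[of "w # ws"] ws that(3) by auto
    ultimately show "even (card ((T - w) \<inter> \<Inter> (set ws)))" by simp
  qed
  have main: "2 ^ m \<le> card T + 1"
    if "finite T" "odd (card T)"
      "\<And>x y. x \<in> T \<Longrightarrow> y \<in> T \<Longrightarrow> x \<noteq> y \<Longrightarrow> \<exists>w\<in>L. (x \<in> w) \<noteq> (y \<in> w)"
      "\<And>x. x \<in> T \<Longrightarrow> \<exists>w\<in>L. x \<in> w"
      "\<And>ws. set ws \<subseteq> L \<Longrightarrow> ws \<noteq> [] \<Longrightarrow> length ws < m \<Longrightarrow> even (card (T \<inter> \<Inter> (set ws)))"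
    for T :: "'a set" and m
    using that
  proof (induction m arbitrary: T)
    case (Suc m)
    show ?case
    proof (cases "m = 0")
      case True
      then show ?thesis using Suc.prems(2) by (cases "card T") auto
    next
      case False
      obtain x where x: "x \<in> T" using Suc.prems(2) by fastforce
      then obtain w where w: "w \<in> L" "x \<in> w" using Suc.prems(4) by auto
      have "2 ^ m \<le> card (T \<inter> w)"
        using x w Suc.prems by (intro inter) auto
      moreover have "2 ^ m \<le> card (T - w) + 1"
        using diff[OF Suc.prems(1,2) w(1) False] Suc.prems by (intro Suc.IH) auto
      ultimately show ?thesis
        using card_Int_Diff[of T w] Suc.prems(1) by simp
    qed
  qed simp
  show "2 ^ m \<le> card T + 1" using assms by (rule main)
  assume w: "w \<in> L" "m \<noteq> 0" "card T + 1 = 2 ^ m"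
  then obtain k where m: "m = Suc k" by (cases m) auto
  show "card (T \<inter> w) \<in> {0, 2 ^ (m - 1)}"
  proof (cases "T \<inter> w = {}")
    case False
    have ge: "2 ^ k \<le> card (T \<inter> w)"
      using w False assms m by (intro inter) auto
    show ?thesis
    proof (cases "k = 0")
      case True
      then show ?thesis using w m ge card_Int_Diff[of T w] assms(1) by auto
    next
      case False
      \<comment> \<open>The lower bounds on the two parts add up to exactly the size of
        \<open>T\<close>, so both are attained.\<close>
      have "2 ^ k \<le> card (T - w) + 1"
        using diff[OF assms(1,2) w(1) False] assms m by (intro main) auto
      then show ?thesis
        using w m ge card_Int_Diff[of T w] assms(1) by auto
    qed
  qed simp
qed

section \<open>Dyadic values and the descent of their denominator\<close>

lemma card_symdiff_closed:
  assumes "finite V"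
  shows "L \<subseteq> Pow V \<Longrightarrow> L \<noteq> {} \<Longrightarrow> (\<And>w w'. w \<in> L \<Longrightarrow> w' \<in> L \<Longrightarrow> w \<triangle> w' \<in> L) \<Longrightarrow>
    \<exists>k. card L = 2 ^ k"
  using assms
proof (induction V arbitrary: L rule: finite_induct)
  case empty
  then have "L = {{}}" by auto
  then show ?case by (auto intro: exI[of _ 0])
next
  case (insert u V)
  define L0 where "L0 = {w \<in> L. u \<notin> w}"
  obtain w where "w \<in> L" using insert.prems by auto
  then have "w \<triangle> w \<in> L" by (intro insert.prems)
  then have "{} \<in> L0" by (simp add: L0_def)
  then have "\<exists>k. card L0 = 2 ^ k"
    using insert.prems(1,3) by (intro insert.IH) (auto simp: L0_def)
  then obtain k where k: "card L0 = 2 ^ k" by auto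
  show ?case
  proof (cases "\<exists>w0\<in>L. u \<in> w0")
    case True
    then obtain w0 where w0: "w0 \<in> L" "u \<in> w0" by auto
    have "bij_betw (\<lambda>w. w \<triangle> w0) L0 (L - L0)"
      by (rule bij_betw_byWitness[where f' = "\<lambda>w. w \<triangle> w0"]) (use w0 insert.prems in \<open>auto simp: L0_def\<close>)
    then have "card (L - L0) = card L0" by (simp add: bij_betw_same_card)
    moreover have "finite L" "L0 \<subseteq> L"
      using insert.prems(1) insert.hyps(1) by (auto simp: L0_def intro: finite_subset)
    ultimately have "card L = 2 ^ Suc k"
      using k card_Diff_subset[of L0 L] card_mono[of L L0] finite_subset[of L0 L] by simp
    then show ?thesis by blast
  next
    case False
    then have "L = L0" by (auto simp: L0_def)
    with k show ?thesis by blast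
  qed
qed

text \<open>Fourier inversion on the group \<open>L\<close>. The sign functions \<sigma> of the
  vertices are characters, nontrivial by coverage and distinct by separation, hence orthogonal. This
  recovers each \<open>a u\<close> from the sums over members of \<open>L\<close> with denominator
  \<open>2 * card L\<close>, a power of 2.\<close>

lemma dyadic_if_separating:
  fixes a :: "'a \<Rightarrow> real"
  assumes V: "finite V" "L \<subseteq> Pow V" "L \<noteq> {}"
    and closed: "\<And>w w'. w \<in> L \<Longrightarrow> w' \<in> L \<Longrightarrow> w \<triangle> w' \<in> L"
    and sep: "\<And>x y. x \<in> V \<Longrightarrow> y \<in> V \<Longrightarrow> x \<noteq> y \<Longrightarrow> \<exists>w\<in>L. (x \<in> w) \<noteq> (y \<in> w)"
    and cov: "\<And>x. x \<in> V \<Longrightarrow> \<exists>w\<in>L. x \<in> w"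
    and int: "\<And>w. w \<in> L \<Longrightarrow> 4 * sum a w \<in> \<int>"
  shows "\<exists>k. \<forall>u\<in>V. 2 ^ k * a u \<in> \<int>"
proof -
  obtain d where d: "card L = 2 ^ d" using card_symdiff_closed[of V L] V closed by auto
  define \<sigma> :: "'a \<Rightarrow> 'a set \<Rightarrow> real" where "\<sigma> u w = (if u \<in> w then -1 else 1)" for u w
  have vanish: "sum g L = 0" if "w0 \<in> L" "\<And>w. g (w \<triangle> w0) = - g w" for w0 and g :: "'a set \<Rightarrow> real"
  proof -
    have "sum g L = (\<Sum>w\<in>L. g (w \<triangle> w0))"
      by (rule sum.reindex_bij_witness[of _ "\<lambda>w. w \<triangle> w0" "\<lambda>w. w \<triangle> w0"]) (use that closed in auto)
    then show ?thesis using that by (simp add: sum_negf)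
  qed
  have "2 ^ Suc d * a u \<in> \<int>" if u: "u \<in> V" for u
  proof -
    have 1: "(\<Sum>w\<in>L. \<sigma> u w) = 0"
    proof -
      obtain w0 where "w0 \<in> L" "u \<in> w0" using cov u by auto
      then show ?thesis by (intro vanish[of w0]) (auto simp: \<sigma>_def)
    qed
    have 2: "(\<Sum>w\<in>L. \<sigma> u w * \<sigma> v w) = (if v = u then 2 ^ d else 0)" if "v \<in> V" for v
    proof (cases "v = u")
      case True
      have "\<sigma> u w * \<sigma> u w = 1" for w by (simp add: \<sigma>_def)
      with True show ?thesis by (simp add: d)
    next
      case False
      then obtain w0 where "w0 \<in> L" "(u \<in> w0) \<noteq> (v \<in> w0)" using sep[of u v] u \<open>v \<in> V\<close> by auto
      then have "(\<Sum>w\<in>L. \<sigma> u w * \<sigma> v w) = 0"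
        by (intro vanish[of w0]) (auto simp: \<sigma>_def)
      with False show ?thesis by simp
    qed
    \<comment> \<open>The indicator of \<open>w\<close> at \<open>v\<close> is
      \<open>(1 - \<sigma> v w) / 2\<close>.\<close>
    have "(\<Sum>w\<in>L. \<sigma> u w * (4 * sum a w)) = (\<Sum>w\<in>L. \<Sum>v\<in>V. 2 * a v * (\<sigma> u w - \<sigma> u w * \<sigma> v w))"
    proof (rule sum.cong)
      fix w assume "w \<in> L"
      then have "w \<subseteq> V" using V by auto
      then have "sum a w = (\<Sum>v\<in>V. if v \<in> w then a v else 0)"
        using V by (simp add: sum.If_cases Int_absorb1)
      then have "\<sigma> u w * (4 * sum a w) = (\<Sum>v\<in>V. \<sigma> u w * 4 * (if v \<in> w then a v else 0))"
        by (simp add: sum_distrib_left mult.assoc)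
      also have "\<dots> = (\<Sum>v\<in>V. 2 * a v * (\<sigma> u w - \<sigma> u w * \<sigma> v w))"
        by (rule sum.cong) (auto simp: \<sigma>_def)
      finally show "\<sigma> u w * (4 * sum a w) = (\<Sum>v\<in>V. 2 * a v * (\<sigma> u w - \<sigma> u w * \<sigma> v w))" .
    qed simp
    also have "\<dots> = (\<Sum>v\<in>V. 2 * a v * ((\<Sum>w\<in>L. \<sigma> u w) - (\<Sum>w\<in>L. \<sigma> u w * \<sigma> v w)))"
      by (subst sum.swap) (simp add: sum_distrib_left sum_subtractf right_diff_distrib)
    also have "\<dots> = (\<Sum>v\<in>V. if v = u then - (2 * a v * 2 ^ d) else 0)"
      by (rule sum.cong) (auto simp: 1 2)
    also have "\<dots> = - (2 ^ Suc d * a u)"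
      using u V by simp
    finally have "2 ^ Suc d * a u = - (\<Sum>w\<in>L. \<sigma> u w * (4 * sum a w))" by simp
    also have "\<dots> \<in> \<int>"
      by (intro Ints_minus Ints_sum Ints_mult int) (auto simp: \<sigma>_def)
    finally show ?thesis .
  qed
  then show ?thesis by blast
qed

text \<open>Rounding the odd numerators down changes the sum over \<open>w\<close> by
  \<open>card (T \<inter> w) / 2 ^ N\<close>, where \<open>T\<close> collects the odd ones.
  Integrality of triple intersections makes \<open>T\<close> a punctured code word, and the bound on
  \<open>V\<close> leaves only the empty word and minimum weight. The change is then 0 or 1.\<close>

lemma halve_denominator:
  fixes S :: "'a \<Rightarrow> int"
  assumes V: "finite V" "L \<subseteq> Pow V" "card V < 2 ^ Suc N" "3 \<le> N"
    and closed: "\<And>w w'. w \<in> L \<Longrightarrow> w' \<in> L \<Longrightarrow> w \<triangle> w' \<in> L"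
    and sep: "\<And>x y. x \<in> V \<Longrightarrow> y \<in> V \<Longrightarrow> x \<noteq> y \<Longrightarrow> \<exists>w\<in>L. (x \<in> w) \<noteq> (y \<in> w)"
    and cov: "\<And>x. x \<in> V \<Longrightarrow> \<exists>w\<in>L. x \<in> w"
    and int: "\<And>w1 w2 w3. w1 \<in> L \<Longrightarrow> w2 \<in> L \<Longrightarrow> w3 \<in> L \<Longrightarrow>
      4 * (\<Sum>u\<in>w1 \<inter> w2 \<inter> w3. of_int (S u) / 2 ^ N) \<in> (\<int> :: real set)"
    and w: "w \<in> L"
  shows "(\<Sum>u\<in>w. of_int (S u) / 2 ^ N) - (\<Sum>u\<in>w. of_int (S u div 2) / 2 ^ (N - 1)) \<in> (\<int> :: real set)"
proof -
  define T where "T = {u \<in> V. odd (S u)}"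
  have finw: "finite w" if "w \<in> L" for w using V that by (auto intro: finite_subset)
  have "finite T" using V by (simp add: T_def)
  have even: "even (card (T \<inter> \<Inter> (set ws)))"
    if ws: "set ws \<subseteq> L" "ws \<noteq> []" "length ws < Suc N" for ws
  proof -
    \<comment> \<open>Integrality starts at three factors. Repeating a factor leaves the
      intersection unchanged and raises shorter lists to length 3, which is still at most
      \<open>N\<close>.\<close>
    define vs where "vs = ws @ replicate (3 - length ws) (hd ws)"
    have "hd ws \<in> set ws" using ws by simp
    then have vs: "set vs = set ws" by (auto simp: vs_def)
    have len: "3 \<le> length vs" "length vs \<le> N" using ws V by (auto simp: vs_def)
    define k where "k = length vs - 3"
    have k: "length vs = k + 3" "k + 2 < N" using len by (auto simp: k_def)
    let ?X = "\<Inter> (set ws)"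
    have X: "?X \<subseteq> V" "finite ?X" using \<open>hd ws \<in> set ws\<close> ws(1) V
      by (auto intro: finite_subset[of _ "hd ws"] finw)
    have "2 ^ (k + 2) * (\<Sum>u\<in>?X. of_int (S u) / 2 ^ N) \<in> (\<int> :: real set)"
      using sum_Inter_in_Ints[OF closed finw int k(1)] ws vs by simp
    then obtain j where "2 ^ (k + 2) * (\<Sum>u\<in>?X. of_int (S u) / 2 ^ N) = (of_int j :: real)"
      by (auto elim: Ints_cases)
    then have "of_int (2 ^ (k + 2) * (\<Sum>u\<in>?X. S u)) = (of_int (j * 2 ^ N) :: real)"
      by (simp add: sum_divide_distrib[symmetric] field_simps)
    then have "2 ^ (k + 2) * (\<Sum>u\<in>?X. S u) = j * 2 ^ N" by (simp only: of_int_eq_iff)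
    moreover have "(2::int) ^ N = 2 ^ (k + 2) * 2 ^ (N - (k + 2))"
      using k by (metis add_diff_inverse_nat less_imp_le not_le power_add)
    ultimately have "(\<Sum>u\<in>?X. S u) = j * 2 ^ (N - (k + 2))" by simp
    with k have "even (\<Sum>u\<in>?X. S u)" by simp
    then have "even (card {u\<in>?X. odd (S u)})" using X by (simp add: even_sum_iff)
    moreover have "{u\<in>?X. odd (S u)} = T \<inter> ?X" using X by (auto simp: T_def)
    ultimately show ?thesis by simp
  qed
  have "card T \<le> card V" using V by (intro card_mono) (auto simp: T_def)
  then have small: "card T < 2 ^ Suc N" using V by simp
  have key: "card (T \<inter> w) \<in> {0, 2 ^ N}"
  proof (cases "T = {}")
    case False
    \<comment> \<open>A nonempty word of even size would satisfy the unpunctured bound, which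
      exceeds the size of \<open>V\<close>.\<close>
    have "odd (card T)"
    proof (rule ccontr)
      assume "\<not> odd (card T)"
      then have "even (card (T \<inter> \<Inter> (set ws)))" if "set ws \<subseteq> L" "length ws < Suc N" for ws
        using even[of ws] that by (cases "ws = []") auto
      then have "2 ^ Suc N \<le> card T"
        using False sep \<open>finite T\<close> by (intro card_ge_power_if_even_Inter[of T L "Suc N"]) (auto simp: T_def)
      with small show False by simp
    qed
    have T_sep: "\<And>x y. x \<in> T \<Longrightarrow> y \<in> T \<Longrightarrow> x \<noteq> y \<Longrightarrow> \<exists>w\<in>L. (x \<in> w) \<noteq> (y \<in> w)"
      and T_cov: "\<And>x. x \<in> T \<Longrightarrow> \<exists>w\<in>L. x \<in> w"
      using sep cov by (simp_all add: T_def)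
    have "2 ^ Suc N \<le> card T + 1"
      by (rule card_ge_power_if_odd(1)[of T L]) (fact \<open>finite T\<close> \<open>odd (card T)\<close> T_sep T_cov even)+
    with small have "card T + 1 = 2 ^ Suc N" by linarith
    have "card (T \<inter> w) \<in> {0, 2 ^ (Suc N - 1)}"
      by (rule card_ge_power_if_odd(2)[of T L])
        (fact \<open>finite T\<close> \<open>odd (card T)\<close> T_sep T_cov even w \<open>card T + 1 = 2 ^ Suc N\<close> nat.distinct(2))+
    then show ?thesis by simp
  qed simp
  have "(\<Sum>u\<in>w. of_int (S u) / 2 ^ N) - (\<Sum>u\<in>w. of_int (S u div 2) / 2 ^ (N - 1))
     = (\<Sum>u\<in>w. if u \<in> T then 1 / 2 ^ N else (0 :: real))"
  proof -
    have "of_int (S u) / 2 ^ N - of_int (S u div 2) / 2 ^ (N - 1)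
      = (if u \<in> T then 1 / 2 ^ N else (0 :: real))" if "u \<in> w" for u
    proof -
      have "S u = 2 * (S u div 2) + (if u \<in> T then 1 else 0)"
        using that w V by (auto simp: T_def)
      then have "(of_int (S u) :: real) = 2 * of_int (S u div 2) + (if u \<in> T then 1 else 0)"
        by (metis (mono_tags) of_int_1 of_int_0 of_int_add of_int_mult of_int_numeral)
      moreover have "(2::real) ^ N = 2 * 2 ^ (N - 1)"
        using V by (metis Suc_diff_1 less_le_trans power_Suc zero_less_numeral)
      ultimately show ?thesis by (simp add: field_simps)
    qed
    then show ?thesis by (simp flip: sum_subtractf)
  qed
  also have "\<dots> = card (T \<inter> w) / 2 ^ N"
    using finw[OF w] by (simp add: sum.If_cases Int_commute)
  also have "\<dots> \<in> \<int>" using key by auto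
  finally show ?thesis .
qed

text \<open>Values are in units of a full turn, so the exponent \<open>r + 1\<close> corresponds to
  angles that are multiples of pi / 2^r. The induction removes one power of 2 at a time. Only the
  sums modulo 1 are kept, since rounding alters the values themselves.\<close>

lemma bounded_denominator_if_separating:
  fixes a :: "'a \<Rightarrow> real"
  assumes V: "finite V" "L \<subseteq> Pow V" "card V < 2 ^ (r + 3)" "1 \<le> r"
    and closed: "\<And>w w'. w \<in> L \<Longrightarrow> w' \<in> L \<Longrightarrow> w \<triangle> w' \<in> L"
    and sep: "\<And>x y. x \<in> V \<Longrightarrow> y \<in> V \<Longrightarrow> x \<noteq> y \<Longrightarrow> \<exists>w\<in>L. (x \<in> w) \<noteq> (y \<in> w)"
    and cov: "\<And>x. x \<in> V \<Longrightarrow> \<exists>w\<in>L. x \<in> w"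
    and int: "\<And>w1 w2 w3. w1 \<in> L \<Longrightarrow> w2 \<in> L \<Longrightarrow> w3 \<in> L \<Longrightarrow> 4 * sum a (w1 \<inter> w2 \<inter> w3) \<in> \<int>"
  shows "\<exists>S :: 'a \<Rightarrow> int. \<forall>w\<in>L. sum a w - (\<Sum>u\<in>w. of_int (S u) / 2 ^ (r + 1)) \<in> \<int>"
proof (cases "L = {}")
  case False
  have finw: "finite w" if "w \<in> L" for w using V that by (auto intro: finite_subset)
  have "\<exists>k. \<forall>u\<in>V. 2 ^ k * a u \<in> \<int>"
    using V False closed sep cov int[of w w w for w] by (intro dyadic_if_separating) auto
  then obtain k where k: "\<And>u. u \<in> V \<Longrightarrow> 2 ^ k * a u \<in> \<int>" by blast
  \<comment> \<open>The factor \<open>2 ^ (r + 1)\<close> only pads the denominator, so that the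
    induction on \<open>k\<close> ends exactly at the exponent \<open>r + 1\<close>.\<close>
  define S0 where "S0 u = \<lfloor>2 ^ k * a u\<rfloor> * 2 ^ (r + 1)" for u
  have "a u = of_int (S0 u) / 2 ^ (k + (r + 1))" if "u \<in> V" for u
    using k[OF that] by (auto simp: S0_def power_add field_simps elim!: Ints_cases)
  then have "sum a w = (\<Sum>u\<in>w. of_int (S0 u) / 2 ^ (k + (r + 1)))" if "w \<in> L" for w
    using that V by (intro sum.cong) auto
  then have "\<exists>S :: 'a \<Rightarrow> int. \<forall>w\<in>L. sum a w - (\<Sum>u\<in>w. of_int (S u) / 2 ^ (k + (r + 1))) \<in> \<int>"
    by (intro exI[of _ S0]) auto
  then show ?thesis
  proof (induction k)
    case (Suc k)
    then obtain S :: "'a \<Rightarrow> int" where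
      S: "\<And>w. w \<in> L \<Longrightarrow> sum a w - (\<Sum>u\<in>w. of_int (S u) / 2 ^ (Suc k + (r + 1))) \<in> \<int>" by blast
    let ?b = "\<lambda>u. of_int (S u) / 2 ^ (Suc k + (r + 1)) :: real"
    have "sum a w - (\<Sum>u\<in>w. of_int (S u div 2) / 2 ^ (k + (r + 1))) \<in> \<int>" if w: "w \<in> L" for w
    proof -
      have "4 * sum ?b (w1 \<inter> w2 \<inter> w3) \<in> \<int>" if "w1 \<in> L" "w2 \<in> L" "w3 \<in> L" for w1 w2 w3
      proof -
        \<comment> \<open>On \<open>L\<close> the sums of \<open>a\<close> and \<open>?b\<close>
          agree modulo 1, and the third difference carries this over to triple
          intersections.\<close>
        let ?d = "\<lambda>w. sum a w - sum ?b w"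
        have "4 * sum ?b (w1 \<inter> w2 \<inter> w3) = 4 * sum a (w1 \<inter> w2 \<inter> w3)
          - (?d w1 + ?d w2 + ?d w3 - ?d (w1 \<triangle> w2) - ?d (w1 \<triangle> w3) - ?d (w2 \<triangle> w3)
          + ?d (w1 \<triangle> w2 \<triangle> w3))"
          using that by (simp only: four_sum_Int3 finw)
        also have "\<dots> \<in> \<int>"
          using that closed by (intro Ints_diff Ints_add S int) auto
        finally show ?thesis .
      qed
      note int' = this
      \<comment> \<open>For \<open>k = 0\<close> the two powers are equal: the last halving consumes
        the full bound on the order.\<close>
      have card: "card V < 2 ^ Suc (Suc k + (r + 1))"
        using V(3) by (rule less_le_trans) (rule power_increasing, auto)
      have "3 \<le> Suc k + (r + 1)" using V(4) by simp
      then have "sum ?b w - (\<Sum>u\<in>w. of_int (S u div 2) / 2 ^ (Suc k + (r + 1) - 1)) \<in> \<int>"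
        by (rule halve_denominator[OF V(1,2) card])
          (fact closed sep cov int' w)+
      from Ints_add[OF S[OF w] this] show ?thesis by simp
    qed
    then show ?case by (intro Suc.IH exI[of _ "\<lambda>u. S u div 2"]) auto
  qed simp
qed simp

lemma bounded_denominator:
  fixes a :: "'a \<Rightarrow> real"
  assumes V: "finite V" "L \<subseteq> Pow V" "card V < 2 ^ (r + 3)" "1 \<le> r"
    and closed: "\<And>w w'. w \<in> L \<Longrightarrow> w' \<in> L \<Longrightarrow> w \<triangle> w' \<in> L"
    and int: "\<And>w1 w2 w3. w1 \<in> L \<Longrightarrow> w2 \<in> L \<Longrightarrow> w3 \<in> L \<Longrightarrow> 4 * sum a (w1 \<inter> w2 \<inter> w3) \<in> \<int>"
  shows "\<exists>S :: 'a \<Rightarrow> int. \<forall>w\<in>L. sum a w - (\<Sum>u\<in>w. of_int (S u) / 2 ^ (r + 1)) \<in> \<int>"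
proof -
  have finw: "finite w" if "w \<in> L" for w using V that by (auto intro: finite_subset)
  \<comment> \<open>As \<open>w \<inter> w \<inter> w = w\<close>, this keeps the sums over
    \<open>L\<close> together with their third differences.\<close>
  define good where "good b \<longleftrightarrow> (\<forall>w1\<in>L. \<forall>w2\<in>L. \<forall>w3\<in>L. sum b (w1 \<inter> w2 \<inter> w3) = sum a (w1 \<inter> w2 \<inter> w3))"
    for b :: "'a \<Rightarrow> real"
  define W where "W b = {u \<in> V. b u \<noteq> 0}" for b :: "'a \<Rightarrow> real"
  have "good a" by (simp add: good_def)
  then obtain b where b: "good b" and min: "\<And>b'. good b' \<Longrightarrow> card (W b) \<le> card (W b')"
    using ex_has_least_nat[of good a "\<lambda>b. card (W b)"] by auto
  have [simp]: "finite (W b)" for b using V by (simp add: W_def)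
  have sep: "\<exists>w\<in>L. (x \<in> w) \<noteq> (y \<in> w)" if "x \<in> W b" "y \<in> W b" "x \<noteq> y" for x y
  proof (rule ccontr)
    assume *: "\<not> (\<exists>w\<in>L. (x \<in> w) \<noteq> (y \<in> w))"
    \<comment> \<open>The weight of \<open>y\<close> moves to \<open>x\<close>, which lies in the
      same members of \<open>L\<close>.\<close>
    define b' where "b' = b(x := b x + b y, y := 0)"
    have "sum b' X = sum b X" if "finite X" "(x \<in> X) = (y \<in> X)" for X
    proof (cases "x \<in> X")
      case True
      with that \<open>x \<noteq> y\<close> show ?thesis
        by (simp add: b'_def sum.remove[of X x] sum.remove[of "X - {x}" y])
    next
      case False
      with that show ?thesis by (intro sum.cong) (auto simp: b'_def)
    qed
    then have "good b'"
      using b * finw unfolding good_def by (metis IntE IntI finite_Int)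
    moreover have "W b' \<subset> W b" using that by (auto simp: W_def b'_def)
    ultimately show False using min[of b'] psubset_card_mono[of "W b" "W b'"] by simp
  qed
  have cov: "\<exists>w\<in>L. x \<in> w" if "x \<in> W b" for x
  proof (rule ccontr)
    assume *: "\<not> (\<exists>w\<in>L. x \<in> w)"
    define b' where "b' = b(x := 0)"
    have "sum b' X = sum b X" if "x \<notin> X" for X
      using that by (intro sum.cong) (auto simp: b'_def)
    then have "good b'"
      using b * unfolding good_def by (metis IntE)
    moreover have "W b' \<subset> W b" using that by (auto simp: W_def b'_def)
    ultimately show False using min[of b'] psubset_card_mono[of "W b" "W b'"] by simp
  qed
  have sumW: "sum b (X \<inter> W b) = sum b X" if "finite X" "X \<subseteq> V" for X
    using that by (intro sum.mono_neutral_left) (auto simp: W_def)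
  \<comment> \<open>The traces on the support form the separating and covering family.\<close>
  let ?L = "(\<lambda>w. w \<inter> W b) ` L"
  have "\<exists>S :: 'a \<Rightarrow> int. \<forall>w\<in>?L. sum b w - (\<Sum>u\<in>w. of_int (S u) / 2 ^ (r + 1)) \<in> \<int>"
  proof (rule bounded_denominator_if_separating)
    show "card (W b) < 2 ^ (r + 3)"
      using V(3) card_mono[of V "W b"] V(1) by (force simp: W_def)
    show "w \<triangle> w' \<in> ?L" if "w \<in> ?L" "w' \<in> ?L" for w w'
      using that closed by (auto simp flip: symdiff_Int_distrib)
    show "4 * sum b (w1 \<inter> w2 \<inter> w3) \<in> \<int>" if w: "w1 \<in> ?L" "w2 \<in> ?L" "w3 \<in> ?L" for w1 w2 w3
    proof -
      obtain v1 v2 v3 where v: "v1 \<in> L" "v2 \<in> L" "v3 \<in> L"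
        and "w1 = v1 \<inter> W b" "w2 = v2 \<inter> W b" "w3 = v3 \<inter> W b" using w by auto
      then have "w1 \<inter> w2 \<inter> w3 = (v1 \<inter> v2 \<inter> v3) \<inter> W b" by auto
      then have "sum b (w1 \<inter> w2 \<inter> w3) = sum a (v1 \<inter> v2 \<inter> v3)"
        using v b V finw by (simp add: sumW le_infI1 good_def subset_eq)
      then show ?thesis using int v by simp
    qed
  qed (use sep cov V in auto)
  then obtain S :: "'a \<Rightarrow> int" where
    S: "\<And>w. w \<in> L \<Longrightarrow> sum b (w \<inter> W b) - (\<Sum>u\<in>w \<inter> W b. of_int (S u) / 2 ^ (r + 1)) \<in> \<int>" by auto
  define S' where "S' u = (if u \<in> W b then S u else 0)" for u
  have "sum a w - (\<Sum>u\<in>w. of_int (S' u) / 2 ^ (r + 1)) \<in> \<int>" if w: "w \<in> L" for w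
  proof -
    have "sum a w = sum b w" using b w unfolding good_def by (metis Int_absorb)
    moreover have "sum b (w \<inter> W b) = sum b w" using w V finw by (intro sumW) auto
    moreover have "(\<Sum>u\<in>w. of_int (S' u) / 2 ^ (r + 1)) = (\<Sum>u\<in>w \<inter> W b. of_int (S u) / 2 ^ (r + 1) :: real)"
      using finw[OF w] by (intro sum.mono_neutral_cong_right) (auto simp: S'_def)
    ultimately show ?thesis using S[OF w] by simp
  qed
  then show ?thesis by blast
qed

section \<open>Local operators\<close>

lemma sum_Pow_insert:
  assumes "finite V" "u \<notin> V"
  shows "(\<Sum>x\<in>Pow (insert u V). f x) = (\<Sum>x\<in>Pow V. f x + f (insert u x))"
proof -
  have "inj_on (insert u) (Pow V)" using assms by (auto simp: inj_on_def)
  moreover have "Pow V \<inter> insert u ` Pow V = {}" using assms by auto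
  ultimately show ?thesis
    using assms by (simp add: Pow_insert sum.union_disjoint sum.reindex sum.distrib)
qed

lemma prod_sum_bool_eq_sum_Pow:
  fixes f :: "'a \<Rightarrow> bool \<Rightarrow> 'b::comm_semiring_1"
  assumes "finite V"
  shows "(\<Prod>u\<in>V. \<Sum>b\<in>UNIV. f u b) = (\<Sum>x\<in>Pow V. \<Prod>u\<in>V. f u (u \<in> x))"
  using assms
proof (induction V rule: finite_induct)
  case (insert u V)
  have *: "(\<Prod>v\<in>V. f v (v = u \<or> v \<in> x)) = (\<Prod>v\<in>V. f v (v \<in> x))" for x
  proof (rule prod.cong)
    fix v assume "v \<in> V"
    with insert have "v \<noteq> u" by auto
    then show "f v (v = u \<or> v \<in> x) = f v (v \<in> x)" by simp
  qed simp
  have "(\<Sum>x\<in>Pow (insert u V). \<Prod>v\<in>insert u V. f v (v \<in> x))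
    = (\<Sum>x\<in>Pow V. f u False * (\<Prod>v\<in>V. f v (v \<in> x)) + f u True * (\<Prod>v\<in>V. f v (v \<in> x)))"
  proof (subst sum_Pow_insert[OF insert.hyps], rule sum.cong)
    fix x assume "x \<in> Pow V"
    with insert have "u \<notin> x" by auto
    with insert show "(\<Prod>v\<in>insert u V. f v (v \<in> x)) + (\<Prod>v\<in>insert u V. f v (v \<in> insert u x))
      = f u False * (\<Prod>v\<in>V. f v (v \<in> x)) + f u True * (\<Prod>v\<in>V. f v (v \<in> x))"
      by (simp add: *)
  qed simp
  also have "\<dots> = (f u False + f u True) * (\<Sum>x\<in>Pow V. \<Prod>v\<in>V. f v (v \<in> x))"
    by (simp add: sum.distrib sum_distrib_left distrib_right)
  finally show ?case using insert by (simp add: UNIV_bool add.commute)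
qed simp

lemma sum_symdiff_reindex:
  assumes "d \<subseteq> V"
  shows "(\<Sum>x\<in>Pow V. f (x \<triangle> d)) = (\<Sum>x\<in>Pow V. f x)"
  by (rule sum.reindex_bij_witness[of _ "\<lambda>x. x \<triangle> d" "\<lambda>x. x \<triangle> d"]) (use assms in auto)

section \<open>Characters on subsets\<close>

definition parity_sign :: "'a set \<Rightarrow> complex" where
  "parity_sign X = (- 1) ^ card X"

lemma parity_sign_cases: "parity_sign X = 1 \<or> parity_sign X = - 1"
  by (simp add: parity_sign_def minus_one_power_iff)

lemma parity_sign_empty [simp]: "parity_sign {} = 1"
  by (simp add: parity_sign_def)

lemma parity_sign_square [simp]: "parity_sign X * parity_sign X = 1"
  using parity_sign_cases[of X] by auto

lemma parity_sign_nonzero [simp]: "parity_sign X \<noteq> 0"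
  using parity_sign_cases[of X] by auto

lemma norm_parity_sign [simp]: "norm (parity_sign X) = 1"
  using parity_sign_cases[of X] by auto

lemma parity_sign_symdiff:
  assumes "finite A" "finite B"
  shows "parity_sign (A \<triangle> B) = parity_sign A * parity_sign B"
proof -
  have "int (card (A \<triangle> B)) = int (card A) + int (card B) - 2 * int (card (A \<inter> B))"
    using sum_symdiff[OF assms, of "\<lambda>_. 1 :: int"] by simp
  then have "even (card (A \<triangle> B)) \<longleftrightarrow> even (card A + card B)" by presburger
  then show ?thesis by (simp add: parity_sign_def minus_one_power_iff)
qed

lemma parity_sign_symdiff_Int:
  assumes "finite A" "finite B"
  shows "parity_sign ((A \<triangle> B) \<inter> C) = parity_sign (A \<inter> C) * parity_sign (B \<inter> C)"
    "parity_sign (C \<inter> (A \<triangle> B)) = parity_sign (C \<inter> A) * parity_sign (C \<inter> B)"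
  using assms parity_sign_symdiff[of "A \<inter> C" "B \<inter> C"]
  by (simp_all add: symdiff_Int_distrib Int_commute[of C])

lemma sum_parity_sign:
  assumes "finite V" "z \<subseteq> V"
  shows "(\<Sum>x\<in>Pow V. parity_sign (x \<inter> z)) = (if z = {} then 2 ^ card V else 0)"
proof (cases "z = {}")
  case False
  then obtain u where "u \<in> z" by auto
  with assms have u: "u \<in> V" "{u} \<inter> z = {u}" by auto
  have "parity_sign ((x \<triangle> {u}) \<inter> z) = - parity_sign (x \<inter> z)" if "x \<subseteq> V" for x
    using that assms finite_subset[of x V] u by (simp add: parity_sign_symdiff_Int) (simp add: parity_sign_def)
  then have "(\<Sum>x\<in>Pow V. parity_sign ((x \<triangle> {u}) \<inter> z)) = - (\<Sum>x\<in>Pow V. parity_sign (x \<inter> z))"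
    by (simp add: sum_negf)
  moreover have "(\<Sum>x\<in>Pow V. parity_sign ((x \<triangle> {u}) \<inter> z)) = (\<Sum>x\<in>Pow V. parity_sign (x \<inter> z))"
    using u by (intro sum_symdiff_reindex[where f = "\<lambda>x. parity_sign (x \<inter> z)"]) auto
  ultimately show ?thesis using False by simp
qed (use assms in \<open>simp add: card_Pow\<close>)

text \<open>The functions of \<open>x\<close> given by \<open>parity_sign (x \<inter> B)\<close> are
  all characters of \<open>Pow V\<close>; their orthogonality recovers \<open>g y\<close> from the
  transform.\<close>

lemma fourier_zero:
  assumes V: "finite V" and z: "\<And>B. B \<subseteq> V \<Longrightarrow> (\<Sum>x\<in>Pow V. g x * parity_sign (x \<inter> B)) = 0"
    and y: "y \<subseteq> V"
  shows "g y = 0"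
proof -
  have "0 = (\<Sum>B\<in>Pow V. parity_sign (y \<inter> B) * (\<Sum>x\<in>Pow V. g x * parity_sign (x \<inter> B)))"
    using z by simp
  also have "\<dots> = (\<Sum>x\<in>Pow V. g x * (\<Sum>B\<in>Pow V. parity_sign (B \<inter> (x \<triangle> y))))"
    unfolding sum_distrib_left
  proof (subst sum.swap, intro sum.cong refl)
    fix x B assume "x \<in> Pow V" "B \<in> Pow V"
    then have "finite x" "finite y" using V y by (auto intro: finite_subset)
    then show "parity_sign (y \<inter> B) * (g x * parity_sign (x \<inter> B)) = g x * parity_sign (B \<inter> (x \<triangle> y))"
      by (simp add: parity_sign_symdiff_Int Int_commute mult_ac)
  qed
  also have "\<dots> = (\<Sum>x\<in>Pow V. if x = y then g y * 2 ^ card V else 0)"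
  proof (rule sum.cong)
    fix x assume "x \<in> Pow V"
    moreover have "x \<triangle> y = {} \<longleftrightarrow> x = y" by (metis symdiff_cancel(1) symdiff_empty(2) symdiff_self)
    ultimately show "g x * (\<Sum>B\<in>Pow V. parity_sign (B \<inter> (x \<triangle> y))) = (if x = y then g y * 2 ^ card V else 0)"
      using V y by (subst sum_parity_sign) auto
  qed simp
  also have "\<dots> = g y * 2 ^ card V" using V y by simp
  finally show ?thesis by simp
qed

section \<open>Algebra of local operators and expectation values\<close>

definition scale_gate :: "complex \<Rightarrow> gate \<Rightarrow> gate"  (infixl \<open>*k\<close> 70) where
  "c *k A = (\<chi> i j. c * A $ i $ j)"

lemma local_operator_cong:
  assumes "\<And>u. u \<in> V \<Longrightarrow> A u = B u" "\<And>x. x \<subseteq> V \<Longrightarrow> \<psi> x = \<phi> x"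
  shows "local_operator V A \<psi> = local_operator V B \<phi>"
proof -
  have "(\<Prod>u\<in>V. A u $ (u \<in> x) $ (u \<in> y)) = (\<Prod>u\<in>V. B u $ (u \<in> x) $ (u \<in> y))" for x y
    using assms by (intro prod.cong) auto
  then show ?thesis using assms by (auto simp: local_operator_def)
qed

lemma local_operator_mult:
  assumes "finite V"
  shows "local_operator V A (local_operator V B \<psi>) = local_operator V (\<lambda>u. A u ** B u) \<psi>"
proof
  fix x
  show "local_operator V A (local_operator V B \<psi>) x = local_operator V (\<lambda>u. A u ** B u) \<psi> x"
  proof (cases "x \<subseteq> V")
    case True
    let ?P = "\<lambda>M x y. \<Prod>u\<in>V. (M u :: gate) $ (u \<in> x) $ (u \<in> y)"
    have "local_operator V A (local_operator V B \<psi>) x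
      = (\<Sum>y\<in>Pow V. \<Sum>z\<in>Pow V. ?P A x y * ?P B y z * \<psi> z)"
      using True by (auto simp: local_operator_def sum_distrib_left mult.assoc intro!: sum.cong)
    also have "\<dots> = (\<Sum>z\<in>Pow V. (\<Sum>y\<in>Pow V. ?P A x y * ?P B y z) * \<psi> z)"
      by (subst sum.swap) (simp add: sum_distrib_right)
    also have "\<dots> = (\<Sum>z\<in>Pow V. ?P (\<lambda>u. A u ** B u) x z * \<psi> z)"
      using prod_sum_bool_eq_sum_Pow[OF assms, of "\<lambda>u b. A u $ (u \<in> x) $ b * B u $ b $ (u \<in> z)" for z]
      by (simp add: matrix_matrix_mult_def prod.distrib)
    finally show ?thesis using True by (simp add: local_operator_def)
  qed (simp add: local_operator_def)
qed

lemma prod_mat_1: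
  assumes "finite V" "x \<subseteq> V" "y \<subseteq> V"
  shows "(\<Prod>u\<in>V. (mat 1 :: gate) $ (u \<in> x) $ (u \<in> y)) = (if x = y then 1 else 0)"
proof (cases "x = y")
  case False
  then obtain u where "u \<in> V" "(u \<in> x) \<noteq> (u \<in> y)" using assms by blast
  with assms False show ?thesis by (auto simp: mat_def intro!: prod_zero)
qed (simp add: mat_def)

lemma local_operator_mat_1:
  assumes "finite V" "\<And>x. \<not> x \<subseteq> V \<Longrightarrow> \<psi> x = 0"
  shows "local_operator V (\<lambda>_. mat 1) \<psi> = \<psi>"
proof
  fix x show "local_operator V (\<lambda>_. mat 1) \<psi> x = \<psi> x"
    using assms by (cases "x \<subseteq> V")
      (simp_all add: local_operator_def prod_mat_1 if_distrib[of "\<lambda>c. c * _"] cong: if_cong)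
qed

lemma local_operator_scale:
  assumes "finite V"
  shows "local_operator V (\<lambda>u. c u *k A u) \<psi> x = (\<Prod>u\<in>V. c u) * local_operator V A \<psi> x"
  by (simp add: local_operator_def scale_gate_def prod.distrib sum_distrib_left mult.assoc)

lemma local_operator_scale_state:
  "local_operator V A (\<lambda>x. c * \<psi> x) = (\<lambda>x. c * local_operator V A \<psi> x)"
  by (auto simp: local_operator_def sum_distrib_left mult_ac)

lemma local_operator_Z_gate:
  assumes "finite V" "x \<subseteq> V"
  shows "local_operator V (\<lambda>u. Z_gate (\<theta> u)) \<psi> x = cis (sum \<theta> x) * \<psi> x"
proof -
  have "(\<Prod>u\<in>V. Z_gate (\<theta> u) $ (u \<in> x) $ (u \<in> y)) = (if y = x then cis (sum \<theta> x) else 0)"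
    if "y \<subseteq> V" for y
  proof (cases "y = x")
    case True
    have "(\<Prod>u\<in>V. Z_gate (\<theta> u) $ (u \<in> x) $ (u \<in> x)) = (\<Prod>u\<in>V. if u \<in> x then cis (\<theta> u) else 1)"
      by (intro prod.cong) (auto simp: Z_gate_def)
    also have "\<dots> = (\<Prod>u\<in>x. cis (\<theta> u))"
      using assms by (simp add: prod.If_cases Int_absorb1)
    also have "\<dots> = cis (sum \<theta> x)"
      using assms finite_subset[of x V] by (simp add: cis_conv_exp exp_sum sum_distrib_left)
    finally show ?thesis using True by simp
  next
    case False
    then obtain u where "u \<in> V" "(u \<in> x) \<noteq> (u \<in> y)" using assms \<open>y \<subseteq> V\<close> by blast
    with assms False show ?thesis by (auto simp: Z_gate_def intro!: prod_zero)
  qed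
  then show ?thesis
    using assms by (simp add: local_operator_def if_distrib[of "\<lambda>c. c * _"] cong: if_cong)
qed

lemma local_operator_adjoint:
  assumes "finite V"
  shows "(\<Sum>x\<in>Pow V. cnj (local_operator V A \<psi> x) * \<phi> x)
    = (\<Sum>x\<in>Pow V. cnj (\<psi> x) * local_operator V (\<lambda>u. adjoint_gate (A u)) \<phi> x)"
proof -
  let ?P = "\<lambda>x y. \<Prod>u\<in>V. A u $ (u \<in> x) $ (u \<in> y)"
  have "(\<Sum>x\<in>Pow V. cnj (local_operator V A \<psi> x) * \<phi> x)
    = (\<Sum>x\<in>Pow V. \<Sum>y\<in>Pow V. cnj (?P x y) * cnj (\<psi> y) * \<phi> x)"
    by (simp add: local_operator_def sum_distrib_right)
  also have "\<dots> = (\<Sum>y\<in>Pow V. \<Sum>x\<in>Pow V. cnj (\<psi> y) * (cnj (?P x y) * \<phi> x))"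
    by (subst sum.swap) (simp add: mult_ac)
  also have "\<dots> = (\<Sum>x\<in>Pow V. cnj (\<psi> x) * local_operator V (\<lambda>u. adjoint_gate (A u)) \<phi> x)"
    by (simp add: local_operator_def adjoint_gate_def sum_distrib_left)
  finally show ?thesis .
qed

definition expval :: "'a set \<Rightarrow> 'a state \<Rightarrow> ('a \<Rightarrow> gate) \<Rightarrow> complex" where
  "expval V \<psi> A = (\<Sum>x\<in>Pow V. cnj (\<psi> x) * local_operator V A \<psi> x)"

lemma expval_cong:
  assumes "\<And>u. u \<in> V \<Longrightarrow> A u = B u"
  shows "expval V \<psi> A = expval V \<psi> B"
  using local_operator_cong[of V A B \<psi> \<psi>] assms by (simp add: expval_def)

lemma expval_local_operator:
  assumes "finite V"
  shows "expval V (local_operator V U \<psi>) A = expval V \<psi> (\<lambda>u. adjoint_gate (U u) ** A u ** U u)"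
  using assms by (simp add: expval_def local_operator_adjoint local_operator_mult matrix_mul_assoc)

lemma expval_scale:
  assumes "finite V"
  shows "expval V \<psi> (\<lambda>u. c u *k A u) = (\<Prod>u\<in>V. c u) * expval V \<psi> A"
  using assms by (simp add: expval_def local_operator_scale sum_distrib_left mult_ac)

text \<open>The coefficients \<open>f\<close> do not depend on \<open>X\<close>: an expectation
  value is linear in the gate at any single qubit. This is what permits expanding that gate in the
  Pauli basis.\<close>

lemma expval_slot:
  assumes "finite V" "v \<in> V"
  shows "\<exists>f. \<forall>X. expval V \<psi> (A(v := X)) = (\<Sum>i\<in>UNIV. \<Sum>j\<in>UNIV. f i j * X $ i $ j)"
proof -
  define g where "g x y = cnj (\<psi> x) * (\<Prod>u\<in>V - {v}. A u $ (u \<in> x) $ (u \<in> y)) * \<psi> y" for x y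
  define f where "f i j = (\<Sum>x\<in>Pow V. \<Sum>y\<in>Pow V. if i = (v \<in> x) \<and> j = (v \<in> y) then g x y else 0)" for i j
  have "expval V \<psi> (A(v := X)) = (\<Sum>i\<in>UNIV. \<Sum>j\<in>UNIV. f i j * X $ i $ j)" for X
  proof -
    have "(\<Prod>u\<in>V. (A(v := X)) u $ (u \<in> x) $ (u \<in> y))
      = X $ (v \<in> x) $ (v \<in> y) * (\<Prod>u\<in>V - {v}. A u $ (u \<in> x) $ (u \<in> y))" for x y
      using assms by (subst prod.remove[of V v]) (auto intro!: prod.cong)
    then have "expval V \<psi> (A(v := X)) = (\<Sum>x\<in>Pow V. \<Sum>y\<in>Pow V. g x y * X $ (v \<in> x) $ (v \<in> y))"
      by (simp add: expval_def local_operator_def g_def sum_distrib_left mult_ac)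
    also have "\<dots> = (\<Sum>x\<in>Pow V. \<Sum>y\<in>Pow V. \<Sum>i\<in>UNIV. \<Sum>j\<in>UNIV.
        (if i = (v \<in> x) \<and> j = (v \<in> y) then g x y else 0) * X $ i $ j)"
      by (auto simp: UNIV_bool intro!: sum.cong)
    also have "\<dots> = (\<Sum>i\<in>UNIV. \<Sum>j\<in>UNIV. \<Sum>x\<in>Pow V. \<Sum>y\<in>Pow V.
        (if i = (v \<in> x) \<and> j = (v \<in> y) then g x y else 0) * X $ i $ j)"
      by (simp add: UNIV_bool sum.distrib)
    finally show ?thesis by (simp add: f_def sum_distrib_right)
  qed
  then show ?thesis by blast
qed

lemma expval_upd_sum:
  assumes "finite V" "v \<in> V" "finite Q"
  shows "expval V \<psi> (A(v := \<Sum>q\<in>Q. c q *k X q)) = (\<Sum>q\<in>Q. c q * expval V \<psi> (A(v := X q)))"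
proof -
  obtain f where f: "\<And>X. expval V \<psi> (A(v := X)) = (\<Sum>i\<in>UNIV. \<Sum>j\<in>UNIV. f i j * X $ i $ j)"
    using expval_slot[OF assms(1,2)] by blast
  have "(\<Sum>i\<in>UNIV. \<Sum>j\<in>UNIV. f i j * (\<Sum>q\<in>Q. c q *k X q) $ i $ j)
    = (\<Sum>q\<in>Q. c q * (\<Sum>i\<in>UNIV. \<Sum>j\<in>UNIV. f i j * X q $ i $ j))"
    by (simp add: UNIV_bool scale_gate_def sum_distrib_left sum.distrib algebra_simps)
  then show ?thesis by (simp only: f)
qed

section \<open>Pauli matrices and pairings\<close>

text \<open>
  The pair gives the exponents of \<open>X\<close> and \<open>Z\<close>; \<open>(True, True)\<close> is \<open>Y\<close>, with the phase that makes it Hermitian.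
\<close>
definition pauli :: "bool \<times> bool \<Rightarrow> gate" where
  "pauli p = (\<chi> i j. if (i \<noteq> j) = fst p
     then (if fst p \<and> snd p then - \<i> else 1) * (if snd p \<and> i then - 1 else 1) else 0)"

abbreviation I2 :: "bool \<times> bool" where "I2 \<equiv> (False, False)"

lemma sum_bool2:
  fixes f :: "bool \<times> bool \<Rightarrow> 'b::comm_monoid_add"
  shows "(\<Sum>p\<in>UNIV. f p) = f (False, False) + f (False, True) + f (True, False) + f (True, True)"
  unfolding UNIV_Times_UNIV[symmetric] sum.cartesian_product'[symmetric]
  by (simp add: UNIV_bool add_ac)

lemma pauli_I2: "pauli I2 = mat 1"
  by (auto simp: pauli_def mat_def vec_eq_iff)

lemma adjoint_pauli [simp]: "adjoint_gate (pauli p) = pauli p"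
  by (auto simp: pauli_def adjoint_gate_def vec_eq_iff)

lemma pauli_square: "pauli p ** pauli p = mat 1"
  by (auto simp: pauli_def matrix_matrix_mult_def mat_def vec_eq_iff UNIV_bool)

lemma unitary_pauli: "unitary_gate (pauli p)"
  by (simp add: unitary_gate_def pauli_square)

lemma trace_gate: "trace (A :: gate) = A $ False $ False + A $ True $ True"
  by (simp add: trace_def UNIV_bool add.commute)

lemma trace_pauli_mult: "trace (pauli p ** pauli q) = (if p = q then 2 else 0)"
  by (cases p; cases q) (auto simp: trace_gate pauli_def matrix_matrix_mult_def UNIV_bool)

lemma pauli_expansion: "A = (\<Sum>q\<in>UNIV. (trace (pauli q ** A) / 2) *k pauli q)"
  by (auto simp: vec_eq_iff all_bool_eq sum_bool2 trace_gate pauli_def matrix_matrix_mult_def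
      UNIV_bool scale_gate_def field_simps)

text \<open>Parseval's identity for the Hilbert-Schmidt product; the factor 2 is the squared norm of
  each Pauli matrix.\<close>

lemma sum_trace_pauli:
  "(\<Sum>p\<in>UNIV. trace (A ** pauli p) * cnj (trace (B ** pauli p))) = 2 * trace (A ** adjoint_gate B)"
  by (simp add: sum_bool2 trace_gate pauli_def matrix_matrix_mult_def adjoint_gate_def UNIV_bool
      algebra_simps)

text \<open>The matrix of conjugation by \<open>U\<close> in the Pauli basis. For unitary
  \<open>U\<close> it fixes the identity component and is a rotation of the Bloch sphere on the
  other three.\<close>

definition pauli_coeff :: "gate \<Rightarrow> bool \<times> bool \<Rightarrow> bool \<times> bool \<Rightarrow> complex" where
  "pauli_coeff U p q = trace (pauli q ** (adjoint_gate U ** pauli p ** U)) / 2"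

lemma conj_pauli_expansion:
  "adjoint_gate U ** pauli p ** U = (\<Sum>q\<in>UNIV. pauli_coeff U p q *k pauli q)"
  unfolding pauli_coeff_def by (rule pauli_expansion)

lemma trace_conj:
  assumes "unitary_gate U"
  shows "trace (adjoint_gate U ** A ** U) = trace A" "trace (U ** A ** adjoint_gate U) = trace A"
  using assms by (metis matrix_mul_assoc matrix_mul_rid trace_mul_sym unitary_gate_def)+

lemma pauli_coeff_I2:
  assumes "unitary_gate U"
  shows "pauli_coeff U p I2 = (if p = I2 then 1 else 0)" "pauli_coeff U I2 q = (if q = I2 then 1 else 0)"
proof -
  have "trace (pauli p) = (if p = I2 then 2 else 0)" for p
    using trace_pauli_mult[of p I2] by (simp add: pauli_I2)
  then show "pauli_coeff U p I2 = (if p = I2 then 1 else 0)"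
    using trace_conj(1)[OF assms, of "pauli p"] by (simp add: pauli_coeff_def pauli_I2)
  show "pauli_coeff U I2 q = (if q = I2 then 1 else 0)"
    using assms \<open>\<And>p. trace (pauli p) = (if p = I2 then 2 else 0)\<close>
    by (simp add: pauli_coeff_def pauli_I2 unitary_gate_def)
qed

text \<open>Conjugation preserves the Hilbert-Schmidt product. By cyclicity of the trace the
  conjugation moves onto the column label, after which Parseval's identity sums over the
  rows.\<close>

lemma pauli_coeff_columns:
  assumes "unitary_gate U"
  shows "(\<Sum>p\<in>UNIV. pauli_coeff U p q * cnj (pauli_coeff U p q')) = (if q = q' then 1 else 0)"
proof -
  define X where "X q = U ** pauli q ** adjoint_gate U" for q
  have coeff: "pauli_coeff U p q = trace (X q ** pauli p) / 2" for p q
    unfolding pauli_coeff_def X_def by (metis matrix_mul_assoc trace_mul_sym)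
  have "adjoint_gate (X q) = X q" for q
    by (simp add: X_def adjoint_gate_mult matrix_mul_assoc) (simp add: adjoint_gate_def vec_eq_iff)
  moreover have "X q ** X q' = U ** (pauli q ** pauli q') ** adjoint_gate U"
    using assms unfolding X_def unitary_gate_def by (metis matrix_mul_assoc matrix_mul_rid)
  ultimately have "trace (X q ** adjoint_gate (X q')) = trace (pauli q ** pauli q')"
    using trace_conj(2)[OF assms] by simp
  moreover have "(\<Sum>p\<in>UNIV. pauli_coeff U p q * cnj (pauli_coeff U p q'))
    = (\<Sum>p\<in>UNIV. trace (X q ** pauli p) * cnj (trace (X q' ** pauli p))) / 4"
    by (simp add: coeff sum_divide_distrib)
  ultimately show ?thesis
    by (simp only: sum_trace_pauli trace_pauli_mult) auto
qed

lemma pauli_coeff_column_nonzero: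
  assumes "unitary_gate U"
  shows "\<exists>p. pauli_coeff U p q \<noteq> 0"
proof (rule ccontr)
  assume "\<not> ?thesis"
  then have "pauli_coeff U p q = 0" for p by blast
  then have "(\<Sum>p\<in>UNIV. pauli_coeff U p q * cnj (pauli_coeff U p q)) = 0"
    by (simp only: mult_zero_left sum.neutral_const)
  then show False using pauli_coeff_columns[OF assms, of q q] by simp
qed

lemma pauli_coeff_row_nonzero:
  assumes "unitary_gate U"
  shows "\<exists>q. pauli_coeff U p q \<noteq> 0"
proof (rule ccontr)
  assume "\<not> ?thesis"
  then have "adjoint_gate U ** pauli p ** U = 0"
    unfolding conj_pauli_expansion by (intro sum.neutral) (auto simp: scale_gate_def vec_eq_iff)
  then have "U ** (adjoint_gate U ** pauli p ** U) ** adjoint_gate U = 0" by simp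
  then have "pauli p = 0"
    using assms unfolding unitary_gate_def by (metis matrix_mul_assoc matrix_mul_lid matrix_mul_rid)
  then have "pauli p $ False $ fst p = 0" by simp
  then show False by (cases p) (auto simp: pauli_def split: if_splits)
qed

text \<open>On the Bloch sphere: some coordinate axis is carried to a coordinate axis, not
  necessarily the same one.\<close>

definition rigid :: "gate \<Rightarrow> bool" where
  "rigid U \<longleftrightarrow> (\<exists>p q c. p \<noteq> I2 \<and> q \<noteq> I2 \<and> adjoint_gate U ** pauli p ** U = c *k pauli q)"

lemma rigidI:
  assumes "p \<noteq> I2" "q \<noteq> I2" "\<And>q'. q' \<noteq> q \<Longrightarrow> pauli_coeff U p q' = 0"
  shows "rigid U"
proof -
  have "(\<Sum>q\<in>UNIV. pauli_coeff U p q *k pauli q) = (\<Sum>q'\<in>{q}. pauli_coeff U p q' *k pauli q')"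
    using assms(3) by (intro sum.mono_neutral_right) (auto simp: scale_gate_def vec_eq_iff)
  then have "adjoint_gate U ** pauli p ** U = pauli_coeff U p q *k pauli q"
    by (simp add: conj_pauli_expansion)
  with assms show ?thesis unfolding rigid_def by blast
qed

section \<open>Partial expectations with open qubits\<close>

definition mix :: "'a set \<Rightarrow> 'a set \<Rightarrow> 'a set \<Rightarrow> ('a \<Rightarrow> gate) \<Rightarrow> 'a \<Rightarrow> gate" where
  "mix J A B C = (\<lambda>v. if v \<in> J then pauli (v \<in> A, v \<in> B) else C v)"

text \<open>
  The Hilbert-Schmidt pairing of the partial expectations of \<open>C\<close> and \<open>C'\<close> in \<open>\<psi>\<close>, with the qubits
  of \<open>J\<close> left open; it is unchanged by unitaries on \<open>J\<close>.
\<close>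
definition pairing :: "'a set \<Rightarrow> 'a state \<Rightarrow> 'a set \<Rightarrow> ('a \<Rightarrow> gate) \<Rightarrow> ('a \<Rightarrow> gate) \<Rightarrow> complex" where
  "pairing V \<psi> J C C' =
     (\<Sum>A\<in>Pow J. \<Sum>B\<in>Pow J. expval V \<psi> (mix J A B C) * cnj (expval V \<psi> (mix J A B C')))"

lemma pairing_insert:
  assumes "finite J" "w \<notin> J"
  shows "pairing V \<psi> (insert w J) C C'
    = (\<Sum>p\<in>UNIV. pairing V \<psi> J (C(w := pauli p)) (C'(w := pauli p)))"
proof -
  have mix: "mix (insert w J) A B C = mix J A B (C(w := pauli (False, False)))"
    "mix (insert w J) (insert w A) B C = mix J A B (C(w := pauli (True, False)))"
    "mix (insert w J) A (insert w B) C = mix J A B (C(w := pauli (False, True)))"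
    "mix (insert w J) (insert w A) (insert w B) C = mix J A B (C(w := pauli (True, True)))"
    if "A \<subseteq> J" "B \<subseteq> J" for A B C
  proof -
    have "w \<notin> A" "w \<notin> B" using that assms by auto
    with assms show "mix (insert w J) A B C = mix J A B (C(w := pauli (False, False)))"
      "mix (insert w J) (insert w A) B C = mix J A B (C(w := pauli (True, False)))"
      "mix (insert w J) A (insert w B) C = mix J A B (C(w := pauli (False, True)))"
      "mix (insert w J) (insert w A) (insert w B) C = mix J A B (C(w := pauli (True, True)))"
      by (auto simp: mix_def fun_eq_iff)
  qed
  show ?thesis
    unfolding pairing_def sum_bool2 sum.distrib[symmetric] sum_Pow_insert[OF assms]
    by (intro sum.cong) (auto simp: mix)
qed

lemma pairing_upd_sum:
  assumes "finite V" "v \<in> V" "v \<notin> J" "finite Q"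
  shows "pairing V \<psi> J (C(v := \<Sum>q\<in>Q. c q *k X q)) C' = (\<Sum>q\<in>Q. c q * pairing V \<psi> J (C(v := X q)) C')"
    "pairing V \<psi> J C (C'(v := \<Sum>q\<in>Q. c q *k X q)) = (\<Sum>q\<in>Q. cnj (c q) * pairing V \<psi> J C (C'(v := X q)))"
proof -
  have mix: "mix J A B (C(v := Y)) = (mix J A B C)(v := Y)" for A B C Y
    using assms by (auto simp: mix_def fun_eq_iff)
  have "pairing V \<psi> J (C(v := \<Sum>q\<in>Q. c q *k X q)) C' = (\<Sum>A\<in>Pow J. \<Sum>B\<in>Pow J. \<Sum>q\<in>Q.
      c q * (expval V \<psi> (mix J A B (C(v := X q))) * cnj (expval V \<psi> (mix J A B C'))))"
    unfolding pairing_def mix expval_upd_sum[OF assms(1,2,4)] by (simp add: sum_distrib_right mult.assoc)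
  also have "\<dots> = (\<Sum>q\<in>Q. c q * pairing V \<psi> J (C(v := X q)) C')"
    unfolding pairing_def sum_distrib_left by (simp add: sum.swap[of _ Q])
  finally show "pairing V \<psi> J (C(v := \<Sum>q\<in>Q. c q *k X q)) C' = (\<Sum>q\<in>Q. c q * pairing V \<psi> J (C(v := X q)) C')" .
  have "pairing V \<psi> J C (C'(v := \<Sum>q\<in>Q. c q *k X q)) = (\<Sum>A\<in>Pow J. \<Sum>B\<in>Pow J. \<Sum>q\<in>Q.
      cnj (c q) * (expval V \<psi> (mix J A B C) * cnj (expval V \<psi> (mix J A B (C'(v := X q))))))"
    unfolding pairing_def mix expval_upd_sum[OF assms(1,2,4)] by (simp add: sum_distrib_left mult_ac)
  also have "\<dots> = (\<Sum>q\<in>Q. cnj (c q) * pairing V \<psi> J C (C'(v := X q)))"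
    unfolding pairing_def sum_distrib_left by (simp add: sum.swap[of _ Q])
  finally show "pairing V \<psi> J C (C'(v := \<Sum>q\<in>Q. c q *k X q)) = (\<Sum>q\<in>Q. cnj (c q) * pairing V \<psi> J C (C'(v := X q)))" .
qed

lemma pairing_conj_pauli:
  assumes "finite V" "v \<in> V" "v \<notin> J"
  shows "pairing V \<psi> J (C(v := adjoint_gate U ** pauli p ** U)) (C'(v := adjoint_gate U ** pauli p' ** U))
    = (\<Sum>q\<in>UNIV. \<Sum>q'\<in>UNIV. pauli_coeff U p q * cnj (pauli_coeff U p' q')
        * pairing V \<psi> J (C(v := pauli q)) (C'(v := pauli q')))"
  unfolding conj_pauli_expansion
  unfolding pairing_upd_sum(1)[OF assms finite] unfolding pairing_upd_sum(2)[OF assms finite]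
  by (simp add: sum_distrib_left mult.assoc)

text \<open>An open qubit is summed over all Paulis in both arguments simultaneously. Conjugation
  there is a unitary change of the Pauli basis, so orthonormality of the columns of
  \<open>pauli_coeff\<close> collapses the sum, and only the gates outside \<open>J\<close> see
  \<open>U\<close>.\<close>

lemma pairing_local_operator:
  assumes V: "finite V" and U: "\<And>u. u \<in> V \<Longrightarrow> unitary_gate (U u)" and J: "J \<subseteq> V"
  shows "pairing V (local_operator V U \<psi>) J C C'
    = pairing V \<psi> J (\<lambda>u. adjoint_gate (U u) ** C u ** U u) (\<lambda>u. adjoint_gate (U u) ** C' u ** U u)"
  using finite_subset[OF J V] J
proof (induction J arbitrary: C C' rule: finite_induct)
  case empty
  then show ?case by (simp add: pairing_def mix_def expval_local_operator V)
next
  case (insert w J)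
  let ?ad = "\<lambda>C u. adjoint_gate (U u) ** C u ** U u"
  have w: "w \<in> V" using insert by simp
  have "pairing V (local_operator V U \<psi>) (insert w J) C C'
    = (\<Sum>p\<in>UNIV. pairing V \<psi> J (?ad (C(w := pauli p))) (?ad (C'(w := pauli p))))"
    using insert by (simp add: pairing_insert)
  also have "\<dots> = (\<Sum>p\<in>UNIV. \<Sum>q\<in>UNIV. \<Sum>q'\<in>UNIV. pauli_coeff (U w) p q * cnj (pauli_coeff (U w) p q')
        * pairing V \<psi> J ((?ad C)(w := pauli q)) ((?ad C')(w := pauli q')))"
  proof (rule sum.cong)
    fix p
    have "?ad (C(w := pauli p)) = (?ad C)(w := adjoint_gate (U w) ** pauli p ** U w)" for C by auto
    then show "pairing V \<psi> J (?ad (C(w := pauli p))) (?ad (C'(w := pauli p)))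
      = (\<Sum>q\<in>UNIV. \<Sum>q'\<in>UNIV. pauli_coeff (U w) p q * cnj (pauli_coeff (U w) p q')
        * pairing V \<psi> J ((?ad C)(w := pauli q)) ((?ad C')(w := pauli q')))"
      using pairing_conj_pauli[OF V w insert.hyps(2)] by simp
  qed simp
  also have "\<dots> = (\<Sum>q\<in>UNIV. \<Sum>q'\<in>UNIV. (\<Sum>p\<in>UNIV. pauli_coeff (U w) p q * cnj (pauli_coeff (U w) p q'))
        * pairing V \<psi> J ((?ad C)(w := pauli q)) ((?ad C')(w := pauli q')))"
    unfolding sum_distrib_right
    by (subst sum.swap, rule sum.cong[OF refl], subst sum.swap, rule refl)
  also have "\<dots> = (\<Sum>q\<in>UNIV. \<Sum>q'\<in>UNIV. if q = q' then
        pairing V \<psi> J ((?ad C)(w := pauli q)) ((?ad C')(w := pauli q')) else 0)"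
    using pauli_coeff_columns[OF U[OF w]] by (intro sum.cong) auto
  also have "\<dots> = pairing V \<psi> (insert w J) (?ad C) (?ad C')"
    using insert by (simp add: pairing_insert)
  finally show ?case .
qed

section \<open>Stabilizers of graph states\<close>

lemma local_operator_pauli:
  assumes V: "finite V" "x \<subseteq> V" and AB: "A \<subseteq> V" "B \<subseteq> V"
  shows "local_operator V (\<lambda>v. pauli (v \<in> A, v \<in> B)) \<psi> x
    = (- \<i>) ^ card (A \<inter> B) * parity_sign (x \<inter> B) * \<psi> (x \<triangle> A)"
proof -
  let ?c = "(- \<i>) ^ card (A \<inter> B) * parity_sign (x \<inter> B)"
  have "(\<Prod>v\<in>V. pauli (v \<in> A, v \<in> B) $ (v \<in> x) $ (v \<in> y)) = (if y = x \<triangle> A then ?c else 0)"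
    if "y \<subseteq> V" for y
  proof (cases "y = x \<triangle> A")
    case True
    have "(\<Prod>v\<in>V. pauli (v \<in> A, v \<in> B) $ (v \<in> x) $ (v \<in> y))
      = (\<Prod>v\<in>V. (if v \<in> A \<inter> B then - \<i> else 1) * (if v \<in> x \<inter> B then - 1 else 1))"
      using True by (intro prod.cong) (auto simp: pauli_def)
    also have "\<dots> = (\<Prod>v\<in>V. if v \<in> A \<inter> B then - \<i> else 1) * (\<Prod>v\<in>V. if v \<in> x \<inter> B then - 1 else 1)"
      by (rule prod.distrib)
    also have "\<dots> = ?c"
    proof -
      have "V \<inter> {v. v \<in> A \<inter> B} = A \<inter> B" "V \<inter> {v. v \<in> x \<inter> B} = x \<inter> B" using assms by auto
      then show ?thesis using V(1) by (simp only: prod.If_cases) (simp add: parity_sign_def)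
    qed
    finally show ?thesis using True by simp
  next
    case False
    then have "\<exists>v\<in>V. (v \<in> y) \<noteq> (v \<in> x \<triangle> A)"
      using V AB \<open>y \<subseteq> V\<close> symdiff_subset[of x V A] by blast
    then obtain v where "v \<in> V" "(v \<in> y) \<noteq> (v \<in> x \<triangle> A)" by blast
    with V False show ?thesis by (auto simp: pauli_def intro!: prod_zero)
  qed
  then have "local_operator V (\<lambda>v. pauli (v \<in> A, v \<in> B)) \<psi> x
    = (\<Sum>y\<in>Pow V. if y = x \<triangle> A then ?c * \<psi> y else 0)"
    using V by (simp add: local_operator_def if_distrib[of "\<lambda>c. c * _"] cong: if_cong)
  also have "\<dots> = ?c * \<psi> (x \<triangle> A)"
    using V AB symdiff_subset[of x V A] by simp
  finally show ?thesis .
qed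

definition nbrs :: "'a pair_pre_digraph \<Rightarrow> 'a \<Rightarrow> 'a set" where
  "nbrs G u = {v. (u, v) \<in> parcs G}"

definition odd_nbrs :: "'a pair_pre_digraph \<Rightarrow> 'a set \<Rightarrow> 'a set" where
  "odd_nbrs G D = {v \<in> pverts G. odd (card (nbrs G v \<inter> D))}"

definition edge_sign :: "'a pair_pre_digraph \<Rightarrow> 'a set \<Rightarrow> complex" where
  "edge_sign G x = (- 1) ^ card (undirected_edges (with_proj G \<restriction> x))"

lemma undirected_edges_induce:
  "undirected_edges (with_proj G \<restriction> x) = {{u, v} | u v. (u, v) \<in> parcs G \<and> u \<in> x \<and> v \<in> x}"
  by (auto simp: undirected_edges_def arcs_ends_def arc_to_ends_def induce_subgraph_def with_proj_def
      image_iff)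

lemma graph_state_edge_sign:
  "graph_state G x = (if x \<subseteq> pverts G then 1 / sqrt (2 ^ card (pverts G)) * edge_sign G x else 0)"
  by (simp add: graph_state_def edge_sign_def)

context pair_graph
begin

lemma finite_nbrs: "finite (nbrs G u)" and nbrs_subset: "nbrs G u \<subseteq> pverts G"
proof -
  show "nbrs G u \<subseteq> pverts G" by (auto simp: nbrs_def dest: in_arcsD2)
  then show "finite (nbrs G u)" using pair_finite_verts by (rule finite_subset)
qed

lemma nbrs_sym: "v \<in> nbrs G u \<longleftrightarrow> u \<in> nbrs G v"
  unfolding nbrs_def using arcs_symmetric by blast

lemma not_in_own_nbrs: "u \<notin> nbrs G u"
  by (auto simp: nbrs_def dest: no_loops')

lemma odd_nbrs_subset: "odd_nbrs G D \<subseteq> pverts G"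
  by (auto simp: odd_nbrs_def)

lemma odd_nbrs_empty [simp]: "odd_nbrs G {} = {}"
  by (simp add: odd_nbrs_def)

lemma odd_nbrs_singleton: "odd_nbrs G {u} = nbrs G u"
proof -
  have "odd (card (nbrs G v \<inter> {u})) \<longleftrightarrow> v \<in> nbrs G u" for v
    using nbrs_sym[of u v] by (cases "u \<in> nbrs G v") auto
  then show ?thesis using nbrs_subset by (auto simp: odd_nbrs_def)
qed

lemma odd_nbrs_symdiff: "odd_nbrs G (D \<triangle> D') = odd_nbrs G D \<triangle> odd_nbrs G D'"
proof -
  have "odd (card (nbrs G v \<inter> (D \<triangle> D'))) \<longleftrightarrow> odd (card (nbrs G v \<inter> D)) \<noteq> odd (card (nbrs G v \<inter> D'))" for v
  proof -
    let ?A = "nbrs G v \<inter> D" and ?B = "nbrs G v \<inter> D'"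
    have "nbrs G v \<inter> (D \<triangle> D') = ?A \<triangle> ?B" by auto
    moreover have "int (card (?A \<triangle> ?B)) = int (card ?A) + int (card ?B) - 2 * int (card (?A \<inter> ?B))"
      using sum_symdiff[of ?A ?B "\<lambda>_. 1 :: int"] finite_nbrs by simp
    ultimately show ?thesis by presburger
  qed
  then show ?thesis unfolding odd_nbrs_def set_eq_iff in_symdiff mem_Collect_eq by blast
qed

lemma edge_sign_insert:
  assumes "finite x" "u \<notin> x"
  shows "edge_sign G (insert u x) = edge_sign G x * parity_sign (nbrs G u \<inter> x)"
proof -
  let ?E = "\<lambda>x. undirected_edges (with_proj G \<restriction> x)"
  have fin: "finite (?E x)" for x
  proof (rule finite_subset)
    show "?E x \<subseteq> (\<lambda>(u, v). {u, v}) ` parcs G" unfolding undirected_edges_induce by force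
  qed (use pair_finite_arcs in simp)
  have "?E (insert u x) = ?E x \<union> (\<lambda>v. {u, v}) ` (nbrs G u \<inter> x)"
  proof (intro equalityI subsetI)
    fix e assume "e \<in> ?E (insert u x)"
    then obtain a b where e: "e = {a, b}" "(a, b) \<in> parcs G" "a \<in> insert u x" "b \<in> insert u x"
      unfolding undirected_edges_induce by blast
    with no_loops' arcs_symmetric have "a \<noteq> b" "(b, a) \<in> parcs G" by blast+
    with e show "e \<in> ?E x \<union> (\<lambda>v. {u, v}) ` (nbrs G u \<inter> x)"
      unfolding undirected_edges_induce nbrs_def
      by (cases "a = u"; cases "b = u") (simp, blast)+
  next
    fix e assume "e \<in> ?E x \<union> (\<lambda>v. {u, v}) ` (nbrs G u \<inter> x)"
    then show "e \<in> ?E (insert u x)"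
      unfolding undirected_edges_induce nbrs_def by blast
  qed
  moreover have "?E x \<inter> (\<lambda>v. {u, v}) ` (nbrs G u \<inter> x) = {}"
    using assms unfolding undirected_edges_induce by (auto simp: doubleton_eq_iff)
  moreover have "inj_on (\<lambda>v. {u, v}) (nbrs G u \<inter> x)"
    by (auto simp: inj_on_def doubleton_eq_iff)
  ultimately have "card (?E (insert u x)) = card (?E x) + card (nbrs G u \<inter> x)"
    using fin assms by (simp add: card_Un_disjoint card_image)
  then show ?thesis by (simp add: edge_sign_def parity_sign_def power_add)
qed

lemma edge_sign_empty [simp]: "edge_sign G {} = 1"
  by (simp add: edge_sign_def undirected_edges_induce)

lemma edge_sign_square [simp]: "edge_sign G x * edge_sign G x = 1"
  by (simp add: edge_sign_def minus_one_power_iff)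

lemma edge_sign_cancel [simp]: "edge_sign G x * (edge_sign G x * c) = c"
  by (simp flip: mult.assoc)

lemma cnj_edge_sign [simp]: "cnj (edge_sign G x) = edge_sign G x"
  by (simp add: edge_sign_def)

lemma edge_sign_symdiff_singleton:
  assumes "finite x"
  shows "edge_sign G (x \<triangle> {u}) = edge_sign G x * parity_sign (nbrs G u \<inter> x)"
proof (cases "u \<in> x")
  case True
  then have eq: "x \<triangle> {u} = x - {u}" "insert u (x - {u}) = x" by auto
  have "nbrs G u \<inter> (x - {u}) = nbrs G u \<inter> x" using not_in_own_nbrs by auto
  then have "edge_sign G x = edge_sign G (x - {u}) * parity_sign (nbrs G u \<inter> x)"
    using edge_sign_insert[of "x - {u}" u] assms eq by simp
  then show ?thesis using eq by (simp add: mult.assoc)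
next
  case False
  then have "x \<triangle> {u} = insert u x" by auto
  then show ?thesis using edge_sign_insert[OF assms False] by simp
qed

text \<open>The number of induced edges modulo 2 is a quadratic form in \<open>x\<close>. The last
  factor is its polar form, written with the odd neighbourhood.\<close>

lemma edge_sign_symdiff:
  assumes "finite x" "finite D"
  shows "edge_sign G (x \<triangle> D) = edge_sign G x * edge_sign G D * parity_sign (x \<inter> odd_nbrs G D)"
  using assms(2)
proof (induction D rule: finite_induct)
  case (insert u D)
  have ins: "insert u D = D \<triangle> {u}" using insert.hyps by auto
  have "edge_sign G (x \<triangle> (D \<triangle> {u})) = edge_sign G (x \<triangle> D \<triangle> {u})" by (simp add: symdiff_assoc)
  also have "\<dots> = edge_sign G (x \<triangle> D) * parity_sign (nbrs G u \<inter> (x \<triangle> D))"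
    using assms insert by (intro edge_sign_symdiff_singleton) auto
  also have "\<dots> = edge_sign G x * edge_sign G D * parity_sign (x \<inter> odd_nbrs G D)
      * parity_sign (nbrs G u \<inter> x) * parity_sign (nbrs G u \<inter> D)"
    using assms insert by (simp add: insert.IH parity_sign_symdiff_Int)
  also have "\<dots> = edge_sign G x * (edge_sign G D * parity_sign (nbrs G u \<inter> D))
      * (parity_sign (x \<inter> odd_nbrs G D) * parity_sign (x \<inter> nbrs G u))"
    by (simp add: mult_ac Int_commute)
  also have "parity_sign (x \<inter> odd_nbrs G D) * parity_sign (x \<inter> nbrs G u) = parity_sign (x \<inter> odd_nbrs G (D \<triangle> {u}))"
    using finite_nbrs finite_subset[OF odd_nbrs_subset pair_finite_verts]
    by (simp add: odd_nbrs_symdiff odd_nbrs_singleton parity_sign_symdiff_Int)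
  also have "edge_sign G D * parity_sign (nbrs G u \<inter> D) = edge_sign G (D \<triangle> {u})"
    using insert by (simp add: edge_sign_symdiff_singleton)
  finally show ?case using ins by simp
qed simp

text \<open>Applying the Pauli product multiplies the amplitude at \<open>x\<close> by a constant
  phase and a character of \<open>x\<close>, the one attached to
  \<open>B \<triangle> odd_nbrs G A\<close>. Averaging it over all \<open>x\<close> gives 0 unless
  this set is empty.\<close>

lemma norm_expval_graph_state:
  assumes "A \<subseteq> pverts G" "B \<subseteq> pverts G"
  shows "norm (expval (pverts G) (graph_state G) (\<lambda>v. pauli (v \<in> A, v \<in> B)))
    = (if B = odd_nbrs G A then 1 else 0)"
proof -
  let ?V = "pverts G" and ?\<psi> = "graph_state G"
  define K where "K = complex_of_real (1 / sqrt (2 ^ card ?V))"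
  have fin: "finite x" if "x \<subseteq> ?V" for x using that pair_finite_verts by (rule finite_subset)
  have K: "cnj K = K" "K * K = 1 / 2 ^ card ?V"
    by (simp_all add: K_def flip: of_real_mult)
  have "cnj (?\<psi> x) * local_operator ?V (\<lambda>v. pauli (v \<in> A, v \<in> B)) ?\<psi> x
      = K * K * (- \<i>) ^ card (A \<inter> B) * edge_sign G A * parity_sign (x \<inter> (B \<triangle> odd_nbrs G A))"
    if x: "x \<subseteq> ?V" for x
  proof -
    have "?\<psi> x = K * edge_sign G x" using x by (simp add: graph_state_edge_sign K_def)
    moreover have "?\<psi> (x \<triangle> A) = K * (edge_sign G x * edge_sign G A * parity_sign (x \<inter> odd_nbrs G A))"
      using x assms fin edge_sign_symdiff[of x A] symdiff_subset[of x ?V A]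
      by (simp add: graph_state_edge_sign K_def)
    moreover have "parity_sign (x \<inter> (B \<triangle> odd_nbrs G A)) = parity_sign (x \<inter> B) * parity_sign (x \<inter> odd_nbrs G A)"
      using fin assms odd_nbrs_subset by (simp add: parity_sign_symdiff_Int)
    ultimately show ?thesis
      using x assms pair_finite_verts by (simp add: local_operator_pauli K(1) mult_ac)
  qed
  then have "expval ?V ?\<psi> (\<lambda>v. pauli (v \<in> A, v \<in> B))
    = K * K * (- \<i>) ^ card (A \<inter> B) * edge_sign G A * (\<Sum>x\<in>Pow ?V. parity_sign (x \<inter> (B \<triangle> odd_nbrs G A)))"
    by (simp add: expval_def sum_distrib_left)
  also have "\<dots> = (if B = odd_nbrs G A then (- \<i>) ^ card (A \<inter> B) * edge_sign G A else 0)"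
  proof -
    have "B \<triangle> odd_nbrs G A = {} \<longleftrightarrow> B = odd_nbrs G A"
      by (metis symdiff_cancel(1) symdiff_empty(2) symdiff_self)
    then show ?thesis
      using assms pair_finite_verts sum_parity_sign[of ?V "B \<triangle> odd_nbrs G A"]
        symdiff_subset[OF assms(2) odd_nbrs_subset] by (auto simp: K(2))
  qed
  finally show ?thesis by (simp add: norm_mult norm_power edge_sign_def)
qed

end

text \<open>
  Up to sign, the stabilizers of \<open>\<psi>\<close> are the Pauli products with \<open>X\<close> on \<open>A\<close> and \<open>Z\<close> on \<open>Od A\<close>; for a graph
  state, \<open>Od A\<close> is the odd neighbourhood of \<open>A\<close>.
\<close>
locale labelled_state =
  fixes V :: "'a set" and \<psi> :: "'a state" and Od :: "'a set \<Rightarrow> 'a set"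
  assumes finite_V: "finite V"
    and norm_expval: "\<And>A B. A \<subseteq> V \<Longrightarrow> B \<subseteq> V \<Longrightarrow>
      norm (expval V \<psi> (\<lambda>v. pauli (v \<in> A, v \<in> B))) = (if B = Od A then 1 else 0)"
    and Od_symdiff: "\<And>A B. Od (A \<triangle> B) = Od A \<triangle> Od B"
    and Od_subset: "\<And>A. Od A \<subseteq> V"
    and not_in_Od_self: "\<And>u. u \<notin> Od {u}"
    and Od_isolated: "\<And>u A. Od {u} = {} \<Longrightarrow> u \<notin> Od A"

lemma (in pair_graph) labelled_graph_state: "labelled_state (pverts G) (graph_state G) (odd_nbrs G)"
proof
  show "u \<notin> odd_nbrs G A" if "odd_nbrs G {u} = {}" for u A
    using that by (simp add: odd_nbrs_singleton) (simp add: odd_nbrs_def)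
qed (use pair_finite_verts norm_expval_graph_state odd_nbrs_symdiff odd_nbrs_subset
    not_in_own_nbrs odd_nbrs_singleton in auto)

section \<open>Minimal supports of stabilizers through a vertex\<close>

definition realized :: "('a set \<Rightarrow> 'a set) \<Rightarrow> 'a set \<Rightarrow> 'a \<Rightarrow> bool \<times> bool \<Rightarrow> bool" where
  "realized Od B u p \<longleftrightarrow> (\<exists>D. D \<subseteq> B \<and> Od D \<subseteq> B \<and> (u \<in> D, u \<in> Od D) = p)"

text \<open>The situation in which counting gives no information at \<open>u\<close>: on
  \<open>B\<close> all three nontrivial Paulis at \<open>u\<close> occur in stabilizers, and on
  smaller sets none does.\<close>

definition tight :: "('a set \<Rightarrow> 'a set) \<Rightarrow> 'a set \<Rightarrow> 'a \<Rightarrow> bool" where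
  "tight Od B u \<longleftrightarrow> u \<in> B \<and> (\<forall>p. p \<noteq> I2 \<longrightarrow> realized Od B u p) \<and>
     (\<forall>B' p. B' \<subset> B \<longrightarrow> p \<noteq> I2 \<longrightarrow> \<not> realized Od B' u p)"

lemma mix_pauli:
  assumes "A \<subseteq> J" "B \<subseteq> J" "A' \<inter> J = {}" "B' \<inter> J = {}"
  shows "mix J A B (\<lambda>v. pauli (v \<in> A', v \<in> B')) = (\<lambda>v. pauli (v \<in> A \<union> A', v \<in> B \<union> B'))"
proof
  fix v
  show "mix J A B (\<lambda>v. pauli (v \<in> A', v \<in> B')) v = pauli (v \<in> A \<union> A', v \<in> B \<union> B')"
  proof (cases "v \<in> J")
    case True
    then have "v \<notin> A'" "v \<notin> B'" using assms by auto
    with True show ?thesis by (simp add: mix_def)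
  next
    case False
    then have "v \<notin> A" "v \<notin> B" using assms by auto
    with False show ?thesis by (simp add: mix_def)
  qed
qed

context labelled_state
begin

text \<open>A nonzero term of the pairing needs a single Pauli product on \<open>J\<close>, with
  parts \<open>A\<close> and \<open>B\<close>, that completes both prescribed Paulis outside
  \<open>J\<close> to stabilizers.\<close>

lemma pairing_pauli_nonzero:
  assumes J: "J \<subseteq> V" and sub: "A1 \<subseteq> V" "B1 \<subseteq> V" "A2 \<subseteq> V" "B2 \<subseteq> V"
    and disj: "A1 \<inter> J = {}" "B1 \<inter> J = {}" "A2 \<inter> J = {}" "B2 \<inter> J = {}"
    and nz: "pairing V \<psi> J (\<lambda>v. pauli (v \<in> A1, v \<in> B1)) (\<lambda>v. pauli (v \<in> A2, v \<in> B2)) \<noteq> 0"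
  shows "\<exists>A B. A \<subseteq> J \<and> B \<subseteq> J \<and> B \<union> B1 = Od (A \<union> A1) \<and> B \<union> B2 = Od (A \<union> A2)"
proof (rule ccontr)
  assume *: "\<not> ?thesis"
  have "expval V \<psi> (mix J A B (\<lambda>v. pauli (v \<in> A1, v \<in> B1)))
      * cnj (expval V \<psi> (mix J A B (\<lambda>v. pauli (v \<in> A2, v \<in> B2)))) = 0"
    if "A \<subseteq> J" "B \<subseteq> J" for A B
  proof -
    have "B \<union> B1 \<noteq> Od (A \<union> A1) \<or> B \<union> B2 \<noteq> Od (A \<union> A2)" using * that by blast
    moreover have "A \<union> A1 \<subseteq> V" "B \<union> B1 \<subseteq> V" "A \<union> A2 \<subseteq> V" "B \<union> B2 \<subseteq> V" using that J sub by auto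
    ultimately have "norm (expval V \<psi> (\<lambda>v. pauli (v \<in> A \<union> A1, v \<in> B \<union> B1))) = 0 \<or>
        norm (expval V \<psi> (\<lambda>v. pauli (v \<in> A \<union> A2, v \<in> B \<union> B2))) = 0"
      by (metis norm_expval)
    then show ?thesis
      using that disj by (auto simp: mix_pauli)
  qed
  then have "pairing V \<psi> J (\<lambda>v. pauli (v \<in> A1, v \<in> B1)) (\<lambda>v. pauli (v \<in> A2, v \<in> B2)) = 0"
    unfolding pairing_def by (intro sum.neutral ballI) simp
  with nz show False ..
qed

text \<open>All terms are squared norms, each 0 or 1, so \<open>c\<close> counts the stabilizers
  that extend the given Pauli by one on \<open>J\<close>. Only its sign and whether it vanishes are
  recorded.\<close>

lemma pairing_pauli_diag:
  assumes J: "J \<subseteq> V" and sub: "A1 \<subseteq> V" "B1 \<subseteq> V" and disj: "A1 \<inter> J = {}" "B1 \<inter> J = {}"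
  obtains c where "0 \<le> c"
    "pairing V \<psi> J (\<lambda>v. pauli (v \<in> A1, v \<in> B1)) (\<lambda>v. pauli (v \<in> A1, v \<in> B1)) = complex_of_real c"
    "c \<noteq> 0 \<longleftrightarrow> (\<exists>A B. A \<subseteq> J \<and> B \<subseteq> J \<and> B \<union> B1 = Od (A \<union> A1))"
proof
  let ?P = "\<lambda>v. pauli (v \<in> A1, v \<in> B1)"
  define e where "e A B = (norm (expval V \<psi> (mix J A B ?P)))\<^sup>2" for A B
  define c where "c = (\<Sum>A\<in>Pow J. \<Sum>B\<in>Pow J. e A B)"
  have fin: "finite J" using J finite_V by (rule finite_subset)
  show "0 \<le> c" by (simp add: c_def e_def sum_nonneg)
  show eq: "pairing V \<psi> J ?P ?P = complex_of_real c"
    by (simp only: pairing_def c_def e_def of_real_sum complex_norm_square)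
  show "c \<noteq> 0 \<longleftrightarrow> (\<exists>A B. A \<subseteq> J \<and> B \<subseteq> J \<and> B \<union> B1 = Od (A \<union> A1))"
  proof
    assume "c \<noteq> 0"
    then show "\<exists>A B. A \<subseteq> J \<and> B \<subseteq> J \<and> B \<union> B1 = Od (A \<union> A1)"
      using pairing_pauli_nonzero[OF J sub sub disj disj] eq by auto
  next
    assume "\<exists>A B. A \<subseteq> J \<and> B \<subseteq> J \<and> B \<union> B1 = Od (A \<union> A1)"
    then obtain A B where AB: "A \<subseteq> J" "B \<subseteq> J" "B \<union> B1 = Od (A \<union> A1)" by blast
    have "A \<union> A1 \<subseteq> V" "B \<union> B1 \<subseteq> V" using AB(1,2) J sub by auto
    then have "e A B = 1"
      using AB disj norm_expval[of "A \<union> A1" "B \<union> B1"] by (simp add: e_def mix_pauli)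
    moreover have "e A B \<le> (\<Sum>B\<in>Pow J. e A B)"
      using AB fin by (intro member_le_sum) (auto simp: e_def)
    moreover have "(\<Sum>B\<in>Pow J. e A B) \<le> c"
      unfolding c_def using AB fin
      by (intro member_le_sum[of A "Pow J" "\<lambda>A. \<Sum>B\<in>Pow J. e A B"]) (auto simp: e_def intro: sum_nonneg)
    ultimately show "c \<noteq> 0" by linarith
  qed
qed

end

abbreviation pick :: "'a \<Rightarrow> bool \<Rightarrow> 'a set" where
  "pick u b \<equiv> (if b then {u} else {})"

lemma single_pauli:
  "(\<lambda>_. mat 1)(u := pauli p) = (\<lambda>v. pauli (v \<in> pick u (fst p), v \<in> pick u (snd p)))"
  by (cases p) (auto simp: fun_eq_iff pauli_I2)

lemma double_pauli:
  "u \<noteq> w \<Longrightarrow> (\<lambda>_. mat 1)(u := pauli p, w := pauli c)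
    = (\<lambda>v. pauli (v \<in> pick u (fst p) \<union> pick w (fst c), v \<in> pick u (snd p) \<union> pick w (snd c)))"
  by (cases p; cases c) (auto simp: fun_eq_iff pauli_I2)

context labelled_state
begin

text \<open>The number of stabilizers supported on \<open>insert u J\<close> with Pauli
  \<open>p\<close> at \<open>u\<close>, expressed as a pairing so that it can be followed through a
  local unitary.\<close>

definition weight :: "'a set \<Rightarrow> 'a \<Rightarrow> bool \<times> bool \<Rightarrow> complex" where
  "weight J u p = pairing V \<psi> J ((\<lambda>_. mat 1)(u := pauli p)) ((\<lambda>_. mat 1)(u := pauli p))"

lemma weight_nonzero_iff:
  assumes "J \<subseteq> V" "u \<in> V" "u \<notin> J"
  shows "weight J u p \<noteq> 0 \<longleftrightarrow> realized Od (insert u J) u p"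
proof -
  have "pick u b \<subseteq> V" "pick u b \<inter> J = {}" for b using assms by auto
  note sub = this
  let ?P = "\<lambda>v. pauli (v \<in> pick u (fst p), v \<in> pick u (snd p))"
  obtain c where "pairing V \<psi> J ?P ?P = complex_of_real c"
    "c \<noteq> 0 \<longleftrightarrow> (\<exists>A B. A \<subseteq> J \<and> B \<subseteq> J \<and> B \<union> pick u (snd p) = Od (A \<union> pick u (fst p)))"
    by (rule pairing_pauli_diag[OF assms(1) sub(1) sub(1) sub(2) sub(2), of "fst p" "snd p"])
  moreover have "weight J u p = pairing V \<psi> J ?P ?P"
    unfolding weight_def single_pauli ..
  ultimately have "weight J u p \<noteq> 0 \<longleftrightarrow> (\<exists>A B. A \<subseteq> J \<and> B \<subseteq> J \<and> B \<union> pick u (snd p) = Od (A \<union> pick u (fst p)))"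
    by simp
  also have "\<dots> \<longleftrightarrow> realized Od (insert u J) u p"
  proof
    assume "\<exists>A B. A \<subseteq> J \<and> B \<subseteq> J \<and> B \<union> pick u (snd p) = Od (A \<union> pick u (fst p))"
    then obtain A B where AB: "A \<subseteq> J" "B \<subseteq> J" "B \<union> pick u (snd p) = Od (A \<union> pick u (fst p))" by blast
    have "u \<notin> A" "u \<notin> B" using AB assms by auto
    then have "(u \<in> A \<union> pick u (fst p), u \<in> Od (A \<union> pick u (fst p))) = p"
      unfolding AB(3)[symmetric] by (cases p) auto
    moreover have "A \<union> pick u (fst p) \<subseteq> insert u J" "Od (A \<union> pick u (fst p)) \<subseteq> insert u J"
      unfolding AB(3)[symmetric] using AB(1,2) by auto
    ultimately show "realized Od (insert u J) u p"
      unfolding realized_def by blast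
  next
    assume "realized Od (insert u J) u p"
    then obtain D where D: "D \<subseteq> insert u J" "Od D \<subseteq> insert u J" "(u \<in> D, u \<in> Od D) = p"
      by (auto simp: realized_def)
    then have "D - {u} \<union> pick u (fst p) = D" "Od D - {u} \<union> pick u (snd p) = Od D" by auto
    then have "Od D - {u} \<union> pick u (snd p) = Od (D - {u} \<union> pick u (fst p))" by (simp only:)
    moreover have "D - {u} \<subseteq> J" "Od D - {u} \<subseteq> J" using D by auto
    ultimately show "\<exists>A B. A \<subseteq> J \<and> B \<subseteq> J \<and> B \<union> pick u (snd p) = Od (A \<union> pick u (fst p))"
      by blast
  qed
  finally show ?thesis .
qed

text \<open>Two stabilizers that agree on \<open>J\<close> and differ at \<open>u\<close> multiply
  to a stabilizer living on \<open>u\<close> alone. That requires \<open>u\<close> to be isolated,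
  but then no stabilizer has a Z-part at \<open>u\<close>, and two distinct nontrivial Paulis cannot
  both lack it.\<close>

lemma pairing_single_offdiag:
  assumes "J \<subseteq> V" "u \<in> V" "u \<notin> J" "p \<noteq> I2" "p' \<noteq> I2" "p \<noteq> p'"
  shows "pairing V \<psi> J ((\<lambda>_. mat 1)(u := pauli p)) ((\<lambda>_. mat 1)(u := pauli p')) = 0"
proof (rule ccontr)
  assume nz: "pairing V \<psi> J ((\<lambda>_. mat 1)(u := pauli p)) ((\<lambda>_. mat 1)(u := pauli p')) \<noteq> 0"
  have sub: "pick u b \<subseteq> V" "pick u b \<inter> J = {}" for b using assms by auto
  obtain A B where AB: "A \<subseteq> J" "B \<subseteq> J" "B \<union> pick u (snd p) = Od (A \<union> pick u (fst p))"
    "B \<union> pick u (snd p') = Od (A \<union> pick u (fst p'))"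
    using pairing_pauli_nonzero[OF assms(1) sub(1) sub(1) sub(1) sub(1) sub(2) sub(2) sub(2) sub(2) nz[unfolded single_pauli]]
    by blast
  have u: "u \<notin> A" "u \<notin> B" using AB assms by auto
  have ne: "fst p \<noteq> fst p'"
  proof
    assume "fst p = fst p'"
    with AB have "B \<union> pick u (snd p) = B \<union> pick u (snd p')" by simp
    with u have "snd p = snd p'" by (auto split: if_splits)
    with \<open>fst p = fst p'\<close> \<open>p \<noteq> p'\<close> show False by (simp add: prod_eq_iff)
  qed
  have "Od {u} = Od (A \<union> pick u (fst p)) \<triangle> Od (A \<union> pick u (fst p'))"
    using ne u by (auto simp flip: Od_symdiff intro!: arg_cong[of _ _ Od])
  also have "\<dots> = (B \<union> pick u (snd p)) \<triangle> (B \<union> pick u (snd p'))" using AB by simp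
  finally have eq: "Od {u} = (B \<union> pick u (snd p)) \<triangle> (B \<union> pick u (snd p'))" .
  then have "Od {u} = {}" "snd p = snd p'"
    using not_in_Od_self[of u] u by (auto split: if_splits)
  moreover have "snd p \<or> snd p'"
    using ne assms(4,5) by (cases p; cases p') auto
  ultimately have "u \<in> Od (A \<union> pick u (fst p))" using AB(3) by auto
  with Od_isolated[OF \<open>Od {u} = {}\<close>] show False by blast
qed

text \<open>A stabilizer that is trivial at \<open>v\<close> would already live on
  \<open>B - {v}\<close>, against minimality of \<open>B\<close>.\<close>

lemma tight_full:
  assumes "tight Od B u" "D \<subseteq> B" "Od D \<subseteq> B" "u \<in> D \<or> u \<in> Od D" "v \<in> B"
  shows "v \<in> D \<or> v \<in> Od D"
proof (rule ccontr)
  assume "\<not> ?thesis"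
  then have "realized Od (B - {v}) u (u \<in> D, u \<in> Od D)"
    using assms unfolding realized_def by blast
  moreover have "B - {v} \<subset> B" "(u \<in> D, u \<in> Od D) \<noteq> I2" using assms by auto
  ultimately show False using assms(1) unfolding tight_def by blast
qed

text \<open>Otherwise the product \<open>K\<close> of the two stabilizers is trivial at
  \<open>u\<close> and nontrivial at some \<open>v\<close>. Take \<open>D'\<close> with another
  nontrivial Pauli at \<open>u\<close>. The stabilizers of \<open>D1\<close>, \<open>D'\<close> and
  their product are all nontrivial at \<open>u\<close>, hence also at \<open>v\<close>, so they
  carry the three different nontrivial Paulis there. One of them matches \<open>K\<close> at
  \<open>v\<close>; multiplied by \<open>K\<close> it becomes trivial at \<open>v\<close> but not at
  \<open>u\<close>.\<close>

lemma tight_unique: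
  assumes tight: "tight Od B u" and D: "D1 \<subseteq> B" "Od D1 \<subseteq> B" "D2 \<subseteq> B" "Od D2 \<subseteq> B"
    and lab: "(u \<in> D1, u \<in> Od D1) = (u \<in> D2, u \<in> Od D2)" "(u \<in> D1, u \<in> Od D1) \<noteq> I2"
  shows "D1 = D2"
proof (rule ccontr)
  assume "D1 \<noteq> D2"
  then obtain v where v: "v \<in> D1 \<triangle> D2" by auto
  define K where "K = D1 \<triangle> D2"
  have K: "K \<subseteq> B" "Od K \<subseteq> B" "u \<notin> K" "u \<notin> Od K" "v \<in> K"
    using D lab v by (auto simp: K_def Od_symdiff)
  obtain q where q: "q \<noteq> I2" "q \<noteq> (u \<in> D1, u \<in> Od D1)"
    by (metis prod.inject)
  from tight q(1) obtain D' where D': "D' \<subseteq> B" "Od D' \<subseteq> B" "(u \<in> D', u \<in> Od D') = q"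
    unfolding tight_def realized_def by blast
  have absurd: False if E: "E \<subseteq> B" "Od E \<subseteq> B" "u \<in> E \<or> u \<in> Od E" and "(v \<in> E) = (v \<in> K)" "(v \<in> Od E) = (v \<in> Od K)" for E
  proof -
    have "E \<triangle> K \<subseteq> B" "Od (E \<triangle> K) \<subseteq> B" using that K by (auto simp: Od_symdiff)
    then show False
      using tight_full[OF tight, of "E \<triangle> K" v] that K by (auto simp: Od_symdiff)
  qed
  have full: "v \<in> E \<or> v \<in> Od E" if "E \<subseteq> B" "Od E \<subseteq> B" "u \<in> E \<or> u \<in> Od E" for E
    using tight_full[OF tight that] K by auto
  have "u \<in> D1 \<or> u \<in> Od D1" "u \<in> D' \<or> u \<in> Od D'" "u \<in> D1 \<triangle> D' \<or> u \<in> Od (D1 \<triangle> D')"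
    using lab(2) q D'(3) by (auto simp: Od_symdiff)
  moreover have "D1 \<triangle> D' \<subseteq> B" "Od (D1 \<triangle> D') \<subseteq> B" using D D' by (auto simp: Od_symdiff)
  ultimately show False
    using absurd[of D1] absurd[of D'] absurd[of "D1 \<triangle> D'"] full[of D1] full[of D'] full[of "D1 \<triangle> D'"] D D' \<open>v \<in> K\<close>
    unfolding Od_symdiff in_symdiff by blast
qed

text \<open>The stabilizer with \<open>Y\<close> at \<open>u\<close> must be the one of
  \<open>{u, w}\<close>, as \<open>u\<close> is not its own neighbour. This leaves
  \<open>{u}\<close> for the one with \<open>X\<close>. A stabilizer with \<open>Z\<close> at
  \<open>u\<close> shows that \<open>u\<close> is not isolated.\<close>

lemma tight_pair:
  assumes tight: "tight Od B u" and B: "B \<subseteq> {u, w}" "u \<noteq> w"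
  shows "Od {u} = {w}" "Od {w} = {u}"
proof -
  have real: "realized Od B u p" if "p \<noteq> I2" for p using tight that unfolding tight_def by blast
  obtain D1 where D1: "D1 \<subseteq> B" "Od D1 \<subseteq> B" "u \<in> D1" "u \<notin> Od D1"
    using real[of "(True, False)"] by (auto simp: realized_def)
  obtain D2 where D2: "D2 \<subseteq> B" "Od D2 \<subseteq> B" "u \<in> D2" "u \<in> Od D2"
    using real[of "(True, True)"] by (auto simp: realized_def)
  obtain D3 where D3: "u \<in> Od D3"
    using real[of "(False, True)"] by (auto simp: realized_def)
  have "D2 \<noteq> {u}" using D2 not_in_Od_self by auto
  then have "D2 = {u, w}" "w \<in> B" using D2 B by auto
  moreover have "D1 \<noteq> D2" using D1 D2 by auto
  ultimately have "D1 = {u}" using D1 B by auto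
  have uw: "{u, w} = {u} \<triangle> {w}" using B by auto
  have 1: "Od {u} \<subseteq> {w}" using D1 B not_in_Od_self[of u] \<open>D1 = {u}\<close> by auto
  moreover have "Od {u} \<noteq> {}" using Od_isolated D3 by blast
  ultimately show "Od {u} = {w}" by auto
  have "Od {u} \<triangle> Od {w} \<subseteq> {u, w}" "u \<in> Od {u} \<triangle> Od {w}"
    using D2 B \<open>D2 = {u, w}\<close> by (auto simp: uw Od_symdiff)
  moreover from this have "x \<in> {u, w}" if "x \<in> Od {w}" for x
    using that 1 by (cases "x \<in> Od {u}") auto
  ultimately show "Od {w} = {u}" using 1 not_in_Od_self[of w] B by auto
qed

end

section \<open>Local unitaries between graph states\<close>

context labelled_state
begin

lemma pairing_double_diag:
  assumes B: "B \<subseteq> V" and uw: "u \<in> B" "w \<in> B" "u \<noteq> w"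
  shows "\<exists>c\<ge>0. pairing V \<psi> (B - {u, w}) ((\<lambda>_. mat 1)(u := pauli q, w := pauli d))
      ((\<lambda>_. mat 1)(u := pauli q, w := pauli d)) = complex_of_real c \<and>
    (c \<noteq> 0 \<longleftrightarrow> (\<exists>D. D \<subseteq> B \<and> Od D \<subseteq> B \<and> (u \<in> D, u \<in> Od D) = q \<and> (w \<in> D, w \<in> Od D) = d))"
proof -
  let ?J = "B - {u, w}"
  have sub: "pick u a \<union> pick w b \<subseteq> V" "(pick u a \<union> pick w b) \<inter> ?J = {}" for a b
    using uw B by auto
  define X Y where "X = pick u (fst q) \<union> pick w (fst d)" and "Y = pick u (snd q) \<union> pick w (snd d)"
  have "?J \<subseteq> V" using B by auto
  then obtain c where c: "0 \<le> c"
    "pairing V \<psi> ?J (\<lambda>v. pauli (v \<in> X, v \<in> Y)) (\<lambda>v. pauli (v \<in> X, v \<in> Y)) = complex_of_real c"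
    "c \<noteq> 0 \<longleftrightarrow> (\<exists>A C. A \<subseteq> ?J \<and> C \<subseteq> ?J \<and> C \<union> Y = Od (A \<union> X))"
    unfolding X_def Y_def
    by (rule pairing_pauli_diag[OF _ sub(1) sub(1) sub(2) sub(2)])
  have "(\<exists>A C. A \<subseteq> ?J \<and> C \<subseteq> ?J \<and> C \<union> Y = Od (A \<union> X)) \<longleftrightarrow>
    (\<exists>D. D \<subseteq> B \<and> Od D \<subseteq> B \<and> (u \<in> D, u \<in> Od D) = q \<and> (w \<in> D, w \<in> Od D) = d)"
  proof
    assume "\<exists>A C. A \<subseteq> ?J \<and> C \<subseteq> ?J \<and> C \<union> Y = Od (A \<union> X)"
    then obtain A C where AC: "A \<subseteq> ?J" "C \<subseteq> ?J" "C \<union> Y = Od (A \<union> X)" by blast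
    have notin: "u \<notin> A" "w \<notin> A" "u \<notin> C" "w \<notin> C" using AC(1,2) by auto
    then have "(u \<in> A \<union> X, u \<in> C \<union> Y) = q" "(w \<in> A \<union> X, w \<in> C \<union> Y) = d"
      unfolding X_def Y_def using uw by (cases q; cases d; auto)+
    moreover have "A \<union> X \<subseteq> B" "C \<union> Y \<subseteq> B" using AC(1,2) uw by (auto simp: X_def Y_def)
    ultimately show "\<exists>D. D \<subseteq> B \<and> Od D \<subseteq> B \<and> (u \<in> D, u \<in> Od D) = q \<and> (w \<in> D, w \<in> Od D) = d"
      unfolding AC(3) by blast
  next
    assume "\<exists>D. D \<subseteq> B \<and> Od D \<subseteq> B \<and> (u \<in> D, u \<in> Od D) = q \<and> (w \<in> D, w \<in> Od D) = d"
    then obtain D where D: "D \<subseteq> B" "Od D \<subseteq> B" "(u \<in> D, u \<in> Od D) = q" "(w \<in> D, w \<in> Od D) = d" by blast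
    then have "(D - {u, w}) \<union> X = D" "(Od D - {u, w}) \<union> Y = Od D"
      unfolding X_def Y_def by auto
    then have "(Od D - {u, w}) \<union> Y = Od ((D - {u, w}) \<union> X)" by (simp only:)
    moreover have "D - {u, w} \<subseteq> ?J" "Od D - {u, w} \<subseteq> ?J" using D by auto
    ultimately show "\<exists>A C. A \<subseteq> ?J \<and> C \<subseteq> ?J \<and> C \<union> Y = Od (A \<union> X)" by blast
  qed
  with c(3) have iff: "c \<noteq> 0 \<longleftrightarrow> (\<exists>D. D \<subseteq> B \<and> Od D \<subseteq> B \<and> (u \<in> D, u \<in> Od D) = q \<and> (w \<in> D, w \<in> Od D) = d)"
    by (rule trans)
  have "pairing V \<psi> ?J ((\<lambda>_. mat 1)(u := pauli q, w := pauli d)) ((\<lambda>_. mat 1)(u := pauli q, w := pauli d))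
      = complex_of_real c"
    using c(2) unfolding double_pauli[OF uw(3)] X_def Y_def .
  then show ?thesis by (intro exI[of _ c] conjI c(1) iff)
qed

lemma tight_not_singleton:
  assumes "tight Od {u} u"
  shows False
proof -
  have real: "realized Od {u} u p" if "p \<noteq> I2" for p using assms that unfolding tight_def by blast
  obtain D where D: "D \<subseteq> {u}" "u \<in> D" "u \<in> Od D"
    using real[of "(True, True)"] by (auto simp: realized_def)
  then have "D = {u}" by auto
  with D not_in_Od_self show False by blast
qed

end

lemma tightI:
  assumes "u \<in> B" "\<And>p. p \<noteq> I2 \<Longrightarrow> realized Od B u p"
    "\<And>B' p. B' \<subset> B \<Longrightarrow> p \<noteq> I2 \<Longrightarrow> \<not> realized Od B' u p"
  shows "tight Od B u"
  using assms unfolding tight_def by (intro conjI allI impI)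

locale state_pair =
  S1: labelled_state V \<psi> Od1 + S2: labelled_state V "local_operator V U \<psi>" Od2
  for V :: "'a set" and \<psi> U Od1 Od2 +
  assumes unitary: "\<And>u. unitary_gate (U u)"
begin

lemma conj_single:
  "(\<lambda>v. adjoint_gate (U v) ** ((\<lambda>_. mat 1)(u := X)) v ** U v)
    = (\<lambda>_. mat 1)(u := adjoint_gate (U u) ** X ** U u)"
  using unitary by (auto simp: fun_eq_iff unitary_gate_def)

lemma conj_double:
  "u \<noteq> w \<Longrightarrow> (\<lambda>v. adjoint_gate (U v) ** ((\<lambda>_. mat 1)(u := X, w := Y)) v ** U v)
    = (\<lambda>_. mat 1)(u := adjoint_gate (U u) ** X ** U u, w := adjoint_gate (U w) ** Y ** U w)"
  using unitary by (auto simp: fun_eq_iff unitary_gate_def)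

text \<open>The Gram matrices satisfy \<open>g2 = R g1 R*\<close>, where \<open>R\<close> is unitary
  and both are diagonal on nontrivial Paulis. Hence \<open>g2 R = R g1\<close>, and comparing the
  entries at \<open>p\<close>, \<open>q\<close> gives the claim.\<close>

lemma weight_transfer:
  assumes J: "J \<subseteq> V" "u \<in> V" "u \<notin> J" and pq: "p \<noteq> I2" "q \<noteq> I2"
  shows "pauli_coeff (U u) p q \<noteq> 0 \<Longrightarrow> S2.weight J u p = S1.weight J u q"
proof -
  let ?R = "pauli_coeff (U u)"
  let ?g1 = "\<lambda>q q'. pairing V \<psi> J ((\<lambda>_. mat 1)(u := pauli q)) ((\<lambda>_. mat 1)(u := pauli q'))"
  let ?g2 = "\<lambda>p p'. pairing V (local_operator V U \<psi>) J ((\<lambda>_. mat 1)(u := pauli p)) ((\<lambda>_. mat 1)(u := pauli p'))"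
  have g2: "?g2 p p' = (\<Sum>q\<in>UNIV. \<Sum>q'\<in>UNIV. ?R p q * cnj (?R p' q') * ?g1 q q')" for p p'
    by (simp only: pairing_local_operator[OF S1.finite_V unitary J(1)] conj_single)
      (rule pairing_conj_pauli[OF S1.finite_V J(2,3)])
  have "(\<Sum>p'\<in>{p}. ?g2 p p' * ?R p' q) = (\<Sum>p'\<in>UNIV. ?g2 p p' * ?R p' q)"
  proof (rule sum.mono_neutral_left, simp, simp)
    show "\<forall>p'\<in>UNIV - {p}. ?g2 p p' * ?R p' q = 0"
    proof
      fix p' assume "p' \<in> UNIV - {p}"
      then show "?g2 p p' * ?R p' q = 0"
        using S2.pairing_single_offdiag[OF J pq(1), of p'] pauli_coeff_I2(2)[OF unitary, of u q] pq
        by (cases "p' = I2") auto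
    qed
  qed
  also have "(\<Sum>p'\<in>UNIV. ?g2 p p' * ?R p' q)
      = (\<Sum>q1\<in>UNIV. \<Sum>q2\<in>UNIV. ?R p q1 * ?g1 q1 q2 * (\<Sum>p'\<in>UNIV. ?R p' q * cnj (?R p' q2)))"
    unfolding g2 sum_distrib_left sum_distrib_right
    by (subst sum.swap, rule sum.cong[OF refl], subst sum.swap) (simp add: mult_ac)
  also have "\<dots> = (\<Sum>q1\<in>UNIV. ?R p q1 * ?g1 q1 q)"
    unfolding pauli_coeff_columns[OF unitary]
    by (simp add: if_distrib[of "\<lambda>c. _ * c"] cong: if_cong)
  also have "\<dots> = (\<Sum>q1\<in>{q}. ?R p q1 * ?g1 q1 q)"
  proof (rule sum.mono_neutral_right)
    show "\<forall>q1\<in>UNIV - {q}. ?R p q1 * ?g1 q1 q = 0"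
    proof
      fix q1 assume "q1 \<in> UNIV - {q}"
      then show "?R p q1 * ?g1 q1 q = 0"
        using S1.pairing_single_offdiag[OF J _ pq(2), of q1] pauli_coeff_I2(1)[OF unitary, of u p] pq
        by (cases "q1 = I2") auto
    qed
  qed auto
  finally have "S2.weight J u p * ?R p q = ?R p q * S1.weight J u q"
    by (simp add: S1.weight_def S2.weight_def)
  then show "?R p q \<noteq> 0 \<Longrightarrow> S2.weight J u p = S1.weight J u q" by simp
qed

lemma bool2_cases: "p = I2 \<or> p = (False, True) \<or> p = (True, False) \<or> p = (True, True)"
  by (cases p) auto

text \<open>If the count of \<open>q0\<close> differed from the other two, a row of the rotation
  with a nonzero entry at \<open>q0\<close> could have no other nonzero entry, which is rigidity. So
  each of the three counts equals another one, and three such values are all equal.\<close>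

lemma nonrigid_weights:
  assumes J: "J \<subseteq> V" "u \<in> V" "u \<notin> J" and nr: "\<not> rigid (U u)"
  shows "\<exists>m. \<forall>p. p \<noteq> I2 \<longrightarrow> S1.weight J u p = m \<and> S2.weight J u p = m"
proof -
  let ?R = "pauli_coeff (U u)" and ?W = "S1.weight J u"
  have partner: "\<exists>q. q \<noteq> I2 \<and> q \<noteq> q0 \<and> ?W q = ?W q0" if q0: "q0 \<noteq> I2" for q0
  proof (rule ccontr)
    assume *: "\<not> ?thesis"
    obtain p where p: "?R p q0 \<noteq> 0" using pauli_coeff_column_nonzero[OF unitary] by blast
    have "p \<noteq> I2" using p pauli_coeff_I2(2)[OF unitary, of u q0] q0 by auto
    have "?R p q = 0" if "q \<noteq> q0" for q
    proof (cases "q = I2")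
      case True
      then show ?thesis using pauli_coeff_I2(1)[OF unitary, of u p] \<open>p \<noteq> I2\<close> by simp
    next
      case False
      then have "?W q \<noteq> ?W q0" using * that by blast
      then show ?thesis
        using weight_transfer[OF J \<open>p \<noteq> I2\<close> q0 p] weight_transfer[OF J \<open>p \<noteq> I2\<close> False] by metis
    qed
    then have "rigid (U u)" by (rule rigidI[OF \<open>p \<noteq> I2\<close> q0])
    with nr show False ..
  qed
  let ?X = "(True, False)" and ?Y = "(True, True)" and ?Z = "(False, True)"
  have "\<exists>q\<in>{?X, ?Y, ?Z}. q \<noteq> q0 \<and> ?W q = ?W q0" if "q0 \<noteq> I2" for q0
    using partner[OF that] bool2_cases by blast
  then have "?W ?Y = ?W ?X \<or> ?W ?Z = ?W ?X" "?W ?X = ?W ?Y \<or> ?W ?Z = ?W ?Y"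
      "?W ?X = ?W ?Z \<or> ?W ?Y = ?W ?Z"
    by blast+
  then have "?W ?X = ?W ?Z \<and> ?W ?Y = ?W ?Z" by argo
  then have W1: "?W p = ?W ?Z" if "p \<noteq> I2" for p using bool2_cases[of p] that by auto
  have "S2.weight J u p = ?W ?Z" if p: "p \<noteq> I2" for p
  proof -
    obtain q where q: "?R p q \<noteq> 0" using pauli_coeff_row_nonzero[OF unitary] by blast
    have "q \<noteq> I2" using q pauli_coeff_I2(1)[OF unitary, of u p] p by auto
    show ?thesis by (rule trans[OF weight_transfer[OF J p \<open>q \<noteq> I2\<close> q] W1[OF \<open>q \<noteq> I2\<close>]])
  qed
  with W1 show ?thesis by blast
qed

text \<open>Equal counts make realizability on \<open>B\<close> independent of the Pauli at
  \<open>u\<close> and of the state, so one minimal \<open>B\<close> serves both states.\<close>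

lemma nonrigid_tight:
  assumes u: "u \<in> V" and nr: "\<not> rigid (U u)"
  shows "\<exists>B. B \<subseteq> V \<and> tight Od1 B u \<and> tight Od2 B u"
proof -
  define ok where "ok B \<longleftrightarrow> B \<subseteq> V \<and> (\<exists>p. p \<noteq> I2 \<and> realized Od1 B u p)" for B
  have inB: "u \<in> B" if "realized Od B u p" "p \<noteq> I2" for Od B p
    using that unfolding realized_def by auto
  have same: "realized Od1 B u p \<longleftrightarrow> ok B" "realized Od2 B u p \<longleftrightarrow> ok B"
    if B: "B \<subseteq> V" "u \<in> B" and p: "p \<noteq> I2" for B p
  proof -
    have J: "B - {u} \<subseteq> V" "u \<notin> B - {u}" and ins: "insert u (B - {u}) = B" using B by auto
    obtain m where m: "\<And>p. p \<noteq> I2 \<Longrightarrow> S1.weight (B - {u}) u p = m \<and> S2.weight (B - {u}) u p = m"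
      using nonrigid_weights[OF J(1) u J(2) nr] by blast
    have "realized Od1 B u q \<longleftrightarrow> m \<noteq> 0" "realized Od2 B u q \<longleftrightarrow> m \<noteq> 0" if "q \<noteq> I2" for q
      using m[OF that] S1.weight_nonzero_iff[OF J(1) u J(2), of q, unfolded ins]
        S2.weight_nonzero_iff[OF J(1) u J(2), of q, unfolded ins] by simp_all
    with B p show "realized Od1 B u p \<longleftrightarrow> ok B" "realized Od2 B u p \<longleftrightarrow> ok B"
      unfolding ok_def by blast+
  qed
  \<comment> \<open>The stabilizer of \<open>{u}\<close> itself, so that a minimal \<open>B\<close>
    exists.\<close>
  have "realized Od1 V u (True, u \<in> Od1 {u})"
    unfolding realized_def using u S1.Od_subset by (intro exI[of _ "{u}"]) auto
  then have "ok V" unfolding ok_def by auto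
  then obtain B where B: "ok B" and min: "\<And>B'. ok B' \<Longrightarrow> card B \<le> card B'"
    using ex_has_least_nat[of ok V card] by blast
  have sub: "B \<subseteq> V" "u \<in> B" using B inB unfolding ok_def by blast+
  have "\<not> ok B'" if "B' \<subset> B" for B'
    using min[of B'] psubset_card_mono[OF finite_subset[OF sub(1) S1.finite_V] that] by auto
  then have "\<not> realized Od1 B' u p \<and> \<not> realized Od2 B' u p" if "B' \<subset> B" "p \<noteq> I2" for B' p
  proof (cases "u \<in> B'")
    case True
    then show ?thesis using that sub same[of B' p] \<open>\<And>B'. B' \<subset> B \<Longrightarrow> \<not> ok B'\<close>[OF that(1)] by blast
  next
    case False
    then show ?thesis using inB that by blast
  qed
  note none = this
  have real: "realized Od1 B u p" "realized Od2 B u p" if "p \<noteq> I2" for p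
    using same[OF sub that] B by simp_all
  have "tight Od1 B u"
    using sub(2) real(1) none by (intro tightI) simp_all
  moreover have "tight Od2 B u"
    using sub(2) real(2) none by (intro tightI) simp_all
  ultimately
  show ?thesis using sub(1) by blast
qed

text \<open>Consider two stabilizers on \<open>B\<close> that agree on \<open>B - {u, w}\<close>, a
  nonempty set. With the same Pauli at \<open>u\<close> they coincide by uniqueness. With different
  ones their product is nontrivial at \<open>u\<close>, hence nontrivial on all of \<open>B\<close>,
  yet it cancels on \<open>B - {u, w}\<close>.\<close>

lemma double_offdiag:
  assumes tight: "tight Od1 B u" and B: "B \<subseteq> V" and w: "w \<in> B" "w \<noteq> u" "B \<noteq> {u, w}"
    and q: "q \<noteq> I2" "(q, d) \<noteq> (q', d')"
  shows "pairing V \<psi> (B - {u, w}) ((\<lambda>_. mat 1)(u := pauli q, w := pauli d))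
    ((\<lambda>_. mat 1)(u := pauli q', w := pauli d')) = 0"
proof (rule ccontr)
  assume nz: "\<not> ?thesis"
  let ?J = "B - {u, w}"
  have uB: "u \<in> B" using tight by (simp add: tight_def)
  have sub: "pick u a \<union> pick w b \<subseteq> V" "(pick u a \<union> pick w b) \<inter> ?J = {}" for a b
    using uB w B by auto
  define X Y where "X = pick u (fst q) \<union> pick w (fst d)" and "Y = pick u (snd q) \<union> pick w (snd d)"
  define X' Y' where "X' = pick u (fst q') \<union> pick w (fst d')" and "Y' = pick u (snd q') \<union> pick w (snd d')"
  have "\<exists>A C. A \<subseteq> ?J \<and> C \<subseteq> ?J \<and> C \<union> Y = Od1 (A \<union> X) \<and> C \<union> Y' = Od1 (A \<union> X')"
    unfolding X_def Y_def X'_def Y'_def using w(2) nz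
    by (intro S1.pairing_pauli_nonzero sub) (use B in \<open>auto simp: double_pauli\<close>)
  then obtain A C where AC: "A \<subseteq> ?J" "C \<subseteq> ?J" "C \<union> Y = Od1 (A \<union> X)" "C \<union> Y' = Od1 (A \<union> X')" by blast
  define D D' where "D = A \<union> X" and "D' = A \<union> X'"
  have OdD: "Od1 D = C \<union> Y" "Od1 D' = C \<union> Y'" using AC by (simp_all add: D_def D'_def)
  have notin: "u \<notin> A" "w \<notin> A" "u \<notin> C" "w \<notin> C" using AC by auto
  have lab: "(u \<in> D, u \<in> Od1 D) = q" "(w \<in> D, w \<in> Od1 D) = d"
    "(u \<in> D', u \<in> Od1 D') = q'" "(w \<in> D', w \<in> Od1 D') = d'"
    unfolding OdD unfolding D_def D'_def X_def Y_def X'_def Y'_def using notin w(2)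
    by (cases q; cases d; cases q'; cases d'; auto)+
  have DB: "D \<subseteq> B" "Od1 D \<subseteq> B" "D' \<subseteq> B" "Od1 D' \<subseteq> B"
    unfolding OdD unfolding D_def D'_def X_def Y_def X'_def Y'_def using AC uB w by auto
  show False
  proof (cases "q = q'")
    case True
    then have "D = D'" using S1.tight_unique[OF tight DB] lab q by simp
    with lab True q show False by simp
  next
    case False
    obtain v where v: "v \<in> ?J" using uB w B by blast
    have "D \<triangle> D' \<subseteq> B" "Od1 (D \<triangle> D') \<subseteq> B" using DB by (auto simp: S1.Od_symdiff)
    moreover have "u \<in> D \<triangle> D' \<or> u \<in> Od1 (D \<triangle> D')"
      using False lab by (auto simp: S1.Od_symdiff)
    ultimately have "v \<in> D \<triangle> D' \<or> v \<in> Od1 (D \<triangle> D')"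
      using S1.tight_full[OF tight] v by blast
    moreover have "v \<notin> D \<triangle> D'" "v \<notin> Od1 (D \<triangle> D')"
      unfolding S1.Od_symdiff OdD unfolding D_def D'_def X_def Y_def X'_def Y'_def using v by auto
    ultimately show False by blast
  qed
qed

lemma pairing_double_transfer:
  assumes J: "J \<subseteq> V" and uw: "u \<in> V" "w \<in> V" "u \<noteq> w" "u \<notin> J" "w \<notin> J"
  shows "pairing V (local_operator V U \<psi>) J ((\<lambda>_. mat 1)(u := pauli p, w := pauli c))
      ((\<lambda>_. mat 1)(u := pauli p, w := pauli c))
    = (\<Sum>d\<in>UNIV. \<Sum>d'\<in>UNIV. \<Sum>q\<in>UNIV. \<Sum>q'\<in>UNIV.
        pauli_coeff (U w) c d * cnj (pauli_coeff (U w) c d') *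
        (pauli_coeff (U u) p q * cnj (pauli_coeff (U u) p q')) *
        pairing V \<psi> J ((\<lambda>_. mat 1)(u := pauli q, w := pauli d)) ((\<lambda>_. mat 1)(u := pauli q', w := pauli d')))"
proof -
  let ?X = "adjoint_gate (U u) ** pauli p ** U u" and ?Y = "adjoint_gate (U w) ** pauli c ** U w"
  have twist: "(\<lambda>_. mat 1)(u := X, w := Y) = ((\<lambda>_. mat 1)(w := Y, u := X) :: 'a \<Rightarrow> gate)" for X Y
    using uw(3) by (rule fun_upd_twist)
  have "pairing V (local_operator V U \<psi>) J ((\<lambda>_. mat 1)(u := pauli p, w := pauli c))
      ((\<lambda>_. mat 1)(u := pauli p, w := pauli c))
    = pairing V \<psi> J ((\<lambda>_. mat 1)(u := ?X, w := ?Y)) ((\<lambda>_. mat 1)(u := ?X, w := ?Y))"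
    by (simp only: pairing_local_operator[OF S1.finite_V unitary J] conj_double[OF uw(3)])
  also have "\<dots> = (\<Sum>d\<in>UNIV. \<Sum>d'\<in>UNIV. pauli_coeff (U w) c d * cnj (pauli_coeff (U w) c d')
        * pairing V \<psi> J ((\<lambda>_. mat 1)(u := ?X, w := pauli d)) ((\<lambda>_. mat 1)(u := ?X, w := pauli d')))"
    by (rule pairing_conj_pauli[OF S1.finite_V uw(2,5)])
  also have "\<dots> = (\<Sum>d\<in>UNIV. \<Sum>d'\<in>UNIV. pauli_coeff (U w) c d * cnj (pauli_coeff (U w) c d')
        * (\<Sum>q\<in>UNIV. \<Sum>q'\<in>UNIV. pauli_coeff (U u) p q * cnj (pauli_coeff (U u) p q')
        * pairing V \<psi> J ((\<lambda>_. mat 1)(u := pauli q, w := pauli d)) ((\<lambda>_. mat 1)(u := pauli q', w := pauli d'))))"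
    by (simp only: twist pairing_conj_pauli[OF S1.finite_V uw(1,4)])
  finally show ?thesis by (simp only: sum_distrib_left mult.assoc)
qed

text \<open>In the second state only one stabilizer on \<open>B\<close> has \<open>X\<close> at
  \<open>u\<close>; let \<open>c0\<close> be its Pauli at \<open>w\<close>. Expressed in the first
  state, the vanishing of the counts for all other Paulis at \<open>w\<close> is a vanishing sum of
  nonnegative terms. So each \<open>q\<close> occurring in row \<open>X\<close> of the rotation at
  \<open>u\<close> determines a column of the rotation at \<open>w\<close> that is supported in row
  \<open>c0\<close>. Different \<open>q\<close> give different columns, and two such columns cannot
  be orthogonal.\<close>

lemma rigid_if_tight:
  assumes tight: "tight Od1 B u" "tight Od2 B u" and B: "B \<subseteq> V" and w: "w \<in> B" "w \<noteq> u" "B \<noteq> {u, w}"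
  shows "rigid (U u)"
proof -
  let ?J = "B - {u, w}"
  let ?Ru = "pauli_coeff (U u)" and ?Rw = "pauli_coeff (U w)"
  have u: "u \<in> B" "u \<in> V" "w \<in> V" "u \<noteq> w" "u \<notin> ?J" "w \<notin> ?J" "?J \<subseteq> V"
    using tight(1) B w by (auto simp: tight_def)
  define F where "F q d q' d' = pairing V \<psi> ?J ((\<lambda>_. mat 1)(u := pauli q, w := pauli d))
    ((\<lambda>_. mat 1)(u := pauli q', w := pauli d'))" for q d q' d'
  obtain f where f: "\<And>q d. 0 \<le> f q d" "\<And>q d. F q d q d = complex_of_real (f q d)"
    "\<And>q d. f q d \<noteq> 0 \<longleftrightarrow> (\<exists>D. D \<subseteq> B \<and> Od1 D \<subseteq> B \<and> (u \<in> D, u \<in> Od1 D) = q \<and> (w \<in> D, w \<in> Od1 D) = d)"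
    using S1.pairing_double_diag[OF B u(1) w(1) u(4)] unfolding F_def by metis
  let ?p = "(True, False)"
  define g where "g c = pairing V (local_operator V U \<psi>) ?J ((\<lambda>_. mat 1)(u := pauli ?p, w := pauli c))
      ((\<lambda>_. mat 1)(u := pauli ?p, w := pauli c))" for c
  have g: "g c = complex_of_real (\<Sum>d\<in>UNIV. \<Sum>q\<in>UNIV. (norm (?Rw c d))\<^sup>2 * (norm (?Ru ?p q))\<^sup>2 * f q d)" for c
  proof -
    define t where "t d d' q q' = ?Rw c d * cnj (?Rw c d') * (?Ru ?p q * cnj (?Ru ?p q')) * F q d q' d'" for d d' q q'
    \<comment> \<open>Off-diagonal pairings vanish for nontrivial \<open>q\<close>, and the row of
      \<open>X\<close> has no identity component; the sum reduces to its nonnegative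
      diagonal.\<close>
    have t: "t d d' q q' = (if q' = q then if d' = d then t d d q q else 0 else 0)" for d d' q q'
      using pauli_coeff_I2(1)[OF unitary, of u ?p] double_offdiag[OF tight(1) B w, of q d q' d']
      by (cases "q = I2") (auto simp: t_def F_def)
    have "g c = (\<Sum>d\<in>UNIV. \<Sum>d'\<in>UNIV. \<Sum>q\<in>UNIV. \<Sum>q'\<in>UNIV. t d d' q q')"
      unfolding g_def t_def F_def by (rule pairing_double_transfer) (use u in auto)
    also have "\<dots> = (\<Sum>d\<in>UNIV. \<Sum>d'\<in>UNIV. \<Sum>q\<in>UNIV. if d' = d then t d d q q else 0)"
      by (subst t) simp
    also have "\<dots> = (\<Sum>d\<in>UNIV. \<Sum>q\<in>UNIV. \<Sum>d'\<in>UNIV. if d' = d then t d d q q else 0)"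
      by (rule sum.cong[OF refl], rule sum.swap)
    also have "\<dots> = (\<Sum>d\<in>UNIV. \<Sum>q\<in>UNIV. t d d q q)" by simp
    also have "\<dots> = complex_of_real (\<Sum>d\<in>UNIV. \<Sum>q\<in>UNIV. (norm (?Rw c d))\<^sup>2 * (norm (?Ru ?p q))\<^sup>2 * f q d)"
      unfolding t_def f(2) of_real_sum of_real_mult complex_norm_square ..
    finally show ?thesis .
  qed
  have zero: "?Rw c d = 0 \<or> ?Ru ?p q = 0 \<or> f q d = 0" if "g c = 0" for c q d
  proof -
    let ?s = "\<lambda>q d. (norm (?Rw c d))\<^sup>2 * (norm (?Ru ?p q))\<^sup>2 * f q d"
    have "(\<Sum>d\<in>UNIV. \<Sum>q\<in>UNIV. ?s q d) = 0" using that unfolding g of_real_eq_0_iff .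
    note tot = this
    have nn: "0 \<le> ?s q d" for q d by (intro mult_nonneg_nonneg zero_le_power2 f(1))
    have "?s q d \<le> (\<Sum>q\<in>UNIV. ?s q d)"
      by (rule member_le_sum) (simp_all only: UNIV_I nn finite)
    also have "(\<Sum>q\<in>UNIV. ?s q d) \<le> (\<Sum>d\<in>UNIV. \<Sum>q\<in>UNIV. ?s q d)"
      by (rule member_le_sum) (simp_all only: UNIV_I sum_nonneg nn finite)
    finally have "?s q d \<le> 0" unfolding tot .
    then have "?s q d = 0" using nn by (rule order_antisym)
    then show ?thesis by simp
  qed
  obtain D0 where D0: "D0 \<subseteq> B" "Od2 D0 \<subseteq> B" "(u \<in> D0, u \<in> Od2 D0) = ?p"
    using tight(2) unfolding tight_def realized_def by blast
  define c0 where "c0 = (w \<in> D0, w \<in> Od2 D0)"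
  have g0: "g c = 0" if "c \<noteq> c0" for c
  proof (rule ccontr)
    assume "g c \<noteq> 0"
    then obtain D where D: "D \<subseteq> B" "Od2 D \<subseteq> B" "(u \<in> D, u \<in> Od2 D) = ?p" "(w \<in> D, w \<in> Od2 D) = c"
      using S2.pairing_double_diag[OF B u(1) w(1) u(4), of ?p c] unfolding g_def by auto
    then have "D = D0" using S2.tight_unique[OF tight(2) D(1,2) D0(1,2)] D0 by simp
    with D that show False by (simp add: c0_def)
  qed
  obtain q where q: "?Ru ?p q \<noteq> 0" using pauli_coeff_row_nonzero[OF unitary] by blast
  have nI: "q \<noteq> I2" if "?Ru ?p q \<noteq> 0" for q
    using that pauli_coeff_I2(1)[OF unitary, of u ?p] by auto
  have col: "\<exists>D. D \<subseteq> B \<and> Od1 D \<subseteq> B \<and> (u \<in> D, u \<in> Od1 D) = q \<and>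
      (\<forall>c. c \<noteq> c0 \<longrightarrow> ?Rw c (w \<in> D, w \<in> Od1 D) = 0)" if q: "?Ru ?p q \<noteq> 0" for q
  proof -
    obtain D where D: "D \<subseteq> B" "Od1 D \<subseteq> B" "(u \<in> D, u \<in> Od1 D) = q"
      using tight(1) nI[OF q] unfolding tight_def realized_def by blast
    then have "f q (w \<in> D, w \<in> Od1 D) \<noteq> 0" using f(3) by blast
    then have "?Rw c (w \<in> D, w \<in> Od1 D) = 0" if "c \<noteq> c0" for c
      using zero[OF g0[OF that]] q by blast
    with D show ?thesis by blast
  qed
  have "?Ru ?p q' = 0" if "q' \<noteq> q" for q'
  proof (rule ccontr)
    assume q': "?Ru ?p q' \<noteq> 0"
    obtain D where D: "D \<subseteq> B" "Od1 D \<subseteq> B" "(u \<in> D, u \<in> Od1 D) = q"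
      "\<And>c. c \<noteq> c0 \<Longrightarrow> ?Rw c (w \<in> D, w \<in> Od1 D) = 0" using col[OF q] by blast
    obtain D' where D': "D' \<subseteq> B" "Od1 D' \<subseteq> B" "(u \<in> D', u \<in> Od1 D') = q'"
      "\<And>c. c \<noteq> c0 \<Longrightarrow> ?Rw c (w \<in> D', w \<in> Od1 D') = 0" using col[OF q'] by blast
    let ?d = "(w \<in> D, w \<in> Od1 D)" and ?d' = "(w \<in> D', w \<in> Od1 D')"
    have "u \<in> D \<triangle> D' \<or> u \<in> Od1 (D \<triangle> D')" using D(3) D'(3) that by (auto simp: S1.Od_symdiff)
    moreover have "D \<triangle> D' \<subseteq> B" "Od1 (D \<triangle> D') \<subseteq> B" using D(1,2) D'(1,2) by (auto simp: S1.Od_symdiff)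
    ultimately have "w \<in> D \<triangle> D' \<or> w \<in> Od1 (D \<triangle> D')"
      using S1.tight_full[OF tight(1)] w(1) by blast
    then have ne: "?d \<noteq> ?d'" by (auto simp: S1.Od_symdiff)
    \<comment> \<open>Orthogonality of the two columns involves only the entry in row
      \<open>c0\<close>, so one of the columns would be zero.\<close>
    have "(\<Sum>c\<in>UNIV. ?Rw c ?d * cnj (?Rw c ?d')) = (\<Sum>c\<in>{c0}. ?Rw c ?d * cnj (?Rw c ?d'))"
      using D(4) by (intro sum.mono_neutral_right) (auto simp del: split_paired_All)
    then have "?Rw c0 ?d = 0 \<or> ?Rw c0 ?d' = 0"
      by (simp only: pauli_coeff_columns[OF unitary] ne if_False) simp
    then consider "\<And>c. ?Rw c ?d = 0" | "\<And>c. ?Rw c ?d' = 0"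
      using D(4) D'(4) by metis
    then show False
      using pauli_coeff_column_nonzero[OF unitary] by cases blast+
  qed
  then show ?thesis by (intro rigidI[of ?p q]) (use nI[OF q] in auto)
qed

lemma nonrigid_isolated_edge:
  assumes u: "u \<in> V" and nr: "\<not> rigid (U u)"
  shows "\<exists>w\<in>V. w \<noteq> u \<and> Od1 {u} = {w} \<and> Od1 {w} = {u}"
proof -
  obtain B where B: "B \<subseteq> V" "tight Od1 B u" "tight Od2 B u"
    using nonrigid_tight[OF assms] by blast
  have "u \<in> B" "B \<noteq> {u}" using B(2) S1.tight_not_singleton by (auto simp: tight_def)
  then obtain w where w: "w \<in> B" "w \<noteq> u" by auto
  then have "B = {u, w}" using rigid_if_tight[OF B(2,3,1)] nr by blast
  then have "Od1 {u} = {w}" "Od1 {w} = {u}"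
    using S1.tight_pair[OF B(2), of w] w by auto
  with w B(1) show ?thesis by blast
qed

end

section \<open>Moving a gate across an isolated edge\<close>

lemma transpose_adjoint: "adjoint_gate (transpose A) = transpose (adjoint_gate A)"
  by (simp add: adjoint_gate_def transpose_def vec_eq_iff)

lemma unitary_transpose:
  assumes "unitary_gate A"
  shows "unitary_gate (transpose A)"
  using assms unfolding unitary_gate_def transpose_adjoint
  by (metis matrix_transpose_mul transpose_mat)

lemma hadamard_square: "hadamard_gate ** hadamard_gate = mat 1"
proof -
  have "complex_of_real (sqrt 2) * complex_of_real (sqrt 2) = 2"
    by (simp flip: of_real_mult)
  then show ?thesis
    by (auto simp: hadamard_gate_def matrix_matrix_mult_def mat_def vec_eq_iff UNIV_bool)
qed

lemma transpose_hadamard: "transpose hadamard_gate = hadamard_gate"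
  by (auto simp: hadamard_gate_def transpose_def vec_eq_iff)

context pair_graph
begin

text \<open>An isolated edge is a tensor factor of the state whose amplitudes form a multiple of the
  Hadamard matrix. Gates at its ends act on this matrix from the left and, transposed, from the
  right.\<close>

lemma local_operator_isolated_edge:
  assumes edge: "nbrs G u = {w}" "nbrs G w = {u}" and uw: "u \<noteq> w" "u \<in> pverts G" "w \<in> pverts G"
    and x: "x \<subseteq> pverts G"
  shows "local_operator (pverts G) U (graph_state G) x =
    (\<Sum>z\<in>Pow (pverts G - {u, w}). graph_state G z * (\<Prod>v\<in>pverts G - {u, w}. U v $ (v \<in> x) $ (v \<in> z)))
    * (sqrt 2 * (U u ** hadamard_gate ** transpose (U w)) $ (u \<in> x) $ (w \<in> x))"
proof -
  let ?V = "pverts G" and ?W = "pverts G - {u, w}" and ?\<psi> = "graph_state G"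
  have V: "?V = insert u (insert w ?W)" using uw by blast
  have fin: "finite ?W" "finite (insert w ?W)" "u \<notin> insert w ?W" "w \<notin> ?W"
    using finite_Diff[OF pair_finite_verts, of "{u, w}"] uw(1) by simp_all
  define P where "P z = (\<Prod>v\<in>?W. U v $ (v \<in> x) $ (v \<in> z))" for z
  define f where "f y = (\<Prod>v\<in>?V. U v $ (v \<in> x) $ (v \<in> y)) * ?\<psi> y" for y
  have prod: "(\<Prod>v\<in>?V. U v $ (v \<in> x) $ (v \<in> y))
      = U u $ (u \<in> x) $ (u \<in> y) * (U w $ (w \<in> x) $ (w \<in> y) * P (y - {u, w}))" for y
  proof -
    have "(\<Prod>v\<in>?W. U v $ (v \<in> x) $ (v \<in> y)) = P (y - {u, w})"
      unfolding P_def by (intro prod.cong) auto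
    then show ?thesis
      by (subst V) (simp only: prod.insert[OF fin(2,3)] prod.insert[OF fin(1,4)])
  qed
  \<comment> \<open>The four terms are the possible bits at \<open>u\<close> and \<open>w\<close>
    over a fixed \<open>z\<close>; the minus sign comes from the edge between them.\<close>
  have quad: "f z + f (insert w z) + (f (insert u z) + f (insert u (insert w z)))
      = ?\<psi> z * P z * (sqrt 2 * (U u ** hadamard_gate ** transpose (U w)) $ (u \<in> x) $ (w \<in> x))"
    if z: "z \<subseteq> ?W" for z
  proof -
    have zz: "u \<notin> z" "w \<notin> z" "z \<subseteq> ?V" "finite z" using z finite_subset[OF z fin(1)] by auto
    have diff: "z - {u, w} = z" "insert w z - {u, w} = z" "insert u z - {u, w} = z"
        "insert u (insert w z) - {u, w} = z" using zz by auto
    have "edge_sign G (insert w z) = edge_sign G z" "edge_sign G (insert u z) = edge_sign G z"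
      "edge_sign G (insert u (insert w z)) = - edge_sign G z"
      using edge_sign_insert[of z w] edge_sign_insert[of z u] edge_sign_insert[of "insert w z" u]
        zz uw edge by (simp_all add: parity_sign_def)
    then have \<psi>: "?\<psi> (insert w z) = ?\<psi> z" "?\<psi> (insert u z) = ?\<psi> z" "?\<psi> (insert u (insert w z)) = - ?\<psi> z"
      using zz uw by (simp_all add: graph_state_edge_sign)
    have "sqrt 2 * (U u ** hadamard_gate ** transpose (U w)) $ i $ j
      = U u $ i $ False * U w $ j $ False + U u $ i $ False * U w $ j $ True
      + U u $ i $ True * U w $ j $ False - U u $ i $ True * U w $ j $ True" for i j
      by (simp add: matrix_matrix_mult_def transpose_def hadamard_gate_def UNIV_bool field_simps)
    note form = this
    show ?thesis
      using zz uw(1) unfolding f_def prod diff form by (simp add: \<psi> algebra_simps)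
  qed
  have "local_operator ?V U ?\<psi> x = (\<Sum>y\<in>Pow ?V. f y)"
    using x by (simp add: local_operator_def f_def)
  also have "\<dots> = (\<Sum>z\<in>Pow ?W. f z + f (insert w z) + (f (insert u z) + f (insert u (insert w z))))"
    by (subst V) (simp only: sum_Pow_insert[OF fin(2,3)] sum_Pow_insert[OF fin(1,4)] add_ac)
  also have "\<dots> = (\<Sum>z\<in>Pow ?W. ?\<psi> z * P z * (sqrt 2 * (U u ** hadamard_gate ** transpose (U w)) $ (u \<in> x) $ (w \<in> x)))"
    using quad by (intro sum.cong) auto
  finally show ?thesis by (simp only: sum_distrib_right P_def)
qed

text \<open>With H symmetric and of square 1, the new gate at \<open>w\<close> is chosen so that H
  times its transpose is \<open>U u ** hadamard_gate ** transpose (U w)\<close>.\<close>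

lemma local_operator_pull_across_edge:
  assumes edge: "nbrs G u = {w}" "nbrs G w = {u}" and uw: "u \<noteq> w" "u \<in> pverts G" "w \<in> pverts G"
  shows "local_operator (pverts G) (U(u := mat 1,
      w := U w ** hadamard_gate ** transpose (U u) ** hadamard_gate)) (graph_state G)
    = local_operator (pverts G) U (graph_state G)"
    (is "local_operator _ ?U' _ = _")
proof
  fix x
  have "?U' u ** hadamard_gate ** transpose (?U' w) = U u ** hadamard_gate ** transpose (U w)"
    using uw(1) hadamard_square
    by (simp add: matrix_transpose_mul transpose_hadamard matrix_mul_assoc)
  moreover have "(\<Prod>v\<in>pverts G - {u, w}. ?U' v $ (v \<in> x) $ (v \<in> z))
      = (\<Prod>v\<in>pverts G - {u, w}. U v $ (v \<in> x) $ (v \<in> z))" for z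
    by (intro prod.cong) auto
  ultimately show "local_operator (pverts G) ?U' (graph_state G) x
      = local_operator (pverts G) U (graph_state G) x"
    using local_operator_isolated_edge[OF edge uw]
    by (cases "x \<subseteq> pverts G") (simp_all only:, simp add: local_operator_def)
qed

end

lemma pauli_coeff_row_norm:
  assumes "unitary_gate U"
  shows "(\<Sum>q\<in>UNIV. (norm (pauli_coeff U p q))\<^sup>2) = 1"
proof -
  define A where "A = adjoint_gate U ** pauli p ** U"
  have adj: "adjoint_gate A = A"
    by (simp add: A_def adjoint_gate_mult matrix_mul_assoc) (simp add: adjoint_gate_def vec_eq_iff)
  have "A ** A = adjoint_gate U ** (pauli p ** pauli p) ** U"
    using assms unfolding A_def unitary_gate_def by (metis matrix_mul_assoc matrix_mul_rid)
  then have AA: "A ** A = mat 1" using assms by (simp add: pauli_square unitary_gate_def)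
  have coeff: "pauli_coeff U p q = trace (A ** pauli q) / 2" for q
    unfolding pauli_coeff_def A_def by (subst trace_mul_sym) (rule refl)
  have "(\<Sum>q\<in>UNIV. pauli_coeff U p q * cnj (pauli_coeff U p q))
      = (\<Sum>q\<in>UNIV. trace (A ** pauli q) * cnj (trace (A ** pauli q))) / 4"
    by (simp add: coeff sum_divide_distrib)
  also have "\<dots> = 1"
    unfolding sum_trace_pauli adj AA by (simp add: trace_gate mat_def)
  finally have "(\<Sum>q\<in>UNIV. pauli_coeff U p q * cnj (pauli_coeff U p q)) = 1" .
  then have "complex_of_real (\<Sum>q\<in>UNIV. (norm (pauli_coeff U p q))\<^sup>2) = 1"
    by (simp only: of_real_sum complex_norm_square)
  then show ?thesis by (simp only: of_real_eq_1_iff)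
qed

lemma (in state_pair) rigid_partner:
  assumes edge: "Od1 {u} = {w}" "Od1 {w} = {u}" and uw: "u \<noteq> w" "u \<in> V" "w \<in> V" and U: "U u = mat 1"
  shows "rigid (U w)"
proof -
  let ?X = "(True, False)" and ?Z = "(False, True)" and ?R = "pauli_coeff (U w)"
  let ?C = "\<lambda>p d. (\<lambda>_. mat 1)(u := pauli p, w := pauli d)"
  have sub: "pick u a \<union> pick w b \<subseteq> V" for a b using uw by auto
  have norm1: "norm (expval V \<psi> (?C ?X d)) = (if d = ?Z then 1 else 0)" for d
  proof -
    have "Od1 {u, w} = {u, w}"
      using S1.Od_symdiff[of "{u}" "{w}"] edge uw(1) by (auto simp: symdiff_def insert_commute)
    then show ?thesis
      unfolding double_pauli[OF uw(1)] S1.norm_expval[OF sub sub] using edge uw(1)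
      by (cases d) auto
  qed
  have norm2: "norm (expval V (local_operator V U \<psi>) (?C ?X c)) \<in> {0, 1}" for c
    unfolding double_pauli[OF uw(1)] S2.norm_expval[OF sub sub] by simp
  have "expval V (local_operator V U \<psi>) (?C ?X c) = ?R c ?Z * expval V \<psi> (?C ?X ?Z)" for c
  proof -
    have "expval V (local_operator V U \<psi>) (?C ?X c)
        = expval V \<psi> ((\<lambda>_. mat 1)(u := pauli ?X, w := \<Sum>d\<in>UNIV. ?R c d *k pauli d))"
      unfolding expval_local_operator[OF S1.finite_V] conj_double[OF uw(1)] U
      by (simp add: adjoint_gate_mat_1 conj_pauli_expansion)
    also have "\<dots> = (\<Sum>d\<in>UNIV. ?R c d * expval V \<psi> (?C ?X d))"
      by (rule expval_upd_sum[OF S1.finite_V uw(3) finite])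
    also have "\<dots> = (\<Sum>d\<in>{?Z}. ?R c d * expval V \<psi> (?C ?X d))"
    proof (rule sum.mono_neutral_right)
      show "\<forall>d\<in>UNIV - {?Z}. ?R c d * expval V \<psi> (?C ?X d) = 0"
        using norm1 by (metis DiffE insertI1 mult_zero_right norm_eq_zero)
    qed auto
    finally show ?thesis by simp
  qed
  then have R: "norm (?R c ?Z) \<in> {0, 1}" for c
    using norm2[of c] norm1[of ?Z] by (simp add: norm_mult)
  obtain c where "?R c ?Z \<noteq> 0" using pauli_coeff_column_nonzero[OF unitary] by blast
  then have c: "norm (?R c ?Z) = 1" using R[of c] by simp
  then have "c \<noteq> I2" using pauli_coeff_I2(2)[OF unitary, of w ?Z] by auto
  have "?R c q = 0" if "q \<noteq> ?Z" for q
  proof -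
    have "(\<Sum>q\<in>{q, ?Z}. (norm (?R c q))\<^sup>2) \<le> (\<Sum>q\<in>UNIV. (norm (?R c q))\<^sup>2)"
      by (intro sum_mono2) auto
    then show ?thesis using pauli_coeff_row_norm[OF unitary, of w c] c that by simp
  qed
  then show ?thesis using \<open>c \<noteq> I2\<close> by (intro rigidI[of c ?Z]) auto
qed

text \<open>Among all local unitaries between the two states, one with fewest nonrigid gates has
  none: pulling a nonrigid gate across its isolated edge leaves rigid gates at both ends and touches
  no other vertex.\<close>

lemma LU_equivalent_rigid:
  assumes G: "pair_graph G\<^sub>1" "pair_graph G\<^sub>2" and V: "pverts G\<^sub>1 = pverts G\<^sub>2"
    and LU: "LU_equivalent G\<^sub>1 G\<^sub>2"
  shows "\<exists>U. (\<forall>u. unitary_gate (U u)) \<and> (\<forall>u\<in>pverts G\<^sub>1. rigid (U u)) \<and>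
    graph_state G\<^sub>2 = local_operator (pverts G\<^sub>1) U (graph_state G\<^sub>1)"
proof -
  interpret G1: pair_graph G\<^sub>1 by fact
  interpret G2: pair_graph G\<^sub>2 by fact
  let ?V = "pverts G\<^sub>1"
  define ok where "ok U \<longleftrightarrow> (\<forall>u. unitary_gate (U u)) \<and> graph_state G\<^sub>2 = local_operator ?V U (graph_state G\<^sub>1)" for U
  define nr where "nr U = {u \<in> ?V. \<not> rigid (U u)}" for U
  obtain U0 where U0: "\<And>u. u \<in> ?V \<Longrightarrow> unitary_gate (U0 u)" "graph_state G\<^sub>2 = local_operator ?V U0 (graph_state G\<^sub>1)"
    using LU unfolding LU_equivalent_def by blast
  define U1 where "U1 u = (if u \<in> ?V then U0 u else mat 1)" for u
  have "ok U1"
    using U0 local_operator_cong[of ?V U0 U1 "graph_state G\<^sub>1"]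
    by (auto simp: ok_def U1_def unitary_gate_def adjoint_gate_mat_1)
  then obtain U where U: "ok U" and min: "\<And>U'. ok U' \<Longrightarrow> card (nr U) \<le> card (nr U')"
    using ex_has_least_nat[of ok U1 "\<lambda>U. card (nr U)"] by blast
  have pair: "state_pair ?V (graph_state G\<^sub>1) U (odd_nbrs G\<^sub>1) (odd_nbrs G\<^sub>2)" if "ok U" for U
  proof -
    have "labelled_state ?V (local_operator ?V U (graph_state G\<^sub>1)) (odd_nbrs G\<^sub>2)"
      using G2.labelled_graph_state that V by (simp add: ok_def)
    then show ?thesis
      using G1.labelled_graph_state that by (simp add: state_pair_def state_pair_axioms_def ok_def)
  qed
  have "nr U = {}"
  proof (rule ccontr)
    assume "nr U \<noteq> {}"
    then obtain u where u: "u \<in> ?V" "\<not> rigid (U u)" by (auto simp: nr_def)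
    obtain w where w: "w \<in> ?V" "w \<noteq> u" and od: "odd_nbrs G\<^sub>1 {u} = {w}" "odd_nbrs G\<^sub>1 {w} = {u}"
      using state_pair.nonrigid_isolated_edge[OF pair[OF U] u] by blast
    define U' where "U' = U(u := mat 1, w := U w ** hadamard_gate ** transpose (U u) ** hadamard_gate)"
    have "graph_state G\<^sub>2 = local_operator ?V U' (graph_state G\<^sub>1)"
      unfolding U'_def using G1.local_operator_pull_across_edge[of u w U] od w u U
      by (simp add: G1.odd_nbrs_singleton ok_def)
    moreover have "unitary_gate (U' v)" for v
      using U w unitary_hadamard_gate unitary_transpose
      by (auto simp: U'_def ok_def intro!: unitary_gate_mult) (simp add: unitary_gate_def adjoint_gate_mat_1)
    ultimately have ok': "ok U'" by (simp add: ok_def)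
    have "U' u = mat 1" using w by (simp add: U'_def)
    then have "rigid (U' w)"
      using state_pair.rigid_partner[OF pair[OF ok'] od] w u by blast
    moreover have "rigid (U' u)"
    proof -
      have "adjoint_gate (U' u) ** pauli (True, False) ** U' u = 1 *k pauli (True, False)"
        unfolding \<open>U' u = mat 1\<close> by (simp add: adjoint_gate_mat_1 scale_gate_def vec_eq_iff)
      then show ?thesis unfolding rigid_def by blast
    qed
    moreover have "U' v = U v" if "v \<noteq> u" "v \<noteq> w" for v using that by (simp add: U'_def)
    ultimately have "nr U' \<subseteq> nr U - {u}" by (auto simp: nr_def) metis
    moreover have "finite (nr U)" "u \<in> nr U" using G1.pair_finite_verts u by (auto simp: nr_def)
    ultimately have "card (nr U') < card (nr U)"
      by (meson card_Diff1_less card_mono finite_Diff le_less_trans)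
    with min[OF ok'] show False by simp
  qed
  with U show ?thesis by (auto simp: ok_def nr_def)
qed

section \<open>Rigid gates as Z-rotations between Cliffords\<close>

lemma generated_gates_mono:
  assumes "1 \<le> r" "A \<in> generated_gates 1"
  shows "A \<in> generated_gates r"
  using assms(2)
proof (induction rule: generated_gates.induct)
  case Z
  have "pi / 2 ^ 1 = real (2 ^ (r - 1)) * (pi / 2 ^ r)"
    using assms(1) by (cases r) auto
  then show ?case by (simp only: Z_gate_multiple_in_generated_gates)
qed (auto intro: generated_gates.intros)

lemma pauli_Z_eq: "pauli (False, True) = Z_gate pi"
  by (auto simp: pauli_def Z_gate_def vec_eq_iff)

lemma pauli_Z_in_generated_gates: "pauli (False, True) \<in> generated_gates 1"
  using Z_gate_multiple_in_generated_gates[of 2 1] by (simp add: pauli_Z_eq)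

lemma hadamard_conj_Z: "hadamard_gate ** pauli (False, True) ** hadamard_gate = pauli (True, False)"
proof -
  have "complex_of_real (sqrt 2) * complex_of_real (sqrt 2) = 2"
    by (simp flip: of_real_mult)
  then show ?thesis
    by (auto simp: hadamard_gate_def pauli_def matrix_matrix_mult_def vec_eq_iff UNIV_bool)
qed

lemma pauli_X_in_generated_gates: "pauli (True, False) \<in> generated_gates 1"
  using hadamard_conj_Z pauli_Z_in_generated_gates
  by (metis generated_gates.H generated_gates.mult)

lemma adjoint_hadamard: "adjoint_gate hadamard_gate = hadamard_gate"
  by (auto simp: adjoint_gate_def hadamard_gate_def vec_eq_iff)

lemma adjoint_adjoint_gate [simp]: "adjoint_gate (adjoint_gate A) = A"
  by (simp add: adjoint_gate_def vec_eq_iff)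

lemma pauli_conj_Z:
  assumes "p \<noteq> I2"
  shows "\<exists>C\<in>generated_gates 1. adjoint_gate C ** pauli (False, True) ** C = pauli p"
proof -
  have S: "Z_gate (pi / 2) \<in> generated_gates 1" using generated_gates.Z[of 1] by simp
  consider "p = (False, True)" | "p = (True, False)" | "p = (True, True)" using assms by (cases p) auto
  then show ?thesis
  proof cases
    case 1
    then show ?thesis by (intro bexI[of _ "mat 1"]) (auto simp: adjoint_gate_mat_1 generated_gates.one)
  next
    case 2
    then show ?thesis
      by (intro bexI[of _ hadamard_gate]) (auto simp: adjoint_hadamard hadamard_conj_Z generated_gates.H)
  next
    case 3
    let ?C = "hadamard_gate ** adjoint_gate (Z_gate (pi / 2))"
    have "adjoint_gate ?C ** pauli (False, True) ** ?C
      = Z_gate (pi / 2) ** (hadamard_gate ** pauli (False, True) ** hadamard_gate) ** adjoint_gate (Z_gate (pi / 2))"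
      by (simp add: adjoint_gate_mult adjoint_hadamard matrix_mul_assoc)
    also have "\<dots> = pauli (True, True)"
      unfolding hadamard_conj_Z
      by (auto simp: pauli_def Z_gate_def adjoint_gate_def matrix_matrix_mult_def vec_eq_iff UNIV_bool)
    finally show ?thesis
      using 3 S by (intro bexI[of _ ?C]) (auto intro: generated_gates.mult generated_gates.H adjoint_in_generated_gates)
  qed
qed

lemma scale_gate_mult: "(c *k A) ** B = c *k (A ** B)" "A ** (c *k B) = c *k (A ** B)"
  by (simp_all add: scale_gate_def matrix_matrix_mult_def vec_eq_iff sum_distrib_left mult_ac)

lemma diagonal_unitary:
  assumes "unitary_gate W" "W $ False $ True = 0" "W $ True $ False = 0"
  shows "\<exists>\<alpha> \<theta>. norm \<alpha> = 1 \<and> W = \<alpha> *k Z_gate \<theta>"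
proof -
  let ?a = "W $ False $ False" and ?b = "W $ True $ True"
  have "(adjoint_gate W ** W) $ i $ i = 1" for i
    using assms(1) by (simp add: unitary_gate_def mat_def)
  from this[of False] this[of True] have "cnj ?a * ?a = 1" "cnj ?b * ?b = 1"
    using assms(2,3) by (simp_all add: adjoint_gate_def matrix_matrix_mult_def UNIV_bool)
  then have "norm (cnj ?a * ?a) = 1" "norm (cnj ?b * ?b) = 1" by simp_all
  then have n: "norm ?a = 1" "norm ?b = 1"
    using abs_square_eq_1[of "norm ?a"] abs_square_eq_1[of "norm ?b"]
    by (simp_all add: norm_mult power2_eq_square)
  then have "cis (Arg (?b / ?a)) = ?b / ?a"
    by (subst cis_Arg) (auto simp: sgn_eq norm_divide)
  then have "W = ?a *k Z_gate (Arg (?b / ?a))"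
    using n assms(2,3) by (auto simp: scale_gate_def Z_gate_def vec_eq_iff all_bool_eq)
  with n show ?thesis by blast
qed

text \<open>Cliffords carry both axes to \<open>Z\<close>, which leaves a unitary \<open>W\<close>
  with \<open>Z W = c W Z\<close>. Entrywise this makes \<open>W\<close> diagonal, or antidiagonal
  when \<open>c = - 1\<close>; a factor \<open>X\<close> turns the second case into the
  first.\<close>

lemma rigid_decomposition:
  assumes U: "unitary_gate U" and "rigid U"
  shows "\<exists>\<alpha> \<theta> P Q. norm \<alpha> = 1 \<and> P \<in> generated_gates 1 \<and> Q \<in> generated_gates 1 \<and>
    U = \<alpha> *k (P ** Z_gate \<theta> ** Q)"
proof -
  let ?Z = "pauli (False, True)" and ?X = "pauli (True, False)"
  obtain p q c where p: "p \<noteq> I2" and q: "q \<noteq> I2" and conj: "adjoint_gate U ** pauli p ** U = c *k pauli q"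
    using \<open>rigid U\<close> unfolding rigid_def by blast
  obtain C D where C: "C \<in> generated_gates 1" "adjoint_gate C ** ?Z ** C = pauli p"
    and D: "D \<in> generated_gates 1" "adjoint_gate D ** ?Z ** D = pauli q"
    using pauli_conj_Z[OF p] pauli_conj_Z[OF q] by blast
  have uC: "unitary_gate C" and uD: "unitary_gate D" using C D generated_gates_unitary by auto
  define W where "W = C ** U ** adjoint_gate D"
  have adj: "unitary_gate (adjoint_gate A)" if "unitary_gate A" for A
    using that by (simp add: unitary_gate_def)
  have uW: "unitary_gate W" unfolding W_def by (intro unitary_gate_mult adj uC uD U)
  have UW: "U = adjoint_gate C ** W ** D"
    using uC uD unfolding W_def unitary_gate_def by (metis matrix_mul_assoc matrix_mul_lid matrix_mul_rid)
  have "adjoint_gate W ** ?Z ** W = D ** (adjoint_gate U ** (adjoint_gate C ** ?Z ** C) ** U) ** adjoint_gate D"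
    by (simp add: W_def adjoint_gate_mult matrix_mul_assoc)
  also have "\<dots> = c *k (D ** (adjoint_gate D ** ?Z ** D) ** adjoint_gate D)"
    by (simp add: C D conj scale_gate_mult)
  also have "D ** (adjoint_gate D ** ?Z ** D) ** adjoint_gate D = ?Z"
    using uD unfolding unitary_gate_def by (metis matrix_mul_assoc matrix_mul_lid matrix_mul_rid)
  finally have "W ** (adjoint_gate W ** ?Z ** W) = c *k (W ** ?Z)" by (simp add: scale_gate_mult)
  moreover have "W ** (adjoint_gate W ** ?Z ** W) = ?Z ** W"
    using uW unfolding unitary_gate_def by (metis matrix_mul_assoc matrix_mul_lid)
  ultimately have "(?Z ** W) $ i $ j = (c *k (W ** ?Z)) $ i $ j" for i j by simp
  note ij = this
  have "W $ False $ False = c * W $ False $ False" "W $ True $ True = c * W $ True $ True"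
      "W $ False $ True = - (c * W $ False $ True)" "- W $ True $ False = c * W $ True $ False"
    using ij[of False False] ij[of True True] ij[of False True] ij[of True False]
    by (simp_all add: scale_gate_def pauli_def matrix_matrix_mult_def UNIV_bool)
  then have "W $ False $ False * (1 - c) = 0" "W $ True $ True * (1 - c) = 0"
      "W $ False $ True * (1 + c) = 0" "W $ True $ False * (1 + c) = 0"
    unfolding ring_distribs mult_1_right mult.commute[of _ c]
    by (metis diff_self, metis diff_self, metis add.commute add.right_inverse, metis add.right_inverse)
  then have ent: "c = 1 \<or> W $ False $ False = 0" "c = 1 \<or> W $ True $ True = 0"
      "c = - 1 \<or> W $ False $ True = 0" "c = - 1 \<or> W $ True $ False = 0"
    by (auto simp: add_eq_0_iff)
  show ?thesis
  proof (cases "c = - 1")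
    case False
    then obtain \<alpha> \<theta> where "norm \<alpha> = 1" "W = \<alpha> *k Z_gate \<theta>"
      using diagonal_unitary[OF uW] ent by auto
    then have "U = \<alpha> *k (adjoint_gate C ** Z_gate \<theta> ** D)"
      using UW by (simp add: scale_gate_mult)
    with \<open>norm \<alpha> = 1\<close> show ?thesis using C(1) D(1) adjoint_in_generated_gates by blast
  next
    case True
    then have W0: "W $ False $ False = 0" "W $ True $ True = 0" using ent by auto
    have "unitary_gate (W ** ?X)" by (intro unitary_gate_mult uW unitary_pauli)
    moreover have "(W ** ?X) $ False $ True = 0" "(W ** ?X) $ True $ False = 0"
      using W0 by (simp_all add: pauli_def matrix_matrix_mult_def UNIV_bool)
    ultimately obtain \<alpha> \<theta> where "norm \<alpha> = 1" "W ** ?X = \<alpha> *k Z_gate \<theta>"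
      using diagonal_unitary by blast
    then have "W = \<alpha> *k (Z_gate \<theta> ** ?X)"
      by (metis matrix_mul_assoc matrix_mul_rid pauli_square scale_gate_mult(1))
    then have "U = \<alpha> *k (adjoint_gate C ** Z_gate \<theta> ** (?X ** D))"
      using UW by (simp add: scale_gate_mult matrix_mul_assoc)
    with \<open>norm \<alpha> = 1\<close> show ?thesis
      using C(1) D(1) adjoint_in_generated_gates pauli_X_in_generated_gates generated_gates.mult by blast
  qed
qed

section \<open>Clifford images of graph states\<close>

lemma parity_sign_cancel [simp]: "parity_sign X * (parity_sign X * c) = c"
  by (simp flip: mult.assoc)

text \<open>The trait of stabilizer states that the phase argument uses. It is stable under local
  Cliffords and yields an affine support, amplitudes of constant modulus there and sign characters
  under shifts, without reference to a stabilizer group.\<close>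

definition clifford_state :: "'a set \<Rightarrow> 'a state \<Rightarrow> bool" where
  "clifford_state V \<psi> \<longleftrightarrow> (\<Sum>x\<in>Pow V. cnj (\<psi> x) * \<psi> x) = 1 \<and>
     (\<forall>A B. A \<subseteq> V \<longrightarrow> B \<subseteq> V \<longrightarrow> norm (expval V \<psi> (\<lambda>v. pauli (v \<in> A, v \<in> B))) \<in> {0, 1})"

lemma clifford_conj_pauli:
  assumes "C \<in> generated_gates 1"
  shows "\<exists>q c. norm c = 1 \<and> adjoint_gate C ** pauli p ** C = c *k pauli q"
  using assms
proof (induction arbitrary: p rule: generated_gates.induct)
  case one
  have "adjoint_gate (mat 1) ** pauli p ** mat 1 = 1 *k pauli p"
    by (simp add: adjoint_gate_mat_1 scale_gate_def vec_eq_iff)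
  then show ?case by (metis norm_one)
next
  case H
  have 2: "complex_of_real (sqrt 2) * complex_of_real (sqrt 2) = 2"
    by (simp flip: of_real_mult)
  have "adjoint_gate hadamard_gate ** pauli p ** hadamard_gate
      = (if fst p \<and> snd p then - 1 else 1) *k pauli (snd p, fst p)"
    unfolding adjoint_hadamard using 2
    by (cases p) (auto simp: hadamard_gate_def pauli_def matrix_matrix_mult_def vec_eq_iff UNIV_bool
        scale_gate_def)
  then show ?case by (intro exI[of _ "(snd p, fst p)"] exI[of _ "if fst p \<and> snd p then - 1 else 1"]) auto
next
  case Z
  have "adjoint_gate (Z_gate (pi / 2 ^ 1)) ** pauli p ** Z_gate (pi / 2 ^ 1)
      = (if fst p \<and> \<not> snd p then - 1 else 1) *k pauli (fst p, fst p \<noteq> snd p)"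
    by (cases p) (auto simp: Z_gate_def adjoint_gate_def pauli_def matrix_matrix_mult_def vec_eq_iff
        UNIV_bool scale_gate_def)
  then show ?case
    by (intro exI[of _ "(fst p, fst p \<noteq> snd p)"] exI[of _ "if fst p \<and> \<not> snd p then - 1 else 1"]) auto
next
  case (mult A B)
  obtain q c where q: "norm c = 1" "adjoint_gate A ** pauli p ** A = c *k pauli q"
    using mult.IH(1) by blast
  obtain q' c' where q': "norm c' = 1" "adjoint_gate B ** pauli q ** B = c' *k pauli q'"
    using mult.IH(2) by blast
  have "adjoint_gate (A ** B) ** pauli p ** (A ** B) = adjoint_gate B ** (adjoint_gate A ** pauli p ** A) ** B"
    by (simp add: adjoint_gate_mult matrix_mul_assoc)
  also have "\<dots> = c *k (c' *k pauli q')" by (simp add: q q' scale_gate_mult)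
  also have "\<dots> = (c * c') *k pauli q'" by (simp add: scale_gate_def vec_eq_iff)
  finally show ?case using q(1) q'(1) by (metis mult_1 norm_mult)
qed

lemma local_operator_outside: "\<not> x \<subseteq> V \<Longrightarrow> local_operator V U \<psi> x = 0"
  by (simp add: local_operator_def)

lemma sum_norm_local_operator:
  assumes V: "finite V" and U: "\<And>u. u \<in> V \<Longrightarrow> unitary_gate (U u)"
  shows "(\<Sum>x\<in>Pow V. cnj (local_operator V U \<psi> x) * local_operator V U \<psi> x)
    = (\<Sum>x\<in>Pow V. cnj (\<psi> x) * \<psi> x)"
proof -
  define \<phi> where "\<phi> x = (if x \<subseteq> V then \<psi> x else 0)" for x
  have "local_operator V U \<psi> = local_operator V U \<phi>"
    by (rule local_operator_cong) (auto simp: \<phi>_def)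
  then have "(\<Sum>x\<in>Pow V. cnj (local_operator V U \<psi> x) * local_operator V U \<psi> x)
    = (\<Sum>x\<in>Pow V. cnj (\<phi> x) * local_operator V (\<lambda>u. adjoint_gate (U u) ** U u) \<phi> x)"
    by (simp add: local_operator_adjoint[OF V] local_operator_mult[OF V])
  also have "local_operator V (\<lambda>u. adjoint_gate (U u) ** U u) \<phi> = local_operator V (\<lambda>_. mat 1) \<phi>"
    using U by (intro local_operator_cong) (auto simp: unitary_gate_def)
  also have "\<dots> = \<phi>" by (rule local_operator_mat_1[OF V]) (simp add: \<phi>_def)
  finally show ?thesis by (simp add: \<phi>_def)
qed

lemma clifford_state_local_operator:
  assumes V: "finite V" and C: "\<And>v. v \<in> V \<Longrightarrow> C v \<in> generated_gates 1" and \<psi>: "clifford_state V \<psi>"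
  shows "clifford_state V (local_operator V C \<psi>)"
  unfolding clifford_state_def
proof (intro conjI allI impI)
  show "(\<Sum>x\<in>Pow V. cnj (local_operator V C \<psi> x) * local_operator V C \<psi> x) = 1"
    using \<psi> C generated_gates_unitary by (subst sum_norm_local_operator[OF V]) (auto simp: clifford_state_def)
next
  fix A B assume "A \<subseteq> V" "B \<subseteq> V"
  have "\<forall>v\<in>V. \<exists>q c. norm c = 1 \<and>
      adjoint_gate (C v) ** pauli (v \<in> A, v \<in> B) ** C v = c *k pauli q"
    using C clifford_conj_pauli by blast
  then obtain q c where qc: "\<And>v. v \<in> V \<Longrightarrow> norm (c v) = 1"
    "\<And>v. v \<in> V \<Longrightarrow> adjoint_gate (C v) ** pauli (v \<in> A, v \<in> B) ** C v = c v *k pauli (q v)"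
    by metis
  define A' B' where "A' = {v \<in> V. fst (q v)}" and "B' = {v \<in> V. snd (q v)}"
  have "expval V (local_operator V C \<psi>) (\<lambda>v. pauli (v \<in> A, v \<in> B))
      = expval V \<psi> (\<lambda>v. c v *k pauli (v \<in> A', v \<in> B'))"
    unfolding expval_local_operator[OF V] using qc(2)
    by (intro expval_cong) (simp add: A'_def B'_def)
  also have "\<dots> = prod c V * expval V \<psi> (\<lambda>v. pauli (v \<in> A', v \<in> B'))"
    by (rule expval_scale[OF V])
  finally have "norm (expval V (local_operator V C \<psi>) (\<lambda>v. pauli (v \<in> A, v \<in> B)))
      = norm (expval V \<psi> (\<lambda>v. pauli (v \<in> A', v \<in> B')))"
    using qc(1) by (simp add: norm_mult prod_norm[symmetric])
  moreover have "A' \<subseteq> V" "B' \<subseteq> V" by (auto simp: A'_def B'_def)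
  ultimately show "norm (expval V (local_operator V C \<psi>) (\<lambda>v. pauli (v \<in> A, v \<in> B))) \<in> {0, 1}"
    using \<psi> by (simp add: clifford_state_def)
qed

lemma (in pair_graph) clifford_graph_state: "clifford_state (pverts G) (graph_state G)"
  unfolding clifford_state_def
proof (intro conjI allI impI)
  let ?V = "pverts G"
  have "cnj (graph_state G x) * graph_state G x = 1 / 2 ^ card ?V" if "x \<in> Pow ?V" for x
  proof -
    have "complex_of_real (1 / sqrt (2 ^ card ?V)) * complex_of_real (1 / sqrt (2 ^ card ?V)) = 1 / 2 ^ card ?V"
      by (simp flip: of_real_mult)
    then show ?thesis
      using that by (simp add: graph_state_edge_sign mult_ac)
  qed
  then show "(\<Sum>x\<in>Pow ?V. cnj (graph_state G x) * graph_state G x) = 1"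
    using pair_finite_verts by (simp add: card_Pow)
qed (use norm_expval_graph_state in simp)

text \<open>A nonzero expectation has norm 1, which is equality in the Cauchy-Schwarz inequality, so
  the state is an eigenvector of the Pauli product.\<close>

lemma clifford_state_eigen:
  assumes V: "finite V" and \<psi>: "clifford_state V \<psi>" and AB: "A \<subseteq> V" "B \<subseteq> V"
    and nz: "expval V \<psi> (\<lambda>v. pauli (v \<in> A, v \<in> B)) \<noteq> 0"
  shows "\<exists>c. norm c = 1 \<and> (\<forall>x. x \<subseteq> V \<longrightarrow> \<psi> (x \<triangle> A) = c * parity_sign (x \<inter> B) * \<psi> x)"
proof -
  let ?P = "\<lambda>v. pauli (v \<in> A, v \<in> B)"
  define \<phi> where "\<phi> = local_operator V ?P \<psi>"
  define e where "e = expval V \<psi> ?P"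
  have "norm e \<in> {0, 1}" using \<psi> AB unfolding clifford_state_def e_def by blast
  then have norm_e: "norm e = 1" using nz by (simp add: e_def)
  have "e * cnj e = complex_of_real ((norm e)\<^sup>2)" by (rule complex_norm_square[symmetric])
  then have ee: "e * cnj e = 1" by (simp add: norm_e)
  have 1: "(\<Sum>x\<in>Pow V. cnj (\<psi> x) * \<psi> x) = 1" using \<psi> by (simp add: clifford_state_def)
  have 2: "(\<Sum>x\<in>Pow V. cnj (\<phi> x) * \<phi> x) = 1"
    unfolding \<phi>_def using 1 by (subst sum_norm_local_operator[OF V]) (auto simp: unitary_pauli)
  have 3: "(\<Sum>x\<in>Pow V. cnj (\<psi> x) * \<phi> x) = e" by (simp add: e_def \<phi>_def expval_def)
  have "cnj (\<Sum>x\<in>Pow V. cnj (\<psi> x) * \<phi> x) = cnj e" using 3 by simp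
  then have 4: "(\<Sum>x\<in>Pow V. cnj (\<phi> x) * \<psi> x) = cnj e" by (simp add: mult.commute)
  have "(\<Sum>x\<in>Pow V. cnj (\<phi> x - e * \<psi> x) * (\<phi> x - e * \<psi> x))
    = (\<Sum>x\<in>Pow V. cnj (\<phi> x) * \<phi> x) - e * (\<Sum>x\<in>Pow V. cnj (\<phi> x) * \<psi> x)
      - cnj e * (\<Sum>x\<in>Pow V. cnj (\<psi> x) * \<phi> x) + e * cnj e * (\<Sum>x\<in>Pow V. cnj (\<psi> x) * \<psi> x)"
    unfolding sum_distrib_left sum_subtractf[symmetric] sum.distrib[symmetric]
    by (rule sum.cong) (auto simp: algebra_simps)
  also have "\<dots> = 0" unfolding 1 2 3 4 using ee by (simp add: mult.commute)
  finally have "complex_of_real (\<Sum>x\<in>Pow V. (norm (\<phi> x - e * \<psi> x))\<^sup>2) = 0"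
    by (simp only: of_real_sum complex_norm_square mult.commute[of "_ - _"])
  then have "(\<Sum>x\<in>Pow V. (norm (\<phi> x - e * \<psi> x))\<^sup>2) = 0" by (simp only: of_real_eq_0_iff)
  then have \<phi>: "\<phi> x = e * \<psi> x" if "x \<subseteq> V" for x
    using that V by (subst (asm) sum_nonneg_eq_0_iff) auto
  define k :: complex where "k = (- \<i>) ^ card (A \<inter> B)"
  have k: "norm k = 1" "k \<noteq> 0" by (simp_all add: k_def norm_power)
  have "\<psi> (x \<triangle> A) = e / k * parity_sign (x \<inter> B) * \<psi> x" if x: "x \<subseteq> V" for x
  proof -
    have "k * (parity_sign (x \<inter> B) * \<psi> (x \<triangle> A)) = e * \<psi> x"
      using \<phi>[OF x] local_operator_pauli[OF V x AB, of \<psi>] by (simp add: \<phi>_def k_def mult.assoc)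
    then have "parity_sign (x \<inter> B) * \<psi> (x \<triangle> A) = e / k * \<psi> x" using k(2) by (simp add: field_simps)
    then have "parity_sign (x \<inter> B) * (parity_sign (x \<inter> B) * \<psi> (x \<triangle> A)) = parity_sign (x \<inter> B) * (e / k * \<psi> x)"
      by simp
    then show ?thesis by (simp add: mult_ac)
  qed
  moreover have "norm (e / k) = 1" using norm_e k by (simp add: norm_divide)
  ultimately show ?thesis by blast
qed

text \<open>Some \<open>B\<close> must give a nonzero expectation together with the shift by
  \<open>x \<triangle> y\<close>: otherwise Fourier inversion would make the product of
  \<open>cnj (\<psi> z)\<close> and the shifted amplitude vanish for all \<open>z\<close>, but at
  \<open>z = y\<close> it does not.\<close>

lemma clifford_state_shift:
  assumes V: "finite V" and \<psi>: "clifford_state V \<psi>" and xy: "x \<subseteq> V" "y \<subseteq> V" "\<psi> x \<noteq> 0" "\<psi> y \<noteq> 0"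
  shows "\<exists>B c. B \<subseteq> V \<and> norm c = 1 \<and> (\<forall>z. z \<subseteq> V \<longrightarrow> \<psi> (z \<triangle> (x \<triangle> y)) = c * parity_sign (z \<inter> B) * \<psi> z)"
proof -
  let ?D = "x \<triangle> y"
  have D: "?D \<subseteq> V" using xy by (intro symdiff_subset)
  have "\<exists>B\<subseteq>V. expval V \<psi> (\<lambda>v. pauli (v \<in> ?D, v \<in> B)) \<noteq> 0"
  proof (rule ccontr)
    assume *: "\<not> ?thesis"
    define g where "g z = cnj (\<psi> z) * \<psi> (z \<triangle> ?D)" for z
    have "(\<Sum>z\<in>Pow V. g z * parity_sign (z \<inter> B)) = 0" if B: "B \<subseteq> V" for B
    proof -
      have "expval V \<psi> (\<lambda>v. pauli (v \<in> ?D, v \<in> B))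
          = (\<Sum>z\<in>Pow V. (- \<i>) ^ card (?D \<inter> B) * (g z * parity_sign (z \<inter> B)))"
        unfolding expval_def using local_operator_pauli[OF V _ D B]
        by (intro sum.cong) (auto simp: g_def mult_ac)
      with * B show ?thesis by (auto simp flip: sum_distrib_left)
    qed
    then have "g y = 0" using fourier_zero[OF V _ xy(2), of g] by blast
    moreover have "y \<triangle> ?D = x" by (simp add: symdiff_commute[of x])
    ultimately show False using xy by (simp add: g_def)
  qed
  then obtain B where B: "B \<subseteq> V" "expval V \<psi> (\<lambda>v. pauli (v \<in> ?D, v \<in> B)) \<noteq> 0" by blast
  from clifford_state_eigen[OF V \<psi> D B] B(1) show ?thesis by blast
qed

lemma clifford_state_nonzero:
  assumes "clifford_state V \<psi>"
  shows "\<exists>x\<subseteq>V. \<psi> x \<noteq> 0"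
proof (rule ccontr)
  assume "\<not> ?thesis"
  then have "(\<Sum>x\<in>Pow V. cnj (\<psi> x) * \<psi> x) = 0" by (intro sum.neutral) auto
  with assms show False by (simp add: clifford_state_def)
qed

text \<open>Shifts relate any two nonzero amplitudes by a factor of norm 1, so the total norm 1 is
  spread evenly over the support.\<close>

lemma clifford_state_norm:
  assumes V: "finite V" and \<psi>: "clifford_state V \<psi>" and x: "x \<subseteq> V" "\<psi> x \<noteq> 0"
  shows "(norm (\<psi> x))\<^sup>2 * card {y. y \<subseteq> V \<and> \<psi> y \<noteq> 0} = 1"
proof -
  have fin: "finite (Pow V)" using V by simp
  have same: "norm (\<psi> y) = norm (\<psi> x)" if y: "y \<subseteq> V" "\<psi> y \<noteq> 0" for y
  proof -
    obtain B c where "norm c = 1" "\<psi> (x \<triangle> (y \<triangle> x)) = c * parity_sign (x \<inter> B) * \<psi> x"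
      using clifford_state_shift[OF V \<psi> y(1) x(1) y(2) x(2)] x by blast
    moreover have "x \<triangle> (y \<triangle> x) = y" by (simp add: symdiff_commute[of y])
    ultimately show ?thesis by (simp add: norm_mult)
  qed
  have "complex_of_real (\<Sum>y\<in>Pow V. (norm (\<psi> y))\<^sup>2) = 1"
    using \<psi> by (simp only: clifford_state_def of_real_sum complex_norm_square mult.commute[of "\<psi> _"])
  then have "1 = (\<Sum>y\<in>Pow V. (norm (\<psi> y))\<^sup>2)" by (simp only: of_real_eq_1_iff)
  also have "\<dots> = (\<Sum>y\<in>{y. y \<subseteq> V \<and> \<psi> y \<noteq> 0}. (norm (\<psi> y))\<^sup>2)"
    using fin by (intro sum.mono_neutral_right) auto
  also have "\<dots> = (\<Sum>y\<in>{y. y \<subseteq> V \<and> \<psi> y \<noteq> 0}. (norm (\<psi> x))\<^sup>2)"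
    using same by (intro sum.cong) auto
  finally show ?thesis by (simp add: mult.commute)
qed

section \<open>Diagonal gates between two stabilizer states\<close>

lemma cis_eq_1D: "cis (2 * pi * t) = 1 \<Longrightarrow> t \<in> \<int>"
proof -
  assume "cis (2 * pi * t) = 1"
  then have "cos (2 * pi * t) = 1" by (simp add: complex_eq_iff)
  then obtain n :: int where "2 * pi * t = of_int n * 2 * pi" by (auto simp: cos_one_2pi_int)
  then have "t = of_int n" by simp
  then show "t \<in> \<int>" by simp
qed

text \<open>A shift by a direction \<open>D\<close> of the common support multiplies each state by a
  constant and a sign character. Dividing the two shift relations shows that the second difference
  of the phases is a character in one argument, so the third difference is trivial. This is the
  integrality needed to bound denominators.\<close>

lemma diagonal_equivalence:
  fixes \<theta> :: "'a \<Rightarrow> real"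
  assumes V: "finite V" "card V < 2 ^ (r + 3)" "1 \<le> r"
    and \<psi>1: "clifford_state V \<psi>1" and \<psi>2: "clifford_state V \<psi>2" and k: "k \<noteq> 0"
    and eq: "\<And>x. x \<subseteq> V \<Longrightarrow> \<psi>2 x = k * cis (sum \<theta> x) * \<psi>1 x"
  shows "\<exists>(S :: 'a \<Rightarrow> int) k'. \<forall>x\<subseteq>V. \<psi>2 x = k' * cis (\<Sum>u\<in>x. of_int (S u) * (pi / 2 ^ r)) * \<psi>1 x"
proof -
  obtain x0 where x0: "x0 \<subseteq> V" "\<psi>1 x0 \<noteq> 0" using clifford_state_nonzero[OF \<psi>1] by blast
  \<comment> \<open>The direction space of the support, seen from the base point
    \<open>x0\<close>.\<close>
  define L where "L = {w. w \<subseteq> V \<and> \<psi>1 (x0 \<triangle> w) \<noteq> 0}"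
  have fin: "finite w" if "w \<subseteq> V" for w using that V(1) by (rule finite_subset)
  have LV: "w \<subseteq> V" "finite w" "x0 \<triangle> w \<subseteq> V" if "w \<in> L" for w
    using that fin x0 by (auto simp: L_def)
  have supp2: "\<psi>2 x \<noteq> 0 \<longleftrightarrow> \<psi>1 x \<noteq> 0" if "x \<subseteq> V" for x using eq[OF that] k by simp
  have shift: "\<exists>B c. B \<subseteq> V \<and> c \<noteq> 0 \<and> (\<forall>z. z \<subseteq> V \<longrightarrow> \<psi> (z \<triangle> D) = c * parity_sign (z \<inter> B) * \<psi> z)"
    if D: "D \<in> L" and \<psi>: "clifford_state V \<psi>" "\<And>x. x \<subseteq> V \<Longrightarrow> \<psi> x \<noteq> 0 \<longleftrightarrow> \<psi>1 x \<noteq> 0" for D \<psi>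
  proof -
    have "x0 \<triangle> D \<subseteq> V" "\<psi> (x0 \<triangle> D) \<noteq> 0" "\<psi> x0 \<noteq> 0" using D \<psi>(2) x0 LV[OF D] by (auto simp: L_def)
    from clifford_state_shift[OF V(1) \<psi>(1) x0(1) this(1) this(3) this(2)]
    obtain B c where "B \<subseteq> V" "norm c = 1"
      "\<forall>z. z \<subseteq> V \<longrightarrow> \<psi> (z \<triangle> (x0 \<triangle> (x0 \<triangle> D))) = c * parity_sign (z \<inter> B) * \<psi> z" by blast
    then show ?thesis by (intro exI[of _ B] exI[of _ c]) auto
  qed
  have closed: "w \<triangle> w' \<in> L" if w: "w \<in> L" "w' \<in> L" for w w'
  proof -
    obtain B c where "c \<noteq> 0" "\<psi>1 ((x0 \<triangle> w) \<triangle> w') = c * parity_sign ((x0 \<triangle> w) \<inter> B) * \<psi>1 (x0 \<triangle> w)"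
      using shift[OF w(2) \<psi>1] LV(3)[OF w(1)] by blast
    moreover have "\<psi>1 (x0 \<triangle> w) \<noteq> 0" using w(1) by (simp add: L_def)
    ultimately have "\<psi>1 (x0 \<triangle> (w \<triangle> w')) \<noteq> 0" by (simp add: symdiff_assoc)
    then show ?thesis
      using symdiff_subset[OF LV(1)[OF w(1)] LV(1)[OF w(2)]] by (simp add: L_def)
  qed
  \<comment> \<open>Moving the base point to the empty set changes the sign of the angles at
    vertices of \<open>x0\<close>.\<close>
  define \<epsilon> where "\<epsilon> u = (if u \<in> x0 then - 1 else 1 :: real)" for u
  have sum_shift: "sum f (x0 \<triangle> w) = sum f x0 + (\<Sum>u\<in>w. \<epsilon> u * f u)" if "finite w" for f :: "'a \<Rightarrow> real" and w
  proof -
    have "(\<Sum>u\<in>w. \<epsilon> u * f u) = (\<Sum>u\<in>w. f u - 2 * (if u \<in> x0 then f u else 0))"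
      by (intro sum.cong) (auto simp: \<epsilon>_def)
    also have "\<dots> = sum f w - 2 * sum f (w \<inter> x0)"
      using that by (simp add: sum_subtractf sum.inter_restrict flip: sum_distrib_left)
    finally show ?thesis
      using sum_symdiff[of x0 w f] that fin[OF x0(1)] by (simp add: Int_commute)
  qed
  define a where "a u = \<epsilon> u * \<theta> u / (2 * pi)" for u
  define g where "g w = cis (2 * pi * sum a w)" for w
  have g_nz: "g w \<noteq> 0" for w by (simp add: g_def)
  have "2 * pi * sum a w = (\<Sum>u\<in>w. \<epsilon> u * \<theta> u)" for w
    by (simp add: a_def sum_distrib_left)
  then have ratio: "\<psi>2 (x0 \<triangle> w) = k * cis (sum \<theta> x0) * g w * \<psi>1 (x0 \<triangle> w)" if "w \<in> L" for w
    using eq[OF LV(3)[OF that]] sum_shift[OF LV(2)[OF that], of \<theta>] by (simp add: g_def cis_mult[symmetric] mult_ac)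
  have g_symdiff: "g (w \<triangle> D) * cis (4 * pi * sum a (w \<inter> D)) = g w * g D" if "finite w" "finite D" for w D
  proof -
    have "2 * pi * sum a (w \<triangle> D) + 4 * pi * sum a (w \<inter> D) = 2 * pi * sum a w + 2 * pi * sum a D"
      unfolding sum_symdiff[OF that] by (simp add: algebra_simps)
    then show ?thesis by (simp add: g_def cis_mult)
  qed
  have bilinear: "\<exists>s. (\<forall>w\<in>L. cis (4 * pi * sum a (w \<inter> D)) = s w) \<and> (\<forall>w\<in>L. \<forall>w'\<in>L. s (w \<triangle> w') = s w * s w')"
    if D: "D \<in> L" for D
  proof -
    obtain B1 c1 where 1: "B1 \<subseteq> V" "c1 \<noteq> 0"
      "\<And>z. z \<subseteq> V \<Longrightarrow> \<psi>1 (z \<triangle> D) = c1 * parity_sign (z \<inter> B1) * \<psi>1 z"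
      using shift[OF D \<psi>1] by blast
    obtain B2 c2 where 2: "B2 \<subseteq> V" "c2 \<noteq> 0"
      "\<And>z. z \<subseteq> V \<Longrightarrow> \<psi>2 (z \<triangle> D) = c2 * parity_sign (z \<inter> B2) * \<psi>2 z"
      using shift[OF D \<psi>2 supp2] by blast
    define s where "s w = parity_sign (w \<inter> B1) * parity_sign (w \<inter> B2)" for w
    have s: "s (w \<triangle> w') = s w * s w'" if "finite w" "finite w'" for w w'
      using that by (simp add: s_def parity_sign_symdiff_Int)
    have ss: "s w * s w = 1" for w by (simp add: s_def mult_ac flip: mult.assoc)
    \<comment> \<open>The shift relations of both states at \<open>x0 \<triangle> w\<close> are
      compared through the phase ratio. The case \<open>w = {}\<close> below eliminates the unknown
      constants \<open>c1\<close> and \<open>c2\<close>.\<close>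
    have *: "c1 * g (w \<triangle> D) = c2 * s (x0 \<triangle> w) * g w" if w: "w \<in> L" for w
    proof -
      let ?z = "x0 \<triangle> w"
      have "k * cis (sum \<theta> x0) * g (w \<triangle> D) * (c1 * parity_sign (?z \<inter> B1) * \<psi>1 ?z)
          = c2 * parity_sign (?z \<inter> B2) * (k * cis (sum \<theta> x0) * g w * \<psi>1 ?z)"
        using ratio[OF closed[OF w D]] ratio[OF w] 1(3)[OF LV(3)[OF w]] 2(3)[OF LV(3)[OF w]]
        by (simp add: symdiff_assoc)
      moreover have "\<psi>1 ?z \<noteq> 0" using w by (simp add: L_def)
      ultimately have "c1 * g (w \<triangle> D) * parity_sign (?z \<inter> B1) = c2 * parity_sign (?z \<inter> B2) * g w"
        using k by (simp add: mult_ac)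
      from arg_cong[OF this, of "\<lambda>t. parity_sign (?z \<inter> B1) * t"]
      show ?thesis by (simp add: s_def mult_ac)
    qed
    have "{} \<in> L" using x0 by (simp add: L_def)
    from *[OF this] have gD: "c1 * g D = c2 * s x0" by (simp add: g_def)
    have "cis (4 * pi * sum a (w \<inter> D)) = s w" if w: "w \<in> L" for w
    proof -
      have "c1 * g (w \<triangle> D) = s w * g w * (c2 * s x0)"
        using *[OF w] s[OF fin[OF x0(1)] LV(2)[OF w]] by (simp add: mult_ac)
      then have "c1 * g (w \<triangle> D) = s w * g w * (c1 * g D)" by (simp only: gD)
      then have "g (w \<triangle> D) = s w * (g w * g D)" using 1(2) by (simp add: mult_ac)
      then have "g (w \<triangle> D) = s w * (g (w \<triangle> D) * cis (4 * pi * sum a (w \<inter> D)))"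
        using g_symdiff[OF LV(2)[OF w] LV(2)[OF D]] by simp
      then have "1 = s w * cis (4 * pi * sum a (w \<inter> D))" using g_nz[of "w \<triangle> D"] by (simp add: mult_ac)
      then have "s w * 1 = (s w * s w) * cis (4 * pi * sum a (w \<inter> D))" by (simp add: mult.assoc)
      then show ?thesis by (simp add: ss)
    qed
    moreover have "s (w \<triangle> w') = s w * s w'" if "w \<in> L" "w' \<in> L" for w w'
      using that LV(2) by (intro s)
    ultimately show ?thesis by (intro exI[of _ s] conjI ballI)
  qed
  have int: "4 * sum a (w1 \<inter> w2 \<inter> w3) \<in> \<int>" if w: "w1 \<in> L" "w2 \<in> L" "w3 \<in> L" for w1 w2 w3
  proof (rule cis_eq_1D)
    let ?f = "\<lambda>w. cis (4 * pi * sum a (w \<inter> w3))"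
    obtain s where s: "\<And>w. w \<in> L \<Longrightarrow> ?f w = s w" "\<And>w w'. w \<in> L \<Longrightarrow> w' \<in> L \<Longrightarrow> s (w \<triangle> w') = s w * s w'"
      using bilinear[OF w(3)] by blast
    have "4 * pi * sum a ((w1 \<triangle> w2) \<inter> w3) + 2 * pi * (4 * sum a (w1 \<inter> w2 \<inter> w3))
        = 4 * pi * sum a (w1 \<inter> w3) + 4 * pi * sum a (w2 \<inter> w3)"
      unfolding sum_symdiff_Int[OF LV(2)[OF w(1)] LV(2)[OF w(2)]] by (simp add: algebra_simps)
    then have "?f (w1 \<triangle> w2) * cis (2 * pi * (4 * sum a (w1 \<inter> w2 \<inter> w3))) = ?f w1 * ?f w2"
      by (simp only: cis_mult)
    then have "?f w1 * ?f w2 * cis (2 * pi * (4 * sum a (w1 \<inter> w2 \<inter> w3))) = ?f w1 * ?f w2 * 1"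
      using s w closed[OF w(1,2)] by simp
    moreover have "?f w1 * ?f w2 \<noteq> 0" by simp
    ultimately show "cis (2 * pi * (4 * sum a (w1 \<inter> w2 \<inter> w3))) = 1" by (simp only: mult_cancel_left) blast
  qed
  have "L \<subseteq> Pow V" using LV by blast
  from bounded_denominator[OF V(1) this V(2,3) closed int]
  obtain S :: "'a \<Rightarrow> int" where S: "\<And>w. w \<in> L \<Longrightarrow> sum a w - (\<Sum>u\<in>w. of_int (S u) / 2 ^ (r + 1)) \<in> \<int>"
    by blast
  \<comment> \<open>Undoes the signs of \<epsilon>, which squares to 1.\<close>
  define T where "T u = (if u \<in> x0 then - S u else S u)" for u
  let ?\<theta>' = "\<lambda>u. of_int (T u) * (pi / 2 ^ r)"
  have g_S: "g w = cis (\<Sum>u\<in>w. \<epsilon> u * ?\<theta>' u)" if w: "w \<in> L" for w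
  proof -
    have e: "(\<Sum>u\<in>w. \<epsilon> u * ?\<theta>' u) = 2 * pi * (\<Sum>u\<in>w. of_int (S u) / 2 ^ (r + 1))"
      unfolding sum_distrib_left by (rule sum.cong) (auto simp: \<epsilon>_def T_def)
    obtain n where "sum a w - (\<Sum>u\<in>w. of_int (S u) / 2 ^ (r + 1)) = of_int n"
      using S[OF w] by (auto elim: Ints_cases)
    then have n: "sum a w = (\<Sum>u\<in>w. of_int (S u) / 2 ^ (r + 1)) + of_int n" by linarith
    have "2 * pi * sum a w = (\<Sum>u\<in>w. \<epsilon> u * ?\<theta>' u) + 2 * pi * of_int n"
      unfolding e n by (rule distrib_left)
    then have "g w = cis (\<Sum>u\<in>w. \<epsilon> u * ?\<theta>' u) * cis (2 * pi * of_int n)"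
      by (simp only: g_def cis_mult)
    then show ?thesis by (simp add: cis_multiple_2pi)
  qed
  define k' where "k' = k * cis (sum \<theta> x0) / cis (sum ?\<theta>' x0)"
  have "\<psi>2 x = k' * cis (sum ?\<theta>' x) * \<psi>1 x" if x: "x \<subseteq> V" for x
  proof (cases "\<psi>1 x = 0")
    case True
    then show ?thesis using supp2[OF x] by simp
  next
    case False
    define w where "w = x0 \<triangle> x"
    have xw: "x = x0 \<triangle> w" by (simp add: w_def)
    have w: "w \<in> L" using x x0 False by (auto simp: L_def xw[symmetric] w_def)
    have "cis (sum ?\<theta>' x) = cis (sum ?\<theta>' x0) * g w"
      unfolding xw sum_shift[OF LV(2)[OF w]] g_S[OF w] by (simp add: cis_mult)
    then show ?thesis using ratio[OF w] by (simp add: xw k'_def)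
  qed
  then show ?thesis by blast
qed

section \<open>Global phases\<close>

definition gaussian_ints :: "complex set" where
  "gaussian_ints = {z. Re z \<in> \<int> \<and> Im z \<in> \<int>}"

lemma gaussian_ints_add: "x \<in> gaussian_ints \<Longrightarrow> y \<in> gaussian_ints \<Longrightarrow> x + y \<in> gaussian_ints"
  and gaussian_ints_mult: "x \<in> gaussian_ints \<Longrightarrow> y \<in> gaussian_ints \<Longrightarrow> x * y \<in> gaussian_ints"
  and gaussian_ints_0: "0 \<in> gaussian_ints" and gaussian_ints_1: "1 \<in> gaussian_ints"
  by (auto simp: gaussian_ints_def)

lemma gaussian_ints_sum: "(\<And>x. x \<in> A \<Longrightarrow> f x \<in> gaussian_ints) \<Longrightarrow> sum f A \<in> gaussian_ints"
  by (induction A rule: infinite_finite_induct) (auto intro: gaussian_ints_add gaussian_ints_0)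

lemma gaussian_ints_prod: "(\<And>x. x \<in> A \<Longrightarrow> f x \<in> gaussian_ints) \<Longrightarrow> prod f A \<in> gaussian_ints"
  by (induction A rule: infinite_finite_induct) (auto intro: gaussian_ints_mult gaussian_ints_1)

text \<open>
  A Gaussian integer whose norm is a power of 2 is a unit times a power of \<open>1 + \<i>\<close>.
\<close>
lemma int_sum_squares_power2_phase:
  fixes a b :: int
  assumes "a\<^sup>2 + b\<^sup>2 = 2 ^ k"
  shows "(Complex a b) ^ 8 = 16 ^ k"
  using assms
proof (induction k arbitrary: a b)
  case 0
  then have "a\<^sup>2 + b\<^sup>2 = 1" by simp
  moreover have "0 \<le> a\<^sup>2" "0 \<le> b\<^sup>2" by simp_all
  ultimately have "(a\<^sup>2 = 0 \<and> b\<^sup>2 = 1) \<or> (a\<^sup>2 = 1 \<and> b\<^sup>2 = 0)" by linarith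
  then have "(a = 0 \<and> (b = 1 \<or> b = - 1)) \<or> ((a = 1 \<or> a = - 1) \<and> b = 0)"
    by (simp add: power2_eq_1_iff)
  moreover have "Complex 0 1 = \<i>" "Complex 0 (- 1) = - \<i>" "Complex 1 0 = 1" "Complex (- 1) 0 = - 1"
    by (simp_all add: complex_eq_iff)
  moreover have "\<i> ^ 8 = 1" by (simp add: power_numeral_even)
  ultimately show ?case by auto
next
  case (Suc k)
  have "even (a\<^sup>2 + b\<^sup>2)" using Suc.prems by simp
  then have par: "even (a + b)" "even (b - a)" by auto
  define c d where "c = (a + b) div 2" and "d = (b - a) div 2"
  have cd: "a = c - d" "b = c + d" unfolding c_def d_def using par by presburger+
  have "2 * (c\<^sup>2 + d\<^sup>2) = 2 * 2 ^ k"
    using Suc.prems unfolding cd by (simp add: power2_eq_square algebra_simps)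
  then have "c\<^sup>2 + d\<^sup>2 = 2 ^ k" by simp
  then have IH: "(Complex c d) ^ 8 = 16 ^ k" by (rule Suc.IH)
  have "Complex a b = Complex 1 1 * Complex c d" by (simp add: cd complex_eq_iff)
  moreover have "(Complex 1 1) ^ 8 = 16"
  proof -
    have "Complex 1 1 * Complex 1 1 = 2 * \<i>" by (simp add: complex_eq_iff)
    then show ?thesis by (simp add: power_numeral_even Let_def)
  qed
  ultimately show ?case by (simp only: power_mult_distrib IH) simp
qed

lemma generated_gates_gaussian:
  assumes "C \<in> generated_gates 1"
  shows "\<exists>e. \<forall>i j. C $ i $ j * complex_of_real (sqrt 2) ^ e \<in> gaussian_ints"
  using assms
proof (induction rule: generated_gates.induct)
  case one
  show ?case by (intro exI[of _ 0]) (auto simp: mat_def gaussian_ints_def)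
next
  case H
  show ?case by (intro exI[of _ 1]) (auto simp: hadamard_gate_def gaussian_ints_def)
next
  case Z
  show ?case by (intro exI[of _ 0]) (auto simp: Z_gate_def gaussian_ints_def)
next
  case (mult A B)
  obtain e where e: "\<And>i j. A $ i $ j * complex_of_real (sqrt 2) ^ e \<in> gaussian_ints"
    using mult.IH(1) by blast
  obtain e' where e': "\<And>i j. B $ i $ j * complex_of_real (sqrt 2) ^ e' \<in> gaussian_ints"
    using mult.IH(2) by blast
  have "(A ** B) $ i $ j * complex_of_real (sqrt 2) ^ (e + e') \<in> gaussian_ints" for i j
  proof -
    have "(A ** B) $ i $ j * complex_of_real (sqrt 2) ^ (e + e')
      = (\<Sum>l\<in>UNIV. (A $ i $ l * complex_of_real (sqrt 2) ^ e) * (B $ l $ j * complex_of_real (sqrt 2) ^ e'))"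
      by (simp add: matrix_matrix_mult_def sum_distrib_left sum_distrib_right power_add mult_ac)
    also have "\<dots> \<in> gaussian_ints" by (intro gaussian_ints_sum gaussian_ints_mult e e')
    finally show ?thesis .
  qed
  then show ?case by blast
qed

lemma (in pair_graph) gaussian_amplitude:
  assumes C: "\<And>v. v \<in> pverts G \<Longrightarrow> C v \<in> generated_gates 1" and x: "x \<subseteq> pverts G"
  shows "\<exists>N. local_operator (pverts G) C (graph_state G) x * complex_of_real (sqrt 2) ^ N \<in> gaussian_ints"
proof -
  let ?V = "pverts G" and ?s = "complex_of_real (sqrt 2)"
  have "\<forall>v\<in>?V. \<exists>e. \<forall>i j. C v $ i $ j * ?s ^ e \<in> gaussian_ints"
    using C generated_gates_gaussian by blast
  then obtain e where e: "\<And>v i j. v \<in> ?V \<Longrightarrow> C v $ i $ j * ?s ^ e v \<in> gaussian_ints" by metis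
  have graph: "graph_state G y * ?s ^ card ?V \<in> gaussian_ints" for y
  proof -
    have "edge_sign G y \<in> gaussian_ints" by (simp add: edge_sign_def gaussian_ints_def minus_one_power_iff)
    moreover have "complex_of_real (1 / sqrt (2 ^ card ?V)) * ?s ^ card ?V = 1"
      by (simp add: real_sqrt_power flip: of_real_power)
    then have "graph_state G y * ?s ^ card ?V = (if y \<subseteq> ?V then edge_sign G y else 0)"
      by (simp add: graph_state_edge_sign mult_ac)
    ultimately show ?thesis by (simp add: gaussian_ints_0)
  qed
  have "local_operator ?V C (graph_state G) x * ?s ^ (sum e ?V + card ?V)
    = (\<Sum>y\<in>Pow ?V. (\<Prod>v\<in>?V. C v $ (v \<in> x) $ (v \<in> y) * ?s ^ e v) * (graph_state G y * ?s ^ card ?V))"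
    using x by (simp add: local_operator_def sum_distrib_left sum_distrib_right power_add prod.distrib power_sum mult_ac)
  also have "\<dots> \<in> gaussian_ints"
    by (intro gaussian_ints_sum gaussian_ints_mult gaussian_ints_prod graph e)
  finally show ?thesis by blast
qed

text \<open>The phase is a multiple of pi / 4. A power of sqrt 2 makes the amplitude a Gaussian
  integer; its squared norm times the support size is a power of 2, so the squared norm is one as
  well, and the eighth power of such a Gaussian integer is a positive real.\<close>

lemma (in pair_graph) amplitude_phase:
  assumes C: "\<And>v. v \<in> pverts G \<Longrightarrow> C v \<in> generated_gates 1" and x: "x \<subseteq> pverts G"
    and nz: "local_operator (pverts G) C (graph_state G) x \<noteq> 0"
  shows "(local_operator (pverts G) C (graph_state G) x) ^ 8
    = complex_of_real (norm (local_operator (pverts G) C (graph_state G) x) ^ 8)"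
proof -
  let ?V = "pverts G" and ?s = "complex_of_real (sqrt 2)"
  define \<psi> where "\<psi> = local_operator ?V C (graph_state G)"
  have cliff: "clifford_state ?V \<psi>"
    unfolding \<psi>_def using pair_finite_verts C clifford_graph_state by (rule clifford_state_local_operator)
  obtain N where N: "\<psi> x * ?s ^ N \<in> gaussian_ints"
    using gaussian_amplitude[of C x] C x unfolding \<psi>_def by blast
  then obtain a b :: int where ab: "\<psi> x * ?s ^ N = Complex a b"
    by (auto simp: gaussian_ints_def complex_eq_iff elim!: Ints_cases)
  define M where "M = card {y. y \<subseteq> ?V \<and> \<psi> y \<noteq> 0}"
  have M: "(norm (\<psi> x))\<^sup>2 * M = 1"
    using clifford_state_norm[OF pair_finite_verts cliff x] nz by (simp add: M_def \<psi>_def)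
  have n1: "(norm (\<psi> x * ?s ^ N))\<^sup>2 = (norm (\<psi> x))\<^sup>2 * 2 ^ N"
    by (simp add: norm_mult norm_power power_mult_distrib flip: power_mult) (simp add: power_mult mult.commute[of _ 2])
  have n2: "(norm (\<psi> x * ?s ^ N))\<^sup>2 = of_int (a\<^sup>2 + b\<^sup>2)"
    by (simp add: ab cmod_power2)
  have "of_int (a\<^sup>2 + b\<^sup>2) * real M = (norm (\<psi> x))\<^sup>2 * M * 2 ^ N"
    unfolding n2[symmetric] n1 by simp
  then have "of_int (a\<^sup>2 + b\<^sup>2) * real M = 2 ^ N" unfolding M by simp
  then have "of_int ((a\<^sup>2 + b\<^sup>2) * int M) = (of_int (2 ^ N) :: real)" by simp
  then have prod: "(a\<^sup>2 + b\<^sup>2) * int M = 2 ^ N" by (simp only: of_int_eq_iff)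
  have "nat (a\<^sup>2 + b\<^sup>2) * M = 2 ^ N"
    using arg_cong[OF prod, of nat] by (simp add: nat_mult_distrib nat_power_eq)
  then have "nat (a\<^sup>2 + b\<^sup>2) dvd 2 ^ N" by (metis dvd_triv_left)
  then obtain k where "nat (a\<^sup>2 + b\<^sup>2) = 2 ^ k"
    using divides_primepow_nat[of 2 "nat (a\<^sup>2 + b\<^sup>2)" N] two_is_prime_nat by auto
  then have "int (nat (a\<^sup>2 + b\<^sup>2)) = 2 ^ k" by simp
  then have k: "a\<^sup>2 + b\<^sup>2 = 2 ^ k" by simp
  have pos: "(\<psi> x * ?s ^ N) ^ 8 = complex_of_real (norm (\<psi> x * ?s ^ N) ^ 8)"
  proof -
    have "norm (\<psi> x * ?s ^ N) ^ 8 = ((norm (\<psi> x * ?s ^ N))\<^sup>2) ^ 4" by simp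
    also have "\<dots> = (2 ^ k) ^ 4"
      unfolding n2 k by simp
    also have "\<dots> = 16 ^ k" by (simp flip: power_mult add: mult.commute[of k]) (simp add: power_mult)
    finally show ?thesis using int_sum_squares_power2_phase[OF k] ab by simp
  qed
  have "?s ^ N \<noteq> 0" by simp
  then have "(\<psi> x) ^ 8 = complex_of_real (norm (\<psi> x) ^ 8)"
    using pos by (simp add: power_mult_distrib norm_mult norm_power)
  then show ?thesis by (simp add: \<psi>_def)
qed

section \<open>Scalars and Z-rotations inside the generated group\<close>

lemma mat_mult_gate: "mat c ** (A :: gate) = c *k A"
  by (auto simp: mat_def matrix_matrix_mult_def scale_gate_def vec_eq_iff UNIV_bool)

lemma mat_mult_mat: "mat c ** mat d = (mat (c * d) :: gate)"
  by (auto simp: mat_def matrix_matrix_mult_def vec_eq_iff UNIV_bool)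

lemma mat_power_in_generated_gates:
  assumes "mat c \<in> generated_gates r"
  shows "mat (c ^ n) \<in> generated_gates r"
proof (induction n)
  case (Suc n)
  have "mat (c ^ Suc n) = (mat c ** mat (c ^ n) :: gate)" by (simp add: mat_mult_mat)
  with Suc assms show ?case by (simp only: generated_gates.mult)
qed (simp add: generated_gates.one)

lemma mat_cis_in_generated_gates:
  assumes "1 \<le> r"
  shows "mat (cis (pi / 4)) \<in> generated_gates r" "mat (cis (of_int m * (pi / 2 ^ r))) \<in> generated_gates r"
proof -
  have 2: "complex_of_real (sqrt 2) * complex_of_real (sqrt 2) = 2"
    by (simp flip: of_real_mult)
  let ?A = "hadamard_gate ** Z_gate (pi / 2 ^ 1)"
  have A: "?A = (\<chi> i j. (if i \<and> j then - 1 else 1) * (if j then \<i> else 1) / complex_of_real (sqrt 2))"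
    by (auto simp: hadamard_gate_def Z_gate_def matrix_matrix_mult_def vec_eq_iff UNIV_bool)
  have cis: "cis (pi / 4) = (1 + \<i>) / complex_of_real (sqrt 2)"
    by (simp add: complex_eq_iff cos_45 sin_45 real_div_sqrt field_simps Re_divide_of_real Im_divide_of_real)
  have AA: "?A ** ?A = (\<chi> i j. (if i then if j then \<i> - 1 else 1 - \<i> else 1 + \<i>) / 2)"
    unfolding A using 2
    by (auto simp: matrix_matrix_mult_def vec_eq_iff UNIV_bool add_divide_distrib diff_divide_distrib)
  \<comment> \<open>The product of H and the phase gate \<open>Z_gate (pi / 2)\<close> has a scalar
    cube.\<close>
  have "mat (cis (pi / 4)) = ?A ** (?A ** ?A)"
    unfolding AA unfolding A cis by (auto simp: mat_def matrix_matrix_mult_def vec_eq_iff UNIV_bool field_simps)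
  also have "\<dots> \<in> generated_gates 1"
    by (intro generated_gates.intros)
  finally show "mat (cis (pi / 4)) \<in> generated_gates r"
    by (rule generated_gates_mono[OF assms])
  let ?X = "pauli (True, False)" and ?Z = "Z_gate (pi / 2 ^ r)"
  have X: "?X \<in> generated_gates r"
    by (rule generated_gates_mono[OF assms pauli_X_in_generated_gates])
  \<comment> \<open>Conjugation by X moves the phase to the other diagonal entry.\<close>
  have "mat (cis (pi / 2 ^ r)) = ?X ** ?Z ** ?X ** ?Z"
    by (auto simp: mat_def pauli_def Z_gate_def matrix_matrix_mult_def vec_eq_iff UNIV_bool)
  also have "\<dots> \<in> generated_gates r" by (intro generated_gates.mult X generated_gates.Z)
  finally have base: "mat (cis (pi / 2 ^ r)) \<in> generated_gates r" .
  have nat: "mat (cis (real n * (pi / 2 ^ r))) \<in> generated_gates r" for n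
    using mat_power_in_generated_gates[OF base, of n] by (simp add: Complex.DeMoivre)
  have "adjoint_gate (mat (cis t)) = mat (cis (- t))" for t
    by (auto simp: adjoint_gate_def mat_def vec_eq_iff cis_cnj)
  then have neg: "mat (cis (- (real n * (pi / 2 ^ r)))) \<in> generated_gates r" for n
    using adjoint_in_generated_gates[OF nat[of n]] by simp
  show "mat (cis (of_int m * (pi / 2 ^ r))) \<in> generated_gates r"
  proof (cases "0 \<le> m")
    case True
    then show ?thesis using nat[of "nat m"] by simp
  next
    case False
    then show ?thesis using neg[of "nat (- m)"] by simp
  qed
qed

lemma Z_gate_int_multiple_in_generated_gates: "Z_gate (of_int m * (pi / 2 ^ r)) \<in> generated_gates r"
proof (cases "0 \<le> m")
  case True
  then show ?thesis using Z_gate_multiple_in_generated_gates[of "nat m" r] by simp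
next
  case False
  have "adjoint_gate (Z_gate t) = Z_gate (- t)" for t
    by (auto simp: adjoint_gate_def Z_gate_def vec_eq_iff cis_cnj)
  with False show ?thesis
    using adjoint_in_generated_gates[OF Z_gate_multiple_in_generated_gates[of "nat (- m)" r]] by simp
qed

section \<open>From rigid local unitaries to gates of level r\<close>

theorem corollary29:
  fixes r :: nat and G\<^sub>1 G\<^sub>2 :: "'a :: linorder pair_pre_digraph"
  assumes "r \<ge> 1"
    and "pair_graph G\<^sub>1" and "pair_graph G\<^sub>2"
    and "pverts G\<^sub>1 = pverts G\<^sub>2"
    and "card (pverts G\<^sub>1) \<le> 2 ^ (r + 3) - 1"
    and "LU_equivalent G\<^sub>1 G\<^sub>2"
  shows "LC_equivalent r G\<^sub>1 G\<^sub>2"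
proof (cases "pverts G\<^sub>1 = {}")
  case True
  then show ?thesis using assms(4,6) by (auto simp: LU_equivalent_def LC_equivalent_def)
next
  case False
  interpret G1: pair_graph G\<^sub>1 by fact
  interpret G2: pair_graph G\<^sub>2 by fact
  let ?V = "pverts G\<^sub>1" and ?L = "local_operator (pverts G\<^sub>1)"
  have fin: "finite ?V" by (rule G1.pair_finite_verts)
  have V2: "pverts G\<^sub>2 = ?V" using assms(4) by simp
  have "(1 :: nat) \<le> 2 ^ (r + 3)" by simp
  with assms(5) have small: "card ?V < 2 ^ (r + 3)" by linarith
  obtain U where U: "\<And>u. unitary_gate (U u)" "\<And>u. u \<in> ?V \<Longrightarrow> rigid (U u)"
    "graph_state G\<^sub>2 = ?L U (graph_state G\<^sub>1)"
    using LU_equivalent_rigid[OF assms(2,3,4,6)] by blast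
  have "\<forall>u\<in>?V. \<exists>\<alpha> \<theta> P Q. norm \<alpha> = 1 \<and> P \<in> generated_gates 1 \<and> Q \<in> generated_gates 1 \<and>
    U u = \<alpha> *k (P ** Z_gate \<theta> ** Q)"
    using rigid_decomposition[OF U(1)] U(2) by blast
  then obtain \<alpha> \<theta> P Q where dec: "\<And>u. u \<in> ?V \<Longrightarrow> norm (\<alpha> u) = 1"
    "\<And>u. u \<in> ?V \<Longrightarrow> P u \<in> generated_gates 1" "\<And>u. u \<in> ?V \<Longrightarrow> Q u \<in> generated_gates 1"
    "\<And>u. u \<in> ?V \<Longrightarrow> U u = \<alpha> u *k (P u ** Z_gate (\<theta> u) ** Q u)"
    by metis
  define P' where "P' u = adjoint_gate (P u)" for u
  have P': "P' u \<in> generated_gates 1" if "u \<in> ?V" for u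
    using dec(2)[OF that] by (simp add: P'_def adjoint_in_generated_gates)
  define \<psi>1 where "\<psi>1 = ?L Q (graph_state G\<^sub>1)"
  define \<psi>2 where "\<psi>2 = ?L P' (graph_state G\<^sub>2)"
  have c1: "clifford_state ?V \<psi>1"
    unfolding \<psi>1_def using fin dec(3) G1.clifford_graph_state by (rule clifford_state_local_operator)
  have c2: "clifford_state ?V \<psi>2"
    unfolding \<psi>2_def using fin P' G2.clifford_graph_state[unfolded V2] by (rule clifford_state_local_operator)
  define k where "k = prod \<alpha> ?V"
  have norm_k: "norm k = 1" using dec(1) by (simp add: k_def prod_norm[symmetric])
  then have "k \<noteq> 0" by auto
  have PP: "P' u ** P u = mat 1" "P u ** P' u = mat 1" if "u \<in> ?V" for u
    using generated_gates_unitary[OF dec(2)[OF that]] by (simp_all add: P'_def unitary_gate_def)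
  have rel: "\<psi>2 x = k * cis (sum \<theta> x) * \<psi>1 x" if x: "x \<subseteq> ?V" for x
  proof -
    have "\<psi>2 = ?L (\<lambda>u. \<alpha> u *k (Z_gate (\<theta> u) ** Q u)) (graph_state G\<^sub>1)"
      unfolding \<psi>2_def U(3) local_operator_mult[OF fin]
    proof (rule local_operator_cong)
      fix u assume u: "u \<in> ?V"
      have "P' u ** U u = \<alpha> u *k (P' u ** P u ** (Z_gate (\<theta> u) ** Q u))"
        by (simp only: dec(4)[OF u] scale_gate_mult matrix_mul_assoc)
      then show "P' u ** U u = \<alpha> u *k (Z_gate (\<theta> u) ** Q u)" by (simp add: PP[OF u])
    qed simp
    then have "\<psi>2 x = k * ?L (\<lambda>u. Z_gate (\<theta> u)) \<psi>1 x"
      by (simp add: local_operator_scale[OF fin] local_operator_mult[OF fin] \<psi>1_def k_def)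
    then show ?thesis by (simp add: local_operator_Z_gate[OF fin x])
  qed
  obtain S :: "'a \<Rightarrow> int" and k' where
    S: "\<And>x. x \<subseteq> ?V \<Longrightarrow> \<psi>2 x = k' * cis (\<Sum>u\<in>x. of_int (S u) * (pi / 2 ^ r)) * \<psi>1 x"
    using diagonal_equivalence[OF fin small assms(1) c1 c2 \<open>k \<noteq> 0\<close> rel] by blast
  define \<theta>' where "\<theta>' u = of_int (S u) * (pi / 2 ^ r)" for u
  have S': "\<psi>2 x = k' * cis (sum \<theta>' x) * \<psi>1 x" if "x \<subseteq> ?V" for x
    using S[OF that] by (simp add: \<theta>'_def)
  have k': "mat k' \<in> generated_gates r"
  proof -
    obtain x where x: "x \<subseteq> ?V" "\<psi>1 x \<noteq> 0" using clifford_state_nonzero[OF c1] by blast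
    \<comment> \<open>Both amplitudes at \<open>x\<close> have equal modulus and phases that are
      multiples of pi / 4, so their ratio is an eighth root of unity. The rest of \<open>k'\<close>
      is a multiple of the angle pi / 2^r.\<close>
    define \<omega> where "\<omega> = \<psi>2 x / \<psi>1 x"
    have nz2: "\<psi>2 x \<noteq> 0" using rel[OF x(1)] x(2) \<open>k \<noteq> 0\<close> by simp
    have "norm (\<psi>2 x) = norm (\<psi>1 x)" using rel[OF x(1)] norm_k by (simp add: norm_mult)
    moreover have "(\<psi>1 x) ^ 8 = complex_of_real (norm (\<psi>1 x) ^ 8)"
      using G1.amplitude_phase[of Q x] dec(3) x by (simp add: \<psi>1_def)
    moreover have "(\<psi>2 x) ^ 8 = complex_of_real (norm (\<psi>2 x) ^ 8)"
      using G2.amplitude_phase[of P' x] P' x(1) nz2 by (simp add: \<psi>2_def V2)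
    ultimately have "\<omega> ^ 8 = 1" using x(2) by (simp add: \<omega>_def power_divide)
    moreover have "(\<lambda>k. cis (2 * pi * real k / real 8)) ` {..<8} = {z. z ^ 8 = 1}"
      using bij_betw_imp_surj_on[OF Complex.bij_betw_roots_unity[of 8]] by simp
    ultimately obtain n where "\<omega> = cis (2 * pi * real n / real 8)" by blast
    then have \<omega>: "\<omega> = cis (pi / 4) ^ n" by (simp add: Complex.DeMoivre mult_ac)
    have "k' = \<omega> * cis (- sum \<theta>' x)"
      using S'[OF x(1)] x(2) by (simp add: \<omega>_def cis_mult mult.assoc)
    moreover have "- sum \<theta>' x = of_int (- sum S x) * (pi / 2 ^ r)"
      unfolding \<theta>'_def sum_distrib_right[symmetric] by simp
    ultimately have "mat k' = (mat (cis (pi / 4) ^ n) ** mat (cis (of_int (- sum S x) * (pi / 2 ^ r))) :: gate)"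
      by (simp only: mat_mult_mat \<omega>)
    then show ?thesis
      by (simp only: generated_gates.mult mat_power_in_generated_gates mat_cis_in_generated_gates[OF assms(1)])
  qed
  \<comment> \<open>The scalar \<open>k'\<close> is assigned to the gate at a single vertex, which
    is why the empty vertex set is treated apart.\<close>
  obtain u0 where u0: "u0 \<in> ?V" using False by blast
  define c where "c u = (if u = u0 then k' else 1)" for u
  define U' where "U' u = mat (c u) ** (P u ** Z_gate (\<theta>' u) ** Q u)" for u
  have "prod c ?V = k'" unfolding c_def using fin u0 by simp
  have "\<psi>2 = (\<lambda>x. k' * ?L (\<lambda>u. Z_gate (\<theta>' u)) \<psi>1 x)"
  proof
    fix x show "\<psi>2 x = k' * ?L (\<lambda>u. Z_gate (\<theta>' u)) \<psi>1 x"
      using S' by (cases "x \<subseteq> ?V") (simp_all add: local_operator_Z_gate[OF fin] \<psi>2_def local_operator_outside)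
  qed
  moreover have "?L P \<psi>2 = graph_state G\<^sub>2"
  proof -
    have "?L P \<psi>2 = ?L (\<lambda>_. mat 1) (graph_state G\<^sub>2)"
      unfolding \<psi>2_def local_operator_mult[OF fin] using PP by (intro local_operator_cong) auto
    also have "\<dots> = graph_state G\<^sub>2"
      by (rule local_operator_mat_1[OF fin]) (simp add: graph_state_def V2)
    finally show ?thesis .
  qed
  ultimately have "graph_state G\<^sub>2 = (\<lambda>x. k' * ?L P (?L (\<lambda>u. Z_gate (\<theta>' u)) \<psi>1) x)"
    by (metis local_operator_scale_state)
  also have "\<dots> = ?L U' (graph_state G\<^sub>1)"
    using \<open>prod c ?V = k'\<close>
    by (simp add: U'_def[abs_def] mat_mult_gate local_operator_scale[OF fin] local_operator_mult[OF fin]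
        \<psi>1_def matrix_mul_assoc scale_gate_mult fun_eq_iff)
  finally have "graph_state G\<^sub>2 = ?L U' (graph_state G\<^sub>1)" .
  moreover have "U' u \<in> generated_gates r" if "u \<in> ?V" for u
  proof -
    have "mat (c u) \<in> generated_gates r" using k' by (simp add: c_def generated_gates.one)
    moreover have "Z_gate (\<theta>' u) \<in> generated_gates r"
      unfolding \<theta>'_def by (rule Z_gate_int_multiple_in_generated_gates)
    ultimately show ?thesis
      unfolding U'_def using dec(2,3)[OF that] generated_gates_mono[OF assms(1)]
      by (intro generated_gates.mult) auto
  qed
  ultimately show ?thesis using assms(4) unfolding LC_equivalent_def by blast
qed

end
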